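(* Let $\mathcal{W}$ be a codimension one $k$-web on the complex projective space $\mathbb{P}^{N}$, $N\ge 2$, of degree $d$ and with finite automorphism group. Then $$|\mathrm{Aut}(\mathcal{W})|\le (d+2k)^{(N+1)^{2}-1}.$$
   Context: A codimension one $k$-web $\mathcal{W}$ on a smooth complex variety $X$ of dimension $n>1$ is given by an open covering $\{U_i\}$ of $X$ and $k$-symmetric $1$-forms $\omega_i\in\mathrm{Sym}^k\Omega^1_X(U_i)$ such that: (1) on each non-empty $U_i\cap U_j$ there is a nowhere vanishing function $g_{ij}\in\mathcal{O}_{U_i\cap U_j}$ with $\omega_i=g_{ij}\omega_j$; (2) the zero set of each $\omega_i$ has codimension at least two; (3) for every $i$ and generic $x\in U_i$, the germ of $\omega_i$ at $x$, seen as a homogeneous polynomial of degree $k$ in $\mathcal{O}_x[dx_1,\dots,dx_n]$, is square-free; (4) for every $i$ and generic $x\in U_i$, the germ of $\omega_i$ at $x$ is a product $\beta_1\cdots\beta_k$ of $k$ germs of $1$-forms satisfying $\beta_j\wedge d\beta_j=0$. The $\omega_i$ patch to a global section $\omega\in \mathrm{H}^0(X,\mathrm{Sym}^k\Omega^1_X\otimes\mathcal{L})$, where $\mathcal{L}$ is the line bundle determined by the cocycle $\{g_{ij}\}$; two such sections define the same web if and only if they differ by multiplication by an element of $\mathrm{H}^0(X,\mathcal{O}_X^* )$. For $X=\mathbb{P}^N$, the degree $d=\deg(\mathcal{W})$ is the degree of the tangency locus between $\mathcal{W}$ and a generic line $i:\mathbb{P}^1\hookrightarrow\mathbb{P}^N$,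 i.e. the degree of the zero divisor of $i^*\omega\in \mathrm{H}^0(\mathbb{P}^1,\mathrm{Sym}^k\Omega^1_{\mathbb{P}^1}\otimes\mathcal{L}|_{\mathbb{P}^1})$; equivalently $\mathcal{L}=\mathcal{O}_{\mathbb{P}^N}(d+2k)$. $\mathrm{Aut}(\mathcal{W})$ is the group of those $T\in\mathrm{Aut}(\mathbb{P}^N)$ such that $T^*\omega$ determines the same web $\mathcal{W}$. *)

theory Defs
  imports "HOL-Complex_Analysis.Complex_Analysis"
begin

section \<open>Holomorphic functions and forms on open subsets of complex affine space\<close>

text \<open>Everything is holomorphic: open sets are open for the Euclidean topology, and germs are
  germs of holomorphic objects.\<close>

definition holo_on :: "(complex ^ 'a::finite) set \<Rightarrow> (complex ^ 'a \<Rightarrow> complex) \<Rightarrow> bool" where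
  "holo_on V f \<longleftrightarrow>
     (\<forall>x\<in>V. \<exists>D. (f has_derivative D) (at x) \<and> (\<forall>c v. D (c *s v) = c * D v))"

definition monomial :: "('a::finite \<Rightarrow> nat) \<Rightarrow> complex ^ 'a \<Rightarrow> complex" where
  "monomial I v = (\<Prod>i\<in>UNIV. (v $ i) ^ I i)"

text \<open>A polynomial in \<open>dx\<^sub>1, \<dots>, dx\<^sub>n\<close> with coefficients in \<open>\<O>(V)\<close> is represented by the function
  \<open>p x v\<close> of a point \<open>x\<close> and a tangent vector \<open>v\<close>, where \<open>dx\<^sub>i\<close> evaluates to \<open>v $ i\<close>.\<close>

definition diff_poly :: "(complex ^ 'a::finite) set \<Rightarrow> (complex ^ 'a \<Rightarrow> complex ^ 'a \<Rightarrow> complex) \<Rightarrow> bool"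
  where
  "diff_poly V p \<longleftrightarrow>
     (\<exists>S a. finite S \<and> (\<forall>I\<in>S. holo_on V (a I)) \<and>
        (\<forall>x\<in>V. \<forall>v. p x v = (\<Sum>I\<in>S. a I x * monomial I v)))"

definition sym_form :: "nat \<Rightarrow> (complex ^ 'a::finite) set \<Rightarrow> (complex ^ 'a \<Rightarrow> complex ^ 'a \<Rightarrow> complex) \<Rightarrow> bool"
  where
  "sym_form k V f \<longleftrightarrow>
     (\<exists>a. (\<forall>I\<in>{I. sum I UNIV = k}. holo_on V (a I)) \<and>
        (\<forall>x\<in>V. \<forall>v. f x v = (\<Sum>I\<in>{I. sum I UNIV = k}. a I x * monomial I v)))"

text \<open>Square-freeness of the germ at \<open>y\<close> in the ring \<open>\<O>\<^sub>y[dx\<^sub>1, \<dots>, dx\<^sub>n]\<close>: every \<open>p\<close> whose square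
  divides the germ is a unit of that ring.\<close>

definition squarefree_germ :: "(complex ^ 'a::finite \<Rightarrow> complex ^ 'a \<Rightarrow> complex) \<Rightarrow> complex ^ 'a \<Rightarrow> bool"
  where
  "squarefree_germ f y \<longleftrightarrow>
     (\<forall>W p q. open W \<and> y \<in> W \<and> diff_poly W p \<and> diff_poly W q \<and>
        (\<forall>x\<in>W. \<forall>v. f x v = (p x v)\<^sup>2 * q x v) \<longrightarrow>
        (\<exists>W' r. open W' \<and> y \<in> W' \<and> W' \<subseteq> W \<and> diff_poly W' r \<and>
           (\<forall>x\<in>W'. \<forall>v. p x v * r x v = 1)))"

text \<open>The exterior derivative of a 1-form \<open>\<beta>\<close>, evaluated on two constant vector fields.\<close>

definition ext_deriv :: "(complex ^ 'a::finite \<Rightarrow> complex ^ 'a \<Rightarrow> complex)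
    \<Rightarrow> complex ^ 'a \<Rightarrow> complex ^ 'a \<Rightarrow> complex ^ 'a \<Rightarrow> complex" where
  "ext_deriv \<beta> x u v =
     frechet_derivative (\<lambda>y. \<beta> y v) (at x) u - frechet_derivative (\<lambda>y. \<beta> y u) (at x) v"

definition integrable_form :: "(complex ^ 'a::finite) set \<Rightarrow> (complex ^ 'a \<Rightarrow> complex ^ 'a \<Rightarrow> complex) \<Rightarrow> bool"
  where
  "integrable_form V \<beta> \<longleftrightarrow>
     (\<forall>x\<in>V. \<forall>u v w. \<beta> x u * ext_deriv \<beta> x v w + \<beta> x v * ext_deriv \<beta> x w u
                    + \<beta> x w * ext_deriv \<beta> x u v = 0)"

definition integrable_product_germ ::
    "nat \<Rightarrow> (complex ^ 'a::finite \<Rightarrow> complex ^ 'a \<Rightarrow> complex) \<Rightarrow> complex ^ 'a \<Rightarrow> bool" where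
  "integrable_product_germ k f y \<longleftrightarrow>
     (\<exists>W \<beta>. open W \<and> y \<in> W \<and> (\<forall>j<k. sym_form 1 W (\<beta> j) \<and> integrable_form W (\<beta> j)) \<and>
        (\<forall>x\<in>W. \<forall>v. f x v = (\<Prod>j<k. \<beta> j x v)))"

text \<open>The dimension of an analytic set is the largest dimension of a (locally closed) complex
  submanifold it contains. Locally, a submanifold of codimension \<open>c\<close> is the common zero set of \<open>c\<close>
  holomorphic functions with linearly independent differentials.\<close>

definition contains_submanifold :: "nat \<Rightarrow> (complex ^ 'a::finite) set \<Rightarrow> bool" where
  "contains_submanifold c Z \<longleftrightarrow>
     (\<exists>V y (f :: nat \<Rightarrow> complex ^ 'a \<Rightarrow> complex).
        open V \<and> y \<in> V \<and> (\<forall>j<c. holo_on V (f j) \<and> f j y = 0) \<and>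
        (\<forall>x\<in>V. \<forall>a. (\<forall>v. (\<Sum>j<c. a j * frechet_derivative (f j) (at x) v) = 0) \<longrightarrow> (\<forall>j<c. a j = 0)) \<and>
        {x \<in> V. \<forall>j<c. f j x = 0} \<subseteq> Z)"

definition codim_at_least :: "nat \<Rightarrow> (complex ^ 'a::finite) set \<Rightarrow> bool" where
  "codim_at_least m Z \<longleftrightarrow> (\<forall>c<m. \<not> contains_submanifold c Z)"

definition analytic_subset :: "(complex ^ 'a::finite) set \<Rightarrow> (complex ^ 'a) set \<Rightarrow> bool" where
  "analytic_subset V Z \<longleftrightarrow> Z \<subseteq> V \<and>
     (\<forall>x\<in>V. \<exists>W F. open W \<and> x \<in> W \<and> W \<subseteq> V \<and> finite F \<and> (\<forall>f\<in>F. holo_on W f) \<and>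
        Z \<inter> W = {y \<in> W. \<forall>f\<in>F. f y = 0})"

text \<open>A property holds for generic \<open>x\<close> if it holds off a nowhere dense analytic subset.\<close>

definition generically :: "(complex ^ 'a::finite) set \<Rightarrow> (complex ^ 'a \<Rightarrow> bool) \<Rightarrow> bool" where
  "generically V P \<longleftrightarrow>
     (\<exists>Z. analytic_subset V Z \<and> V \<subseteq> closure (V - Z) \<and> (\<forall>x\<in>V - Z. P x))"


section \<open>Complex projective space and its tangent bundle\<close>

text \<open>With \<open>N = CARD('n)\<close>, homogeneous coordinates are indexed by the type \<open>'n option\<close>, which has
  \<open>N + 1\<close> elements.\<close>

definition proj_rel :: "complex ^ ('n::finite option) \<Rightarrow> complex ^ ('n option) \<Rightarrow> bool" where
  "proj_rel z w \<longleftrightarrow> z \<noteq> 0 \<and> w \<noteq> 0 \<and> (\<exists>c. c \<noteq> 0 \<and> w = c *s z)"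

lemma part_equivp_proj_rel: "part_equivp (proj_rel :: complex ^ ('n::finite option) \<Rightarrow> _)"
proof (rule part_equivpI)
  have "proj_rel (1 :: complex ^ ('n option)) 1"
    unfolding proj_rel_def by (auto intro!: exI[of _ 1])
  then show "\<exists>x :: complex ^ ('n option). proj_rel x x" by blast
  show "symp (proj_rel :: complex ^ ('n option) \<Rightarrow> _)"
  proof (rule sympI)
    fix z w :: "complex ^ ('n option)" assume "proj_rel z w"
    then obtain c where "z \<noteq> 0" "w \<noteq> 0" "c \<noteq> 0" "w = c *s z" unfolding proj_rel_def by blast
    then show "proj_rel w z"
      unfolding proj_rel_def by (auto intro!: exI[of _ "inverse c"] simp: vector_smult_assoc)
  qed
  show "transp (proj_rel :: complex ^ ('n option) \<Rightarrow> _)"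
  proof (rule transpI)
    fix x y z :: "complex ^ ('n option)" assume "proj_rel x y" "proj_rel y z"
    then obtain b c where "x \<noteq> 0" "z \<noteq> 0" "b \<noteq> 0" "c \<noteq> 0" "y = b *s x" "z = c *s y"
      unfolding proj_rel_def by blast
    then show "proj_rel x z"
      unfolding proj_rel_def by (auto intro!: exI[of _ "c * b"] simp: vector_smult_assoc)
  qed
qed

quotient_type 'n proj = "complex ^ ('n::finite option)" / partial: proj_rel
  morphisms rep_proj ppt
  by (rule part_equivp_proj_rel)

text \<open>For \<open>z \<noteq> 0\<close>, the class of the pair \<open>(z, v)\<close> is the tangent vector at \<open>ppt z\<close> of the curve
  \<open>t \<mapsto> ppt (z + t *s v)\<close>. This is the presentation of the tangent bundle by the Euler sequence: the
  tangent space at the line \<open>L\<close> is \<open>Hom (L, \<complex>\<^sup>N\<^sup>+\<^sup>1 / L)\<close>.\<close>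

definition tan_rel :: "(complex ^ ('n::finite option)) \<times> (complex ^ ('n option))
    \<Rightarrow> (complex ^ ('n option)) \<times> (complex ^ ('n option)) \<Rightarrow> bool" where
  "tan_rel p q \<longleftrightarrow> fst p \<noteq> 0 \<and> fst q \<noteq> 0 \<and>
     (\<exists>c \<mu>. c \<noteq> 0 \<and> fst q = c *s fst p \<and> snd q = c *s snd p + \<mu> *s fst p)"

lemma part_equivp_tan_rel:
  "part_equivp (tan_rel :: (complex ^ ('n::finite option)) \<times> (complex ^ ('n option)) \<Rightarrow> _)"
proof (rule part_equivpI)
  have "tan_rel (1 :: complex ^ ('n option), 0) (1, 0)"
    unfolding tan_rel_def by (intro conjI exI[of _ 1] exI[of _ 0]) auto
  then show "\<exists>x :: (complex ^ ('n option)) \<times> (complex ^ ('n option)). tan_rel x x" by blast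
  show "symp (tan_rel :: (complex ^ ('n option)) \<times> (complex ^ ('n option)) \<Rightarrow> _)"
  proof (rule sympI)
    fix p q :: "(complex ^ ('n option)) \<times> (complex ^ ('n option))" assume "tan_rel p q"
    then obtain c \<mu> where *: "fst p \<noteq> 0" "fst q \<noteq> 0" "c \<noteq> 0" "fst q = c *s fst p"
        "snd q = c *s snd p + \<mu> *s fst p"
      unfolding tan_rel_def by blast
    have "fst p = inverse c *s fst q" using * by (simp add: vector_smult_assoc)
    moreover have "snd p = inverse c *s snd q + (- \<mu> / c\<^sup>2) *s fst q"
      using * by (simp add: vec_eq_iff field_simps power2_eq_square)
    ultimately show "tan_rel q p"
      unfolding tan_rel_def using * by (metis inverse_nonzero_iff_nonzero)
  qed
  show "transp (tan_rel :: (complex ^ ('n option)) \<times> (complex ^ ('n option)) \<Rightarrow> _)"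
  proof (rule transpI)
    fix x y z :: "(complex ^ ('n option)) \<times> (complex ^ ('n option))"
    assume "tan_rel x y" "tan_rel y z"
    then obtain b \<mu> c \<nu> where *: "fst x \<noteq> 0" "fst z \<noteq> 0" "b \<noteq> 0" "c \<noteq> 0"
        "fst y = b *s fst x" "snd y = b *s snd x + \<mu> *s fst x"
        "fst z = c *s fst y" "snd z = c *s snd y + \<nu> *s fst y"
      unfolding tan_rel_def by blast
    have "fst z = (c * b) *s fst x" using * by (simp add: vector_smult_assoc)
    moreover have "snd z = (c * b) *s snd x + (c * \<mu> + \<nu> * b) *s fst x"
      using * by (simp add: vec_eq_iff algebra_simps)
    moreover have "c * b \<noteq> 0" using * by simp
    ultimately show "tan_rel x z"
      unfolding tan_rel_def using * by blast
  qed
qed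

quotient_type 'n ptangent = "(complex ^ ('n::finite option)) \<times> (complex ^ ('n option))" / partial: tan_rel
  morphisms rep_ptangent ptan
  by (rule part_equivp_tan_rel)

definition base_point :: "'n::finite ptangent \<Rightarrow> 'n proj" where
  "base_point \<tau> = ppt (fst (rep_ptangent \<tau>))"

instantiation proj :: (finite) topological_space
begin

definition open_proj :: "'a proj set \<Rightarrow> bool" where
  "open_proj U \<longleftrightarrow> open {z. z \<noteq> 0 \<and> ppt z \<in> U}"

instance
proof
  show "open (UNIV :: 'a proj set)"
    using open_Compl[of "{0 :: complex ^ ('a option)}"]
    by (simp add: open_proj_def Compl_eq)
  fix S T :: "'a proj set"
  assume "open S" "open T"
  moreover have "{z. z \<noteq> 0 \<and> ppt z \<in> S \<inter> T} = {z. z \<noteq> 0 \<and> ppt z \<in> S} \<inter> {z. z \<noteq> 0 \<and> ppt z \<in> T}"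
    by auto
  ultimately show "open (S \<inter> T)"
    unfolding open_proj_def by (simp only: open_Int)
next
  fix K :: "'a proj set set"
  assume "\<forall>S\<in>K. open S"
  moreover have "{z. z \<noteq> 0 \<and> ppt z \<in> \<Union>K} = (\<Union>S\<in>K. {z. z \<noteq> 0 \<and> ppt z \<in> S})"
    by auto
  ultimately show "open (\<Union>K)"
    unfolding open_proj_def by (metis (no_types, lifting) open_UN)
qed

end

text \<open>The affine charts: \<open>x\<close> is sent to the point \<open>[1 : x\<^sub>1 : \<dots> : x\<^sub>N]\<close>, followed by a projective
  linear transformation \<open>A\<close>. The maps \<open>chart A\<close>, with \<open>A\<close> invertible, parametrize the complements of
  the hyperplanes and form a holomorphic atlas; \<open>tan_chart A x\<close> is the differential of \<open>chart A\<close> at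
  \<open>x\<close>.\<close>

definition aff_point :: "complex ^ 'n::finite \<Rightarrow> complex ^ ('n option)" where
  "aff_point x = (\<chi> i. case i of None \<Rightarrow> 1 | Some j \<Rightarrow> x $ j)"

definition aff_vector :: "complex ^ 'n::finite \<Rightarrow> complex ^ ('n option)" where
  "aff_vector v = (\<chi> i. case i of None \<Rightarrow> 0 | Some j \<Rightarrow> v $ j)"

definition chart :: "complex ^ ('n::finite option) ^ ('n option) \<Rightarrow> complex ^ 'n \<Rightarrow> 'n proj" where
  "chart A x = ppt (A *v aff_point x)"

definition tan_chart ::
    "complex ^ ('n::finite option) ^ ('n option) \<Rightarrow> complex ^ 'n \<Rightarrow> complex ^ 'n \<Rightarrow> 'n ptangent" where
  "tan_chart A x v = ptan (A *v aff_point x, A *v aff_vector v)"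

definition holo_fun :: "'n::finite proj set \<Rightarrow> ('n proj \<Rightarrow> complex) \<Rightarrow> bool" where
  "holo_fun U g \<longleftrightarrow> (\<forall>A. invertible A \<longrightarrow> holo_on (chart A -` U) (\<lambda>x. g (chart A x)))"

text \<open>\<open>F\<close> is the expression, in the charts \<open>A\<close> and \<open>B\<close> and on the open set \<open>W\<close>, of the self-map \<open>T\<close> of
  projective space.\<close>

definition chart_expression :: "('n::finite proj \<Rightarrow> 'n proj) \<Rightarrow>
    complex ^ ('n option) ^ ('n option) \<Rightarrow> complex ^ ('n option) ^ ('n option) \<Rightarrow>
    (complex ^ 'n) set \<Rightarrow> (complex ^ 'n \<Rightarrow> complex ^ 'n) \<Rightarrow> bool" where
  "chart_expression T A B W F \<longleftrightarrow>
     invertible A \<and> invertible B \<and> open W \<and> (\<forall>i. holo_on W (\<lambda>x. F x $ i)) \<and>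
     (\<forall>x\<in>W. T (chart A x) = chart B (F x))"

definition holo_map :: "('n::finite proj \<Rightarrow> 'n proj) \<Rightarrow> bool" where
  "holo_map T \<longleftrightarrow> (\<forall>A x. invertible A \<longrightarrow> (\<exists>B W F. x \<in> W \<and> chart_expression T A B W F))"

definition proj_differential :: "('n::finite proj \<Rightarrow> 'n proj) \<Rightarrow> 'n ptangent \<Rightarrow> 'n ptangent" where
  "proj_differential T \<tau> = (THE \<sigma>. \<exists>A B W F x v. chart_expression T A B W F \<and> x \<in> W \<and>
     \<tau> = tan_chart A x v \<and> \<sigma> = tan_chart B (F x) (frechet_derivative F (at x) v))"

definition proj_Aut :: "('n::finite proj \<Rightarrow> 'n proj) set" where
  "proj_Aut = {T. bij T \<and> holo_map T \<and> holo_map (inv T)}"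

definition generically_proj :: "'n::finite proj set \<Rightarrow> ('n proj \<Rightarrow> bool) \<Rightarrow> bool" where
  "generically_proj U P \<longleftrightarrow>
     (\<exists>Z\<subseteq>U. (\<forall>A. invertible A \<longrightarrow> analytic_subset (chart A -` U) (chart A -` Z)) \<and>
        U \<subseteq> closure (U - Z) \<and> (\<forall>x\<in>U - Z. P x))"


section \<open>Codimension one webs on projective space\<close>

text \<open>A symmetric form on an open subset of projective space is a function on tangent vectors. Its
  values at tangent vectors based outside the open set are irrelevant.\<close>

definition local_form :: "complex ^ ('n::finite option) ^ ('n option) \<Rightarrow> ('n ptangent \<Rightarrow> complex)
    \<Rightarrow> complex ^ 'n \<Rightarrow> complex ^ 'n \<Rightarrow> complex" where
  "local_form A \<omega> x v = \<omega> (tan_chart A x v)"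

definition proj_sym_form :: "nat \<Rightarrow> 'n::finite proj set \<Rightarrow> ('n ptangent \<Rightarrow> complex) \<Rightarrow> bool" where
  "proj_sym_form k U \<omega> \<longleftrightarrow> (\<forall>A. invertible A \<longrightarrow> sym_form k (chart A -` U) (local_form A \<omega>))"

definition form_zeros :: "'n::finite proj set \<Rightarrow> ('n ptangent \<Rightarrow> complex) \<Rightarrow> 'n proj set" where
  "form_zeros U \<omega> = {x \<in> U. \<forall>\<tau>. base_point \<tau> = x \<longrightarrow> \<omega> \<tau> = 0}"

definition unit_multiple ::
    "'n::finite proj set \<Rightarrow> ('n ptangent \<Rightarrow> complex) \<Rightarrow> ('n ptangent \<Rightarrow> complex) \<Rightarrow> bool" where
  "unit_multiple U \<omega> \<eta> \<longleftrightarrow>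
     (\<exists>g. holo_fun U g \<and> (\<forall>x\<in>U. g x \<noteq> 0) \<and>
        (\<forall>\<tau>. base_point \<tau> \<in> U \<longrightarrow> \<omega> \<tau> = g (base_point \<tau>) * \<eta> \<tau>))"

definition is_web :: "nat \<Rightarrow> ('i \<Rightarrow> 'n::finite proj set) \<Rightarrow> ('i \<Rightarrow> 'n ptangent \<Rightarrow> complex) \<Rightarrow> bool" where
  "is_web k U \<omega> \<longleftrightarrow>
     (\<forall>i. open (U i)) \<and> (\<Union>i. U i) = UNIV \<and>
     (\<forall>i. proj_sym_form k (U i) (\<omega> i)) \<and>
     (\<forall>i j. unit_multiple (U i \<inter> U j) (\<omega> i) (\<omega> j)) \<and>
     (\<forall>i A. invertible A \<longrightarrow> codim_at_least 2 (chart A -` form_zeros (U i) (\<omega> i))) \<and>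
     (\<forall>i. generically_proj (U i)
        (\<lambda>x. \<forall>A y. invertible A \<and> chart A y = x \<longrightarrow> squarefree_germ (local_form A (\<omega> i)) y)) \<and>
     (\<forall>i. generically_proj (U i)
        (\<lambda>x. \<forall>A y. invertible A \<and> chart A y = x \<longrightarrow> integrable_product_germ k (local_form A (\<omega> i)) y))"

text \<open>Two families of local forms define the same web if and only if they agree, on the common
  refinement of the two coverings, up to nowhere vanishing holomorphic functions. These functions
  identify the two line bundles, and the two global sections then correspond up to a global unit.\<close>

definition same_web :: "('i \<Rightarrow> 'n::finite proj set) \<Rightarrow> ('i \<Rightarrow> 'n ptangent \<Rightarrow> complex) \<Rightarrow>
    ('j \<Rightarrow> 'n proj set) \<Rightarrow> ('j \<Rightarrow> 'n ptangent \<Rightarrow> complex) \<Rightarrow> bool" where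
  "same_web U \<omega> V \<eta> \<longleftrightarrow> (\<forall>i j. unit_multiple (U i \<inter> V j) (\<omega> i) (\<eta> j))"

definition web_Aut ::
    "('i \<Rightarrow> 'n::finite proj set) \<Rightarrow> ('i \<Rightarrow> 'n ptangent \<Rightarrow> complex) \<Rightarrow> ('n proj \<Rightarrow> 'n proj) set" where
  "web_Aut U \<omega> = {T \<in> proj_Aut.
     same_web (\<lambda>i. T -` U i) (\<lambda>i \<tau>. \<omega> i (proj_differential T \<tau>)) U \<omega>}"


section \<open>The degree of a web\<close>

text \<open>The line through \<open>ppt p\<close> and \<open>ppt q\<close> consists of the points \<open>ppt (p + t *s q)\<close> with \<open>t\<close> a
  complex number, and of \<open>ppt q\<close>, the point at infinity, near which \<open>s \<mapsto> ppt (q + s *s p)\<close> is a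
  coordinate. In the coordinate \<open>t\<close> the restriction of \<open>\<omega>\<close> to the line is \<open>h(t) dt\<^sup>k\<close> with
  \<open>h t = \<omega> (ptan (p + t *s q, q))\<close>.\<close>

definition line_restriction ::
    "('n::finite ptangent \<Rightarrow> complex) \<Rightarrow> complex ^ ('n option) \<Rightarrow> complex ^ ('n option) \<Rightarrow> complex \<Rightarrow> complex"
  where
  "line_restriction \<omega> p q t = \<omega> (ptan (p + t *s q, q))"

definition tangency_points :: "('i \<Rightarrow> 'n::finite proj set) \<Rightarrow> ('i \<Rightarrow> 'n ptangent \<Rightarrow> complex) \<Rightarrow>
    complex ^ ('n option) \<Rightarrow> complex ^ ('n option) \<Rightarrow> complex set" where
  "tangency_points U \<omega> p q =
     {t. \<exists>i. ppt (p + t *s q) \<in> U i \<and> line_restriction (\<omega> i) p q t = 0}"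

definition tangency_order :: "('i \<Rightarrow> 'n::finite proj set) \<Rightarrow> ('i \<Rightarrow> 'n ptangent \<Rightarrow> complex) \<Rightarrow>
    complex ^ ('n option) \<Rightarrow> complex ^ ('n option) \<Rightarrow> complex \<Rightarrow> int" where
  "tangency_order U \<omega> p q t =
     zorder (line_restriction (\<omega> (SOME i. ppt (p + t *s q) \<in> U i)) p q) t"

text \<open>Finiteness of the set of zeros expresses that the restriction to the line is not identically
  zero, so that it has a zero divisor. The last summand is the contribution of the point at
  infinity; it is zero if the restriction does not vanish there.\<close>

definition tangency_degree :: "('i \<Rightarrow> 'n::finite proj set) \<Rightarrow> ('i \<Rightarrow> 'n ptangent \<Rightarrow> complex) \<Rightarrow>
    complex ^ ('n option) \<Rightarrow> complex ^ ('n option) \<Rightarrow> nat \<Rightarrow> bool" where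
  "tangency_degree U \<omega> p q d \<longleftrightarrow>
     finite (tangency_points U \<omega> p q) \<and>
     int d = (\<Sum>t\<in>tangency_points U \<omega> p q. tangency_order U \<omega> p q t) + tangency_order U \<omega> q p 0"

text \<open>Pairs of vectors spanning a line are encoded as vectors indexed by a disjoint sum, so that
  generic lines can be expressed by generic pairs.\<close>

definition line_pairs :: "(complex ^ ('n::finite option + 'n option)) set" where
  "line_pairs = {w. \<forall>a b. a *s (\<chi> i. w $ Inl i) + b *s (\<chi> i. w $ Inr i) = (0 :: complex ^ ('n option))
                     \<longrightarrow> a = 0 \<and> b = 0}"

definition web_degree ::
    "('i \<Rightarrow> 'n::finite proj set) \<Rightarrow> ('i \<Rightarrow> 'n ptangent \<Rightarrow> complex) \<Rightarrow> nat \<Rightarrow> bool" where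
  "web_degree U \<omega> d \<longleftrightarrow>
     generically line_pairs (\<lambda>w. tangency_degree U \<omega> (\<chi> i. w $ Inl i) (\<chi> i. w $ Inr i) d)"

end

theory Submission
  imports Defs "HOL-Real_Asymp.Real_Asymp" "HOL-Computational_Algebra.Fundamental_Theorem_Algebra"
begin

text \<open>
  Write \<open>E\<close> for the nonzero vectors of \<open>\<complex>\<^sup>N\<^sup>+\<^sup>1\<close> and \<open>D = d + 2k\<close>. The bound is a Bezout estimate for a finite
  group of matrices, applied to a polynomial that represents the web.

  \<^item> The web is given by one form \<open>F z v\<close> on \<open>E\<close>, polynomial in the point \<open>z\<close> and the tangent vector
    \<open>v\<close>, with \<open>F (c z) (c v) = c\<^sup>D F z v\<close>; on each \<open>U i\<close> it is \<open>\<omega> i\<close> times a holomorphic unit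
    (\<open>web_polynomial_form\<close>). Evaluating the \<open>\<omega> i\<close> at a constant vector \<open>q\<close> gives local
    equations, with unit transition functions, of a divisor on \<open>E\<close> that is invariant under scaling.
    Restricted to the lines of a fixed direction outside its support, such a divisor has
    finitely many points, and the monic polynomial with these roots is a global equation: its
    coefficients are holomorphic by the argument principle and polynomial by homogeneity. Dividing
    it by the local equations yields units that glue the \<open>\<omega> i\<close>. So the line bundle is identified
    without computing a Picard group. Counting zeros on the generic line of the degree
    hypothesis gives the exponent \<open>D\<close>.
  \<^item> The same construction, applied to the local lifts of a holomorphic self-map of projective space,
    lifts the map to a homogeneous polynomial map of \<open>E\<close>. For an automorphism and its inverse the
    degrees of the lifts multiply to one, so automorphisms are linear (\<open>proj_Aut_linear\<close>).
  \<^item> A linear automorphism \<open>A\<close> preserves the web iff \<open>F (A z) (A v) = c F z v\<close> for a constant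
    \<open>c \<noteq> 0\<close>, because the ratio of the two sides is a holomorphic function on projective space
    (\<open>symmetry_in_web_Aut\<close>, \<open>web_Aut_symmetry\<close>). Scaling \<open>A\<close> makes \<open>c = 1\<close>, and this can be done in
    \<open>D\<close> ways. Hence \<open>D |Aut| = |G|\<close> for the group \<open>G\<close> of matrices that preserve \<open>F\<close>.
  \<^item> \<open>G\<close> is cut out by polynomials of degree \<open>D\<close> in the \<open>(N+1)\<^sup>2\<close> entries of \<open>A\<close>. If the linearized
    equations at the identity had a solution \<open>X \<noteq> 0\<close>, then \<open>exp (t X)\<close> would lie in \<open>G\<close> for all small \<open>t\<close>,
    which is impossible for a finite \<open>G\<close>. So \<open>(N+1)\<^sup>2\<close> of the equations define a map that is locally
    open at the identity and, by translation, at each point of \<open>G\<close>. The elements of \<open>G\<close> are then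
    isolated points of one fibre, and there are at most \<open>D\<close> to the power \<open>(N+1)\<^sup>2\<close> of them
    (\<open>isolated_fibre_card_le\<close>, \<open>symmetry_matrices_card_le\<close>).
\<close>

unbundle no Formal_Power_Series.fps_syntax

section \<open>Holomorphic functions of several variables\<close>

lemma norm_smult_complex: "norm (c *s (v :: complex ^ 'a::finite)) = norm c * norm v"
  by (simp add: norm_vec_def norm_mult L2_set_right_distrib)

lemma bounded_linear_smult_left: "bounded_linear (\<lambda>c::complex. c *s (v :: complex ^ 'a::finite))"
  by (intro bounded_linear_intro[where K="norm v"])
     (auto simp: vec_eq_iff algebra_simps norm_smult_complex)

lemma bounded_linear_smult_right: "bounded_linear (\<lambda>v :: complex ^ 'a::finite. c *s v)"
  by (intro bounded_linear_intro[where K="norm c"])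
     (auto simp: vec_eq_iff algebra_simps norm_smult_complex)

lemma continuous_on_smult [continuous_intros]:
  fixes g :: "'b::topological_space \<Rightarrow> complex ^ 'a::finite"
  assumes "continuous_on S f" "continuous_on S g"
  shows "continuous_on S (\<lambda>x. f x *s g x)"
  using assms
  by (auto intro!: continuous_on_vec_lambda continuous_intros simp: vector_scalar_mult_def)

lemma tendsto_smult [tendsto_intros]:
  fixes g :: "'b \<Rightarrow> complex ^ 'a::finite"
  assumes "(f \<longlongrightarrow> a) F" "(g \<longlongrightarrow> b) F"
  shows "((\<lambda>x. f x *s g x) \<longlongrightarrow> a *s b) F"
  by (rule vec_tendstoI) (use assms in \<open>auto intro!: tendsto_intros\<close>)

lemma holo_on_imp_continuous_on: "holo_on V f \<Longrightarrow> continuous_on V f"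
  unfolding holo_on_def
  by (metis continuous_at_imp_continuous_on has_derivative_continuous)

lemma holo_on_subset: "holo_on V f \<Longrightarrow> W \<subseteq> V \<Longrightarrow> holo_on W f"
  unfolding holo_on_def by blast

lemma holo_on_cong:
  assumes "open V" "holo_on V f" "\<And>z. z \<in> V \<Longrightarrow> f z = g z"
  shows "holo_on V g"
  unfolding holo_on_def
proof
  fix z assume z: "z \<in> V"
  then obtain D where "(f has_derivative D) (at z)" "\<forall>c v. D (c *s v) = c * D v"
    using assms(2) unfolding holo_on_def by blast
  then show "\<exists>D. (g has_derivative D) (at z) \<and> (\<forall>c v. D (c *s v) = c * D v)"
    using has_derivative_transform_within_open[of f D z UNIV V g] assms(1,3) z by auto
qed

lemma holo_on_compose_line:
  assumes "holo_on V f" "z + t *s v \<in> V"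
  shows "(\<lambda>t. f (z + t *s v)) field_differentiable (at t)"
proof -
  obtain D where D: "(f has_derivative D) (at (z + t *s v))" "\<And>c v. D (c *s v) = c * D v"
    using assms unfolding holo_on_def by blast
  have "((\<lambda>t. z + t *s v) has_derivative (\<lambda>h. h *s v)) (at t)"
    by (auto intro!: derivative_eq_intros bounded_linear.has_derivative[OF bounded_linear_smult_left])
  from diff_chain_at[OF this D(1)]
  have "((\<lambda>t. f (z + t *s v)) has_derivative (\<lambda>h. D v * h)) (at t)"
    by (simp add: o_def D(2) mult.commute)
  then show ?thesis
    unfolding field_differentiable_def has_field_derivative_def by blast
qed

lemma holo_on_compose_line_holomorphic:
  assumes "holo_on V f" "\<And>t. t \<in> S \<Longrightarrow> z + t *s v \<in> V"
  shows "(\<lambda>t. f (z + t *s v)) holomorphic_on S"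
  unfolding holomorphic_on_def
  using holo_on_compose_line[OF assms(1)] assms(2) field_differentiable_at_within by blast

lemma open_line_preimage: "open V \<Longrightarrow> open {t. z + t *s (v :: complex ^ 'a::finite) \<in> V}"
proof -
  assume "open V"
  moreover have "continuous_on UNIV (\<lambda>t. z + t *s v)" by (intro continuous_intros)
  ultimately show ?thesis using open_vimage[of V "\<lambda>t. z + t *s v"] by (simp add: vimage_def)
qed

lemma vector_derivative_circlepath_eq:
  "vector_derivative (circlepath c r) (at t) = 2 * pi * \<i> * r * exp (2 * of_real pi * \<i> * t)"
  by (simp add: vector_derivative_circlepath)

lemma continuous_on_contour_integral_circlepath:
  fixes \<phi> :: "'a::metric_space \<Rightarrow> complex \<Rightarrow> complex"
  assumes "continuous_on (\<Omega> \<times> sphere c r) (\<lambda>(z, s). \<phi> z s)" "r > 0"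
  shows "continuous_on \<Omega> (\<lambda>z. contour_integral (circlepath c r) (\<phi> z))"
proof -
  have "continuous_on (\<Omega> \<times> cbox 0 (1::real))
     (\<lambda>(z, t). \<phi> z (circlepath c r t) * (2 * pi * \<i> * r * exp (2 * of_real pi * \<i> * t)))"
  proof -
    have c: "continuous_on (\<Omega> \<times> cbox 0 (1::real)) (\<lambda>p. (fst p, circlepath c r (snd p)))"
      unfolding circlepath by (intro continuous_intros)
    have "(\<lambda>p. (fst p, circlepath c r (snd p))) ` (\<Omega> \<times> cbox 0 (1::real)) \<subseteq> \<Omega> \<times> sphere c r"
      using path_image_circlepath_nonneg[of r c] assms(2) by (auto simp: path_image_def)
    from continuous_on_compose2[OF assms(1) c this]
    show ?thesis
      unfolding case_prod_unfold by (auto intro!: continuous_intros)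
  qed
  from integral_continuous_on_param[OF this]
  show ?thesis
    by (simp add: contour_integral_integral vector_derivative_circlepath_eq)
qed

lemma exists_ball_line_subset:
  assumes "open V" "z0 \<in> V"
  obtains \<delta> r where "\<delta> > 0" "r > 0"
    "\<And>z t. z \<in> ball z0 \<delta> \<Longrightarrow> t \<in> cball 0 r \<Longrightarrow> z + t *s (v :: complex ^ 'a::finite) \<in> V"
proof -
  obtain \<epsilon> where e: "\<epsilon> > 0" "ball z0 \<epsilon> \<subseteq> V" using assms openE by blast
  define r where "r = \<epsilon> / (2 * (1 + norm v))"
  have "1 + norm v > 0" by (smt (verit) norm_ge_zero)
  then have r: "r > 0" using e by (simp add: r_def)
  have "z + t *s v \<in> V" if "z \<in> ball z0 (\<epsilon>/2)" "t \<in> cball 0 r" for z t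
  proof -
    have "norm (t *s v) \<le> r * norm v"
      using that by (auto simp: norm_smult_complex intro!: mult_right_mono)
    also have "\<dots> \<le> r * (1 + norm v)" using r by (simp add: algebra_simps)
    also have "\<dots> = \<epsilon> / 2" using \<open>1 + norm v > 0\<close> unfolding r_def by (auto simp: field_simps)
    finally have "norm (z0 - z) + norm (t *s v) < \<epsilon>" using that by (auto simp: dist_norm)
    then have "z + t *s v \<in> ball z0 \<epsilon>"
      using norm_triangle_ineq4[of "z0 - z" "t *s v"] by (auto simp: dist_norm algebra_simps)
    then show ?thesis using e by blast
  qed
  then show ?thesis using that[of "\<epsilon>/2" r] e r by auto
qed

text \<open>By Cauchy's formula the derivative along a line is an integral of the function over a circle in
  that line, and the circle can be kept fixed while the base point varies.\<close>

lemma continuous_on_directional_deriv: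
  fixes f :: "complex ^ 'a::finite \<Rightarrow> complex"
  assumes "open V" "continuous_on V f"
    and "\<And>z. z \<in> V \<Longrightarrow> (\<lambda>t. f (z + t *s v)) field_differentiable (at 0)"
  shows "continuous_on V (\<lambda>z. deriv (\<lambda>t. f (z + t *s v)) 0)"
proof (subst continuous_on_eq_continuous_at[OF assms(1)], rule ballI)
    fix z0 assume "z0 \<in> V"
    then obtain \<delta> r where d: "\<delta> > 0" "r > 0"
      and sub: "\<And>z t. z \<in> ball z0 \<delta> \<Longrightarrow> t \<in> cball 0 r \<Longrightarrow> z + t *s v \<in> V"
      using exists_ball_line_subset[OF assms(1), where v=v] by metis
    have fd: "(\<lambda>t. f (z + t *s v)) field_differentiable (at t)" if "z + t *s v \<in> V" for z t
    proof -
      have "(\<lambda>s. f ((z + t *s v) + s *s v)) field_differentiable (at 0)"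
        using assms(3)[OF that] .
      then have "((\<lambda>s. f (z + s *s v)) \<circ> (\<lambda>s. s + t)) field_differentiable (at 0)"
        by (simp add: o_def algebra_simps vector_sadd_rdistrib add.left_commute)
      then show ?thesis
        unfolding field_differentiable_def o_def using DERIV_shift[of "\<lambda>s. f (z + s *s v)" _ 0 t]
        by (simp add: add.commute)
    qed
    have eq: "deriv (\<lambda>t. f (z + t *s v)) 0 =
       1 / (2 * of_real pi * \<i>) * contour_integral (circlepath 0 r) (\<lambda>u. f (z + u *s v) / u\<^sup>2)"
      if z: "z \<in> ball z0 \<delta>" for z
    proof -
      have h: "(\<lambda>t. f (z + t *s v)) holomorphic_on cball 0 r"
        unfolding holomorphic_on_def using fd sub[OF z] field_differentiable_at_within by blast
      show ?thesis
        using Cauchy_derivative_integral_circlepath(2)[of 0 r "\<lambda>t. f (z + t *s v)" 0]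
          holomorphic_on_imp_continuous_on[OF h] holomorphic_on_subset[OF h ball_subset_cball] d
        by (auto intro!: DERIV_imp_deriv)
    qed
    have "continuous_on (ball z0 \<delta>)
        (\<lambda>z. contour_integral (circlepath 0 r) (\<lambda>u. f (z + u *s v) / u\<^sup>2))"
    proof (rule continuous_on_contour_integral_circlepath[OF _ d(2)])
      have "continuous_on (ball z0 \<delta> \<times> sphere 0 r) (\<lambda>p. f (fst p + snd p *s v))"
        by (rule continuous_on_compose2[OF assms(2)]) (use sub in \<open>auto intro!: continuous_intros\<close>)
      then show "continuous_on (ball z0 \<delta> \<times> sphere 0 r) (\<lambda>(z, s). f (z + s *s v) / s\<^sup>2)"
        unfolding case_prod_unfold using d by (auto intro!: continuous_intros)
    qed
    then have "continuous_on (ball z0 \<delta>) (\<lambda>z. deriv (\<lambda>t. f (z + t *s v)) 0)"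
      by (subst continuous_on_cong[OF refl eq]) (auto intro!: continuous_intros)
    then show "isCont (\<lambda>z. deriv (\<lambda>t. f (z + t *s v)) 0) z0"
      using d by (simp add: continuous_on_eq_continuous_at)
qed

lemma field_differentiable_line_shift:
  fixes z v :: "complex ^ 'a::finite"
  assumes "(\<lambda>s. f ((z + t *s v) + s *s v)) field_differentiable (at 0)"
  shows "((\<lambda>s. f (z + s *s v)) has_field_derivative deriv (\<lambda>s. f ((z + t *s v) + s *s v)) 0) (at t)"
proof -
  have "(\<lambda>s. f ((z + t *s v) + s *s v)) = (\<lambda>s. f (z + (s + t) *s v))"
    by (simp add: algebra_simps vector_sadd_rdistrib add.left_commute)
  then show ?thesis
    using assms field_differentiable_derivI[OF assms] DERIV_shift[of "\<lambda>s. f (z + s *s v)" _ 0 t]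
    by (simp add: add.commute)
qed

text \<open>Osgood's lemma: a continuous function that is holomorphic along complex lines is complex
  differentiable. Its partial derivatives are Cauchy integrals of the function itself, hence
  continuous, and continuous partial derivatives give a total derivative by moving one coordinate
  at a time.\<close>

lemma holo_onI:
  fixes f :: "complex ^ 'a::finite \<Rightarrow> complex"
  assumes V: "open V" and cont: "continuous_on V f"
    and line: "\<And>z v. z \<in> V \<Longrightarrow> (\<lambda>t. f (z + t *s v)) field_differentiable (at 0)"
  shows "holo_on V f"
  unfolding holo_on_def
proof
  fix z0 assume z0: "z0 \<in> V"
  define D where "D = (\<lambda>i z. deriv (\<lambda>t. f (z + t *s axis i 1)) 0)"
  have contD: "continuous_on V (D i)" for i
    unfolding D_def by (rule continuous_on_directional_deriv[OF V cont line])
  define L where "L = (\<lambda>h. \<Sum>i\<in>UNIV. h $ i * D i z0)"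
  have bl: "bounded_linear L"
    unfolding L_def
    by (intro bounded_linear_sum bounded_linear_mult_const bounded_linear_vec_nth)
  have "(f has_derivative L) (at z0)"
    unfolding has_derivative_at_alt
  proof (intro conjI bl allI impI)
    fix \<epsilon> :: real assume e: "\<epsilon> > 0"
    define \<epsilon>' where "\<epsilon>' = \<epsilon> / CARD('a)"
    have e': "\<epsilon>' > 0" using e by (simp add: \<epsilon>'_def)
    have "\<exists>d>0. \<forall>z. dist z z0 < d \<longrightarrow> z \<in> V \<and> (\<forall>i. norm (D i z - D i z0) < \<epsilon>')"
    proof -
      have "\<forall>\<^sub>F z in nhds z0. z \<in> V \<and> (\<forall>i\<in>UNIV. norm (D i z - D i z0) < \<epsilon>')"
      proof (intro eventually_conj)
        show "\<forall>\<^sub>F z in nhds z0. z \<in> V" using V z0 eventually_nhds by blast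
        have "\<forall>\<^sub>F z in nhds z0. norm (D i z - D i z0) < \<epsilon>'" for i
        proof -
          have "isCont (D i) z0" using contD[of i] V z0 continuous_on_eq_continuous_at by blast
          then have "(D i \<longlongrightarrow> D i z0) (nhds z0)"
            by (simp add: continuous_at tendsto_at_iff_tendsto_nhds)
          then show ?thesis using e' by (auto simp: tendsto_iff dist_norm)
        qed
        then show "\<forall>\<^sub>F z in nhds z0. \<forall>i\<in>UNIV. norm (D i z - D i z0) < \<epsilon>'"
          by (intro eventually_ball_finite) auto
      qed
      then show ?thesis unfolding eventually_nhds_metric by auto
    qed
    then obtain d where d: "d > 0"
      and dV: "\<And>z. dist z z0 < d \<Longrightarrow> z \<in> V" and dD: "\<And>z i. dist z z0 < d \<Longrightarrow> norm (D i z - D i z0) < \<epsilon>'"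
      by blast
    have "norm (f y - f z0 - L (y - z0)) \<le> \<epsilon> * norm (y - z0)" if y: "norm (y - z0) < d" for y
    proof -
      define h where "h = y - z0"
      define H where "H = (\<lambda>S. (\<chi> j. if j \<in> S then h $ j else 0) :: complex ^ 'a)"
      have key: "norm (f (z0 + H S) - f z0 - (\<Sum>i\<in>S. h $ i * D i z0)) \<le> (\<Sum>i\<in>S. \<epsilon>' * norm (h $ i))"
        if "finite S" for S
        using that
      proof (induction S)
        case empty
        have "H {} = 0" by (simp add: H_def vec_eq_iff)
        then show ?case by simp
      next
        case (insert i S)
        define w where "w = z0 + H S"
        have w: "w + (h $ i) *s axis i 1 = z0 + H (insert i S)"
          using insert.hyps by (auto simp: w_def H_def vec_eq_iff axis_def)
        have inb: "dist (w + t *s axis i 1) z0 < d" if t: "t \<in> closed_segment 0 (h $ i)" for t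
        proof -
          obtain u where u: "0 \<le> u" "u \<le> 1" "t = u *\<^sub>R h $ i" using t by (auto simp: in_segment)
          have "norm (H S + t *s axis i 1) \<le> norm h"
          proof (rule norm_le_componentwise_cart)
            fix j
            show "norm ((H S + t *s axis i 1) $ j) \<le> norm (h $ j)"
              using u insert.hyps mult_left_le_one_le[of "norm (h $ i)" u]
              by (auto simp: H_def axis_def)
          qed
          then show ?thesis using y by (simp add: w_def dist_norm h_def add.assoc)
        qed
        define g where "g = (\<lambda>t. f (w + t *s axis i 1) - t * D i z0)"
        have "norm (g (h $ i) - g 0) \<le> \<epsilon>' * norm (h $ i - 0)"
        proof (rule field_differentiable_bound[where S="closed_segment 0 (h $ i)"
              and f' = "\<lambda>t. D i (w + t *s axis i 1) - D i z0"])
          fix t assume t: "t \<in> closed_segment 0 (h $ i)"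
          have "(\<lambda>s. f ((w + t *s axis i 1) + s *s axis i 1)) field_differentiable (at 0)"
            using line dV inb[OF t] by blast
          from field_differentiable_line_shift[OF this]
          show "(g has_field_derivative D i (w + t *s axis i 1) - D i z0)
              (at t within closed_segment 0 (h $ i))"
            unfolding g_def D_def
            by (auto intro!: derivative_eq_intros intro: has_field_derivative_at_within)
          show "norm (D i (w + t *s axis i 1) - D i z0) \<le> \<epsilon>'"
            using dD[OF inb[OF t]] less_imp_le by blast
        qed auto
        then have "norm (f (z0 + H (insert i S)) - f (z0 + H S) - h $ i * D i z0) \<le> \<epsilon>' * norm (h $ i)"
          by (simp add: g_def flip: w) (simp add: w_def algebra_simps)
        moreover have "f (z0 + H (insert i S)) - f z0 - (\<Sum>i\<in>insert i S. h $ i * D i z0) =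
          (f (z0 + H (insert i S)) - f (z0 + H S) - h $ i * D i z0)
          + (f (z0 + H S) - f z0 - (\<Sum>i\<in>S. h $ i * D i z0))"
          using insert.hyps by simp
        moreover have "(\<Sum>i\<in>insert i S. \<epsilon>' * norm (h $ i)) = \<epsilon>' * norm (h $ i) + (\<Sum>i\<in>S. \<epsilon>' * norm (h $ i))"
          using insert.hyps by simp
        ultimately show ?case
          using insert.IH
          by (simp only:) (rule norm_triangle_le, rule add_mono)
      qed
      have "z0 + H UNIV = y" by (simp add: H_def h_def vec_eq_iff)
      then have "norm (f y - f z0 - L h) \<le> (\<Sum>i\<in>UNIV. \<epsilon>' * norm (h $ i))"
        using key[of UNIV] by (simp add: L_def)
      also have "\<dots> \<le> (\<Sum>i\<in>(UNIV::'a set). \<epsilon>' * norm h)"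
        using e' by (intro sum_mono mult_left_mono) (auto simp: Finite_Cartesian_Product.norm_nth_le)
      also have "\<dots> = \<epsilon> * norm h" by (simp add: \<epsilon>'_def)
      finally show ?thesis by (simp add: h_def)
    qed
    then show "\<exists>d>0. \<forall>y. norm (y - z0) < d \<longrightarrow> norm (f y - f z0 - L (y - z0)) \<le> \<epsilon> * norm (y - z0)"
      using d by blast
  qed
  moreover have "L (c *s v) = c * L v" for c v
    by (simp add: L_def sum_distrib_left mult.assoc)
  ultimately show "\<exists>D. (f has_derivative D) (at z0) \<and> (\<forall>c v. D (c *s v) = c * D v)" by blast
qed

text \<open>Differentiation under the integral sign. Every holomorphic dependence on parameters below (of
  derivatives, of symmetric functions of roots, of removable quotients) is obtained from it.\<close>

lemma holo_on_contour_integral_circlepath: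
  fixes f :: "complex ^ 'a::finite \<Rightarrow> complex"
  assumes W: "open W" and f: "holo_on W f" and \<Omega>: "open \<Omega>" and r: "r > 0"
    and sub: "\<And>z s. z \<in> \<Omega> \<Longrightarrow> s \<in> sphere c r \<Longrightarrow> z + s *s e \<in> W"
    and h: "continuous_on (sphere c r) h"
  shows "holo_on \<Omega> (\<lambda>z. contour_integral (circlepath c r) (\<lambda>s. f (z + s *s e) * h s))"
proof (rule holo_onI[OF \<Omega>])
  have contf: "continuous_on W f" using holo_on_imp_continuous_on[OF f] .
  show "continuous_on \<Omega> (\<lambda>z. contour_integral (circlepath c r) (\<lambda>s. f (z + s *s e) * h s))"
  proof (rule continuous_on_contour_integral_circlepath[OF _ r])
    have "continuous_on (\<Omega> \<times> sphere c r) (\<lambda>p. f (fst p + snd p *s e))"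
      by (rule continuous_on_compose2[OF contf]) (use sub in \<open>auto intro!: continuous_intros\<close>)
    moreover have "continuous_on (\<Omega> \<times> sphere c r) (\<lambda>p. h (snd p))"
      by (rule continuous_on_compose2[OF h]) (auto intro!: continuous_intros)
    ultimately show "continuous_on (\<Omega> \<times> sphere c r) (\<lambda>(z, s). f (z + s *s e) * h s)"
      unfolding case_prod_unfold by (intro continuous_intros)
  qed
next
  fix z v assume z: "z \<in> \<Omega>"
  define D where "D = (\<lambda>z. deriv (\<lambda>t. f (z + t *s v)) 0)"
  have contf: "continuous_on W f" using holo_on_imp_continuous_on[OF f] .
  have fdiff: "(\<lambda>t. f (w + t *s v)) field_differentiable (at 0)" if "w \<in> W" for w
    using holo_on_compose_line[OF f, of w 0] that by simp
  have contD: "continuous_on W D"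
    unfolding D_def by (rule continuous_on_directional_deriv[OF W contf fdiff])
  obtain \<rho> where \<rho>: "\<rho> > 0" "\<And>t. t \<in> ball 0 \<rho> \<Longrightarrow> z + t *s v \<in> \<Omega>"
  proof -
    have "open {t. z + t *s v \<in> \<Omega>}" by (rule open_line_preimage[OF \<Omega>])
    moreover have "0 \<in> {t. z + t *s v \<in> \<Omega>}" using z by simp
    ultimately show ?thesis using that unfolding open_contains_ball by blast
  qed
  have circ: "circlepath c r x \<in> sphere c r" if "x \<in> cbox 0 (1::real)" for x
    using path_image_circlepath_nonneg[of r c] r that by (auto simp: path_image_def)
  define E where "E = (\<lambda>x::real. 2 * pi * \<i> * r * exp (2 * of_real pi * \<i> * x))"
  define \<gamma> where "\<gamma> = circlepath c r"
  have gc: "continuous_on S \<gamma>" for S unfolding \<gamma>_def circlepath by (intro continuous_intros)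
  have hc: "continuous_on (S \<times> cbox 0 (1::real)) (\<lambda>p. h (\<gamma> (snd p)))" for S :: "complex set"
    by (rule continuous_on_compose2[OF h])
       (use circ in \<open>auto simp: \<gamma>_def intro!: continuous_intros continuous_on_compose2[OF gc[unfolded \<gamma>_def]]\<close>)
  have mc: "continuous_on (ball 0 \<rho> \<times> cbox 0 (1::real)) (\<lambda>p. g (z + fst p *s v + \<gamma> (snd p) *s e))"
    if "continuous_on W g" for g :: "complex ^ 'a \<Rightarrow> complex"
    by (rule continuous_on_compose2[OF that])
       (use sub \<rho>(2) circ in \<open>auto simp: \<gamma>_def intro!: continuous_intros continuous_on_compose2[OF gc[unfolded \<gamma>_def]]\<close>)
  have "(\<lambda>t. integral (cbox 0 1) (\<lambda>x. f (z + t *s v + \<gamma> x *s e) * h (\<gamma> x) * E x)) holomorphic_on ball 0 \<rho>"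
  proof (rule leibniz_rule_holomorphic[where fx = "\<lambda>t x. D (z + t *s v + \<gamma> x *s e) * h (\<gamma> x) * E x"])
    fix t x assume t: "t \<in> ball (0::complex) \<rho>" and x: "x \<in> cbox 0 (1::real)"
    have "(z + \<gamma> x *s e) + t *s v \<in> W"
      using sub[OF \<rho>(2)[OF t] circ[OF x]] by (simp add: \<gamma>_def algebra_simps)
    from field_differentiable_line_shift[OF fdiff[OF this]]
    have "((\<lambda>t. f (z + t *s v + \<gamma> x *s e)) has_field_derivative D (z + t *s v + \<gamma> x *s e)) (at t)"
      by (simp add: D_def algebra_simps)
    then have "((\<lambda>t. f (z + t *s v + \<gamma> x *s e)) has_field_derivative D (z + t *s v + \<gamma> x *s e)) (at t within ball 0 \<rho>)"
      by (rule has_field_derivative_at_within)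
    then show "((\<lambda>t. f (z + t *s v + \<gamma> x *s e) * h (\<gamma> x) * E x) has_field_derivative
        D (z + t *s v + \<gamma> x *s e) * h (\<gamma> x) * E x) (at t within ball 0 \<rho>)"
      by (intro DERIV_cmult_right)
  next
    fix t assume t: "t \<in> ball (0::complex) \<rho>"
    have "continuous_on ({t} \<times> cbox 0 (1::real)) (\<lambda>p. f (z + fst p *s v + \<gamma> (snd p) *s e))"
      by (rule continuous_on_subset[OF mc[OF contf]]) (use t in auto)
    then have "continuous_on ({t} \<times> cbox 0 (1::real))
       (\<lambda>p. f (z + fst p *s v + \<gamma> (snd p) *s e) * h (\<gamma> (snd p)) * E (snd p))"
      unfolding E_def by (intro continuous_intros hc)
    moreover have "continuous_on (cbox 0 1) (Pair t)" by (intro continuous_intros)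
    moreover have "Pair t ` cbox 0 (1::real) \<subseteq> {t} \<times> cbox 0 1" by blast
    ultimately have "continuous_on (cbox 0 1) (\<lambda>x. f (z + fst (t, x) *s v + \<gamma> (snd (t, x)) *s e)
        * h (\<gamma> (snd (t, x))) * E (snd (t, x)))"
      by (rule continuous_on_compose2)
    then have "continuous_on (cbox 0 1) (\<lambda>x. f (z + t *s v + \<gamma> x *s e) * h (\<gamma> x) * E x)"
      by (simp only: fst_conv snd_conv)
    then show "(\<lambda>x. f (z + t *s v + \<gamma> x *s e) * h (\<gamma> x) * E x) integrable_on cbox 0 1"
      by (rule integrable_continuous)
  next
    show "continuous_on (ball 0 \<rho> \<times> cbox 0 1) (\<lambda>(t, x). D (z + t *s v + \<gamma> x *s e) * h (\<gamma> x) * E x)"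
      unfolding case_prod_unfold E_def by (intro continuous_intros mc[OF contD] hc)
  qed auto
  then have "(\<lambda>t. contour_integral (circlepath c r) (\<lambda>s. f (z + t *s v + s *s e) * h s)) holomorphic_on ball 0 \<rho>"
    by (simp add: contour_integral_integral vector_derivative_circlepath_eq \<gamma>_def E_def)
  then show "(\<lambda>t. contour_integral (circlepath c r) (\<lambda>s. f (z + t *s v + s *s e) * h s)) field_differentiable (at 0)"
    by (rule holomorphic_on_imp_differentiable_at) (use \<rho> in auto)
qed

lemma holo_on_directional_deriv:
  fixes f :: "complex ^ 'a::finite \<Rightarrow> complex"
  assumes V: "open V" and f: "holo_on V f"
  shows "holo_on V (\<lambda>z. deriv (\<lambda>t. f (z + t *s v)) 0)"
proof -
  have "\<exists>\<delta>>0. holo_on (ball z0 \<delta>) (\<lambda>z. deriv (\<lambda>t. f (z + t *s v)) 0)" if "z0 \<in> V" for z0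
  proof -
    obtain \<delta> r where d: "\<delta> > 0" "r > 0"
      and sub: "\<And>z t. z \<in> ball z0 \<delta> \<Longrightarrow> t \<in> cball 0 r \<Longrightarrow> z + t *s v \<in> V"
      using exists_ball_line_subset[OF V \<open>z0 \<in> V\<close>, where v=v] by metis
    have eq: "deriv (\<lambda>t. f (z + t *s v)) 0 =
       contour_integral (circlepath 0 r) (\<lambda>u. f (z + u *s v) * (1 / (2 * of_real pi * \<i>) / u\<^sup>2))"
      if z: "z \<in> ball z0 \<delta>" for z
    proof -
      have h: "(\<lambda>t. f (z + t *s v)) holomorphic_on cball 0 r"
        by (rule holo_on_compose_line_holomorphic[OF f sub[OF z]])
      have i: "(\<lambda>u. f (z + u *s v) / (u - 0)\<^sup>2) contour_integrable_on circlepath 0 r"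
        using Cauchy_derivative_integral_circlepath(1)[of 0 r "\<lambda>t. f (z + t *s v)" 0]
          holomorphic_on_imp_continuous_on[OF h] holomorphic_on_subset[OF h ball_subset_cball] d
        by auto
      have deq: "contour_integral (circlepath 0 r) (\<lambda>u. f (z + u *s v) * (1 / (2 * of_real pi * \<i>) / u\<^sup>2))
        = 1 / (2 * of_real pi * \<i>) * contour_integral (circlepath 0 r) (\<lambda>u. f (z + u *s v) / (u - 0)\<^sup>2)"
        by (subst contour_integral_lmul[OF i, symmetric]) (simp add: mult.commute)
      show ?thesis
        using Cauchy_derivative_integral_circlepath(2)[of 0 r "\<lambda>t. f (z + t *s v)" 0]
          holomorphic_on_imp_continuous_on[OF h] holomorphic_on_subset[OF h ball_subset_cball] d
        unfolding deq by (intro DERIV_imp_deriv) simp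
    qed
    have "holo_on (ball z0 \<delta>)
       (\<lambda>z. contour_integral (circlepath 0 r) (\<lambda>u. f (z + u *s v) * (1 / (2 * of_real pi * \<i>) / u\<^sup>2)))"
      by (rule holo_on_contour_integral_circlepath[OF V f _ d(2)])
         (use sub d in \<open>auto intro!: continuous_intros\<close>)
    then have "holo_on (ball z0 \<delta>) (\<lambda>z. deriv (\<lambda>t. f (z + t *s v)) 0)"
      by (rule holo_on_cong[OF open_ball]) (use eq in simp)
    then show ?thesis using d by blast
  qed
  then show ?thesis unfolding holo_on_def using centre_in_ball by blast
qed

lemma holo_on_const [simp, intro]: "holo_on V (\<lambda>x. c)"
  unfolding holo_on_def by (auto intro!: exI[of _ "\<lambda>_. 0"])

lemma holo_on_nth [simp, intro]: "holo_on V (\<lambda>x. x $ i)"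
  unfolding holo_on_def
  using bounded_linear.has_derivative[OF bounded_linear_vec_nth has_derivative_ident]
  by (metis vector_smult_component)

lemma holo_on_add:
  assumes "holo_on V f" "holo_on V g" shows "holo_on V (\<lambda>x. f x + g x)"
  unfolding holo_on_def
proof
  fix x assume "x \<in> V"
  then obtain D E where "(f has_derivative D) (at x)" "\<And>c v. D (c *s v) = c * D v"
    "(g has_derivative E) (at x)" "\<And>c v. E (c *s v) = c * E v"
    using assms unfolding holo_on_def by blast
  then show "\<exists>D. ((\<lambda>x. f x + g x) has_derivative D) (at x) \<and> (\<forall>c v. D (c *s v) = c * D v)"
    by (intro exI[of _ "\<lambda>v. D v + E v"]) (auto intro!: derivative_eq_intros simp: algebra_simps)
qed

lemma holo_on_mult:
  assumes "holo_on V f" "holo_on V g" shows "holo_on V (\<lambda>x. f x * g x)"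
  unfolding holo_on_def
proof
  fix x assume "x \<in> V"
  then obtain D E where "(f has_derivative D) (at x)" "\<And>c v. D (c *s v) = c * D v"
    "(g has_derivative E) (at x)" "\<And>c v. E (c *s v) = c * E v"
    using assms unfolding holo_on_def by blast
  then show "\<exists>D. ((\<lambda>x. f x * g x) has_derivative D) (at x) \<and> (\<forall>c v. D (c *s v) = c * D v)"
    by (intro exI[of _ "\<lambda>v. f x * E v + D v * g x"]) (auto intro!: derivative_eq_intros simp: algebra_simps)
qed

lemma holo_on_compose_holomorphic:
  assumes "holo_on V f" "h holomorphic_on S" "open S" "\<And>x. x \<in> V \<Longrightarrow> f x \<in> S"
  shows "holo_on V (\<lambda>x. h (f x))"
  unfolding holo_on_def
proof
  fix x assume x: "x \<in> V"
  then obtain D where D: "(f has_derivative D) (at x)" "\<And>c v. D (c *s v) = c * D v"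
    using assms unfolding holo_on_def by blast
  have "(h has_field_derivative deriv h (f x)) (at (f x))"
    using holomorphic_derivI[OF assms(2,3) assms(4)[OF x]] .
  then have "(h has_derivative (*) (deriv h (f x))) (at (f x))" by (simp add: has_field_derivative_def)
  from diff_chain_at[OF D(1) this]
  show "\<exists>D. ((\<lambda>x. h (f x)) has_derivative D) (at x) \<and> (\<forall>c v. D (c *s v) = c * D v)"
    by (intro exI[of _ "\<lambda>v. deriv h (f x) * D v"]) (auto simp: o_def D(2))
qed

lemma holo_on_divide:
  assumes "holo_on V f" "holo_on V g" "\<And>x. x \<in> V \<Longrightarrow> g x \<noteq> 0"
  shows "holo_on V (\<lambda>x. f x / g x)"
proof -
  have "holo_on V (\<lambda>x. inverse (g x))"
    by (rule holo_on_compose_holomorphic[OF assms(2), of _ "- {0}"])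
       (use assms(3) in \<open>auto intro!: holomorphic_intros\<close>)
  from holo_on_mult[OF assms(1) this] show ?thesis by (simp add: divide_inverse)
qed

lemma holo_on_sum:
  "(\<And>i. i \<in> I \<Longrightarrow> holo_on V (f i)) \<Longrightarrow> holo_on V (\<lambda>x. \<Sum>i\<in>I. f i x)"
  by (induction I rule: infinite_finite_induct) (auto intro: holo_on_add)

lemma holo_on_matrix_vector_mult: "holo_on V (\<lambda>x. (M *v x) $ i)"
  by (auto simp: matrix_vector_mult_def intro!: holo_on_sum holo_on_mult)

lemmas holo_intros = holo_on_const holo_on_nth holo_on_add holo_on_mult holo_on_sum
  holo_on_matrix_vector_mult

lemma has_derivative_vec_of_holo_on:
  fixes F :: "complex ^ 'a::finite \<Rightarrow> complex ^ 'b::finite"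
  assumes "\<And>i. holo_on W (\<lambda>x. F x $ i)" "x \<in> W"
  obtains D where "(F has_derivative D) (at x)" "\<And>c v. D (c *s v) = c *s D v"
proof -
  have "\<forall>i. \<exists>D. ((\<lambda>x. F x $ i) has_derivative D) (at x) \<and> (\<forall>c v. D (c *s v) = c * D v)"
    using assms unfolding holo_on_def by blast
  then obtain D where D: "\<And>i. ((\<lambda>x. F x $ i) has_derivative D i) (at x)" "\<And>i c v. D i (c *s v) = c * D i v"
    by metis
  have "((\<lambda>x. \<Sum>i\<in>UNIV. F x $ i *s axis i 1) has_derivative (\<lambda>v. \<Sum>i\<in>UNIV. D i v *s axis i 1)) (at x)"
    by (intro has_derivative_sum bounded_linear.has_derivative[OF bounded_linear_smult_left] D(1))
  then have "(F has_derivative (\<lambda>v. \<Sum>i\<in>UNIV. D i v *s axis i 1)) (at x)"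
    by (simp add: basis_expansion)
  moreover have "(\<Sum>i\<in>UNIV. D i (c *s v) *s axis i 1) = c *s (\<Sum>i\<in>UNIV. D i v *s axis i (1::complex))" for c v
    by (simp add: D(2) basis_expansion vec_eq_iff sum_distrib_left mult.assoc)
  ultimately show ?thesis using that by blast
qed

lemma holo_on_compose:
  fixes F :: "complex ^ 'a::finite \<Rightarrow> complex ^ 'b::finite"
  assumes "\<And>i. holo_on W (\<lambda>x. F x $ i)" "holo_on V f" "\<And>x. x \<in> W \<Longrightarrow> F x \<in> V"
  shows "holo_on W (\<lambda>x. f (F x))"
  unfolding holo_on_def
proof
  fix x assume x: "x \<in> W"
  obtain D where D: "(F has_derivative D) (at x)" "\<And>c v. D (c *s v) = c *s D v"
    using has_derivative_vec_of_holo_on[OF assms(1) x] by blast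
  obtain E where E: "(f has_derivative E) (at (F x))" "\<And>c v. E (c *s v) = c * E v"
    using assms(2,3) x unfolding holo_on_def by blast
  from diff_chain_at[OF D(1) E(1)]
  show "\<exists>D. ((\<lambda>x. f (F x)) has_derivative D) (at x) \<and> (\<forall>c v. D (c *s v) = c * D v)"
    by (intro exI[of _ "\<lambda>v. E (D v)"]) (auto simp: o_def D(2) E(2))
qed

lemma holo_on_local:
  assumes "\<And>x. x \<in> V \<Longrightarrow> \<exists>W. open W \<and> x \<in> W \<and> holo_on W f"
  shows "holo_on V f"
  unfolding holo_on_def
proof
  fix x assume "x \<in> V"
  then obtain W where "x \<in> W" "holo_on W f" using assms by blast
  then show "\<exists>D. (f has_derivative D) (at x) \<and> (\<forall>c v. D (c *s v) = c * D v)"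
    unfolding holo_on_def by blast
qed

section \<open>Polynomial functions\<close>

text \<open>Polynomial functions of degree at most \<open>n\<close>. The inductive definition makes closure under
  composition immediate; \<open>polyfun_repr\<close> recovers the coefficients.\<close>

inductive polyfun :: "nat \<Rightarrow> (complex ^ 'a::finite \<Rightarrow> complex) \<Rightarrow> bool" where
  polyfun_const: "polyfun n (\<lambda>x. c)"
| polyfun_nth: "polyfun (Suc n) (\<lambda>x. x $ i)"
| polyfun_add: "polyfun n f \<Longrightarrow> polyfun n g \<Longrightarrow> polyfun n (\<lambda>x. f x + g x)"
| polyfun_mult: "polyfun m f \<Longrightarrow> polyfun n g \<Longrightarrow> polyfun (m + n) (\<lambda>x. f x * g x)"

lemma polyfun_mono: "polyfun n f \<Longrightarrow> n \<le> m \<Longrightarrow> polyfun m f"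
proof (induction arbitrary: m rule: polyfun.induct)
  case (polyfun_const n c)
  then show ?case by (intro polyfun.polyfun_const)
next
  case (polyfun_nth n i)
  then show ?case using polyfun.polyfun_nth[of "m - 1" i] by simp
next
  case (polyfun_add n f g)
  then show ?case by (intro polyfun.polyfun_add)
next
  case (polyfun_mult k f n g)
  then show ?case using polyfun.polyfun_mult[of k f "m - k" g] by simp
qed

lemma polyfun_cmult: "polyfun n f \<Longrightarrow> polyfun n (\<lambda>x. c * f x)"
  using polyfun_mult[OF polyfun_const[of 0 c]] by simp

lemma polyfun_sum: "(\<And>i. i \<in> I \<Longrightarrow> polyfun n (f i)) \<Longrightarrow> polyfun n (\<lambda>x. \<Sum>i\<in>I. f i x)"
  by (induction I rule: infinite_finite_induct) (auto intro: polyfun_const polyfun_add)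

lemma polyfun_prod: "(\<And>i. i \<in> I \<Longrightarrow> polyfun (n i) (f i)) \<Longrightarrow> polyfun (sum n I) (\<lambda>x. \<Prod>i\<in>I. f i x)"
  by (induction I rule: infinite_finite_induct) (auto intro: polyfun_const polyfun_mult)

lemma polyfun_power: "polyfun n f \<Longrightarrow> polyfun (k * n) (\<lambda>x. f x ^ k)"
  by (induction k) (auto intro: polyfun_const polyfun_mult)

lemma polyfun_monomial: "polyfun (sum I UNIV) (monomial I)"
proof -
  have "polyfun (I i) (\<lambda>x. x $ i ^ I i)" for i
    using polyfun_power[OF polyfun_nth[of 0 i], of "I i"] by simp
  then show ?thesis unfolding monomial_def by (intro polyfun_prod)
qed

lemma polyfun_compose:
  fixes F :: "complex ^ 'a::finite \<Rightarrow> complex ^ 'b::finite"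
  assumes "polyfun n f" "\<And>i. polyfun d (\<lambda>x. F x $ i)"
  shows "polyfun (n * d) (\<lambda>x. f (F x))"
  using assms(1)
proof (induction rule: polyfun.induct)
  case (polyfun_nth n i)
  show ?case by (rule polyfun_mono[OF assms(2)]) simp
qed (auto intro: polyfun_const polyfun_add polyfun_mult simp: add_mult_distrib)

lemma polyfun_line:
  assumes "polyfun n f"
  shows "\<exists>p. degree p \<le> n \<and> (\<forall>t. f (z + t *s v) = poly p t)"
  using assms
proof (induction rule: polyfun.induct)
  case (polyfun_const n c)
  show ?case by (intro exI[of _ "[:c:]"]) auto
next
  case (polyfun_nth n i)
  show ?case by (intro exI[of _ "[:z $ i, v $ i:]"]) (auto simp: mult.commute)
next
  case (polyfun_add n f g)
  then obtain p q where "degree p \<le> n" "\<forall>t. f (z + t *s v) = poly p t"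
    "degree q \<le> n" "\<forall>t. g (z + t *s v) = poly q t" by blast
  then show ?case by (intro exI[of _ "p + q"]) (auto intro: degree_add_le)
next
  case (polyfun_mult m f n g)
  then obtain p q where "degree p \<le> m" "\<forall>t. f (z + t *s v) = poly p t"
    "degree q \<le> n" "\<forall>t. g (z + t *s v) = poly q t" by blast
  then show ?case
    using degree_mult_le[of p q] by (intro exI[of _ "p * q"]) auto
qed

lemma holo_on_polyfun: "polyfun n f \<Longrightarrow> holo_on V f"
  by (induction rule: polyfun.induct) (auto intro: holo_intros)

lemma polyfun_zero_on_open:
  assumes "polyfun n f" "open V" "V \<noteq> {}" "\<And>x. x \<in> V \<Longrightarrow> f x = 0"
  shows "f x = 0"
proof -
  obtain z where z: "z \<in> V" using assms(3) by blast
  obtain p where p: "\<And>t. f (z + t *s (x - z)) = poly p t" using polyfun_line[OF assms(1)] by blast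
  have "open {t. z + t *s (x - z) \<in> V}" by (rule open_line_preimage[OF assms(2)])
  moreover have "0 \<in> {t. z + t *s (x - z) \<in> V}" using z by simp
  ultimately have "infinite {t. z + t *s (x - z) \<in> V}"
    using finite_imp_not_open by blast
  moreover have "{t. z + t *s (x - z) \<in> V} \<subseteq> {t. poly p t = 0}" using p assms(4) by force
  ultimately have "p = 0" using poly_roots_finite finite_subset by blast
  then show ?thesis using p[of 1] by simp
qed

lemma multi_index_le_sum: "I i \<le> sum I UNIV" for I :: "'a::finite \<Rightarrow> nat"
  by (rule member_le_sum) auto

lemma finite_multi_indices: "finite {I :: 'a::finite \<Rightarrow> nat. sum I UNIV \<le> n}"
proof (rule finite_subset)
  show "{I :: 'a \<Rightarrow> nat. sum I UNIV \<le> n} \<subseteq> PiE UNIV (\<lambda>_. {..n})"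
    using le_trans[OF multi_index_le_sum] by (auto simp: PiE_def)
  show "finite (PiE (UNIV::'a set) (\<lambda>_. {..n}))" by (intro finite_PiE) auto
qed

lemma monomial_add: "monomial (\<lambda>i. I i + J i) x = monomial I x * monomial J x"
  by (simp add: monomial_def power_add prod.distrib)

lemma polyfun_repr:
  fixes f :: "complex ^ 'a::finite \<Rightarrow> complex"
  assumes "polyfun n f"
  shows "\<exists>c. \<forall>x. f x = (\<Sum>I | sum I UNIV \<le> n. c I * monomial I x)"
proof -
  define sp where "sp = (\<lambda>n (f :: complex ^ 'a \<Rightarrow> complex). \<exists>c. \<forall>x. f x = (\<Sum>I | sum I UNIV \<le> n. c I * monomial I x))"
  have mono: "sp n (\<lambda>x. c * monomial I x)" if "sum I UNIV \<le> n" for c I n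
    unfolding sp_def using that
    by (intro exI[of _ "\<lambda>J. if J = I then c else 0"])
       (simp add: if_distrib[of "\<lambda>c. c * _"] sum.delta finite_multi_indices cong: if_cong)
  have add: "sp n (\<lambda>x. f x + g x)" if fg: "sp n f" "sp n g" for n f g
  proof -
    obtain c d where "\<And>x. f x = (\<Sum>I | sum I UNIV \<le> n. c I * monomial I x)"
      "\<And>x. g x = (\<Sum>I | sum I UNIV \<le> n. d I * monomial I x)"
      using fg unfolding sp_def by blast
    then show ?thesis
      unfolding sp_def by (intro exI[of _ "\<lambda>I. c I + d I"]) (simp add: sum.distrib algebra_simps)
  qed
  have zero: "sp n (\<lambda>x. 0)" for n
    unfolding sp_def by (intro exI[of _ "\<lambda>_. 0"]) simp
  have sum: "sp n (\<lambda>x. \<Sum>i\<in>K. f i x)" if "\<And>i. i \<in> K \<Longrightarrow> sp n (f i)" for K :: "'k set" and f n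
    using that by (induction K rule: infinite_finite_induct) (auto intro: zero add)
  have sum2: "sp n (\<lambda>x. \<Sum>i\<in>K. f i x)" if "\<And>i. i \<in> K \<Longrightarrow> sp n (f i)" for K :: "('a \<Rightarrow> nat) set" and f n
    using that by (induction K rule: infinite_finite_induct) (auto intro: zero add)
  have "sp n f"
    using assms
  proof (induction rule: polyfun.induct)
    case (polyfun_const n c)
    show ?case using mono[of "\<lambda>_. 0" n c] by (simp add: monomial_def)
  next
    case (polyfun_nth n i)
    show ?case using mono[of "\<lambda>j. if j = i then 1 else 0" "Suc n" 1]
      by (simp add: monomial_def if_distrib[of "\<lambda>k. _ ^ k"] cong: if_cong)
  next
    case (polyfun_add n f g)
    then show ?case by (intro add)
  next
    case (polyfun_mult m f n g)
    obtain c d where cd: "\<And>x. f x = (\<Sum>I | sum I UNIV \<le> m. c I * monomial I x)"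
      "\<And>x. g x = (\<Sum>I | sum I UNIV \<le> n. d I * monomial I x)"
      using polyfun_mult.IH unfolding sp_def by blast
    have "(\<lambda>x. f x * g x) = (\<lambda>x. \<Sum>I | sum I UNIV \<le> m. \<Sum>J | sum J UNIV \<le> n.
        (c I * d J) * monomial (\<lambda>i. I i + J i) x)"
      by (rule ext) (simp add: cd sum_product monomial_add mult_ac)
    then show ?case
      by (simp only:) (intro sum2 mono, simp add: sum.distrib)
  qed
  then show ?thesis unfolding sp_def .
qed

lemma monomial_smult: "monomial I (c *s x) = c ^ sum I UNIV * monomial I x"
  by (simp add: monomial_def power_mult_distrib prod.distrib power_sum)

text \<open>Only the part of degree \<open>D\<close> of a polynomial function can survive if the function is homogeneous of
  degree \<open>D\<close>. So degrees need no care as long as homogeneity is known.\<close>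

lemma polyfun_homogeneous_degree:
  fixes f :: "complex ^ 'a::finite \<Rightarrow> complex"
  assumes "polyfun n f" and hom: "\<And>c x. c \<noteq> 0 \<Longrightarrow> f (c *s x) = c ^ D * f x"
  shows "polyfun D f"
proof -
  obtain c where c: "\<And>x. f x = (\<Sum>I | sum I UNIV \<le> n. c I * monomial I x)"
    using polyfun_repr[OF assms(1)] by blast
  define h where "h = (\<lambda>m x. \<Sum>I | sum I UNIV \<le> n \<and> sum I UNIV = m. c I * monomial I x)"
  have h: "f (t *s x) = (\<Sum>m\<le>n. t ^ m * h m x)" for t x
  proof -
    have "f (t *s x) = (\<Sum>I | sum I UNIV \<le> n. t ^ sum I UNIV * (c I * monomial I x))"
      by (simp add: c monomial_smult mult_ac)
    also have "\<dots> = (\<Sum>m\<le>n. \<Sum>I | I \<in> {I. sum I UNIV \<le> n} \<and> sum I UNIV = m. t ^ sum I UNIV * (c I * monomial I x))"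
      by (rule sum.group[symmetric]) (auto simp: finite_multi_indices)
    finally show ?thesis by (simp add: h_def sum_distrib_left)
  qed
  have "f x = (if D \<le> n then h D x else 0)" for x
  proof -
    define p where "p = (\<Sum>m\<le>n. monom (h m x) m) - monom (f x) D"
    have "poly p t = 0" if "t \<noteq> 0" for t
      using h[of t x] hom[OF that, of x] by (simp add: p_def poly_sum poly_monom mult.commute)
    then have "- {0} \<subseteq> {t. poly p t = 0}" by auto
    moreover have "infinite (- {0::complex})" by (simp add: infinite_UNIV_char_0)
    ultimately have "p = 0" using poly_roots_finite finite_subset by blast
    then have "coeff p D = 0" by simp
    then show ?thesis
      by (auto simp: p_def coeff_sum split: if_splits)
  qed
  moreover have "polyfun D (\<lambda>x. if D \<le> n then h D x else 0)"
    unfolding h_def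
    by (cases "D \<le> n") (auto intro!: polyfun_const polyfun_sum polyfun_cmult polyfun_mono[OF polyfun_monomial])
  ultimately show ?thesis by presburger
qed

section \<open>A Bezout bound for isolated points of a fibre\<close>

text \<open>Dedekind's argument: distinct monomials are distinct multiplicative characters.\<close>

lemma monomials_independent:
  fixes S :: "('a::finite \<Rightarrow> nat) set"
  assumes "finite S" "\<And>x. (\<Sum>I\<in>S. c I * monomial I x) = 0" "J \<in> S"
  shows "c J = 0"
  using assms
proof (induction S arbitrary: c J rule: finite_psubset_induct)
  case (psubset S)
  have mono_times: "monomial I (\<chi> i. x $ i * y $ i) = monomial I x * monomial I y" for I and x y :: "complex ^ 'a"
    by (simp add: monomial_def power_mult_distrib prod.distrib)
  have other: "c L = 0" if L: "L \<in> S" "L \<noteq> K" "K \<in> S" for L K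
  proof -
    obtain i where i: "L i \<noteq> K i" using L(2) by blast
    define y :: "complex ^ 'a" where "y = (\<chi> j. if j = i then 2 else 1)"
    have y: "monomial I y = 2 ^ I i" for I
      by (simp add: monomial_def y_def if_distrib[of "\<lambda>b. b ^ _"] prod.delta cong: if_cong)
    have "(\<Sum>I\<in>S - {K}. (c I * (monomial I y - monomial K y)) * monomial I x) = 0" for x
    proof -
      have "(\<Sum>I\<in>S - {K}. (c I * (monomial I y - monomial K y)) * monomial I x)
          = (\<Sum>I\<in>S. (c I * (monomial I y - monomial K y)) * monomial I x)"
        using psubset.hyps L(3) by (simp add: sum.remove)
      also have "\<dots> = (\<Sum>I\<in>S. c I * monomial I (\<chi> i. x $ i * y $ i)) - monomial K y * (\<Sum>I\<in>S. c I * monomial I x)"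
        by (simp add: mono_times sum_distrib_left sum_subtractf algebra_simps)
      finally show ?thesis using psubset.prems(1) by simp
    qed
    then have "c L * (monomial L y - monomial K y) = 0"
      using psubset.IH[of "S - {K}" "\<lambda>I. c I * (monomial I y - monomial K y)" L] L by blast
    moreover have "(2::complex) ^ L i \<noteq> 2 ^ K i"
    proof
      assume "(2::complex) ^ L i = 2 ^ K i"
      then have "norm ((2::complex) ^ L i) = norm ((2::complex) ^ K i)" by simp
      then show False using i by (simp add: norm_power)
    qed
    ultimately show ?thesis by (simp add: y)
  qed
  have "(\<Sum>I\<in>S. c I * monomial I 1) = c J * monomial J 1"
    using psubset.hyps psubset.prems(2) other[of _ J] by (subst sum.remove[of _ J]) (auto intro!: sum.neutral)
  then show ?case using psubset.prems(1)[of 1] by (simp add: monomial_def)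
qed

text \<open>Elimination of one equation at a time.\<close>

lemma homogeneous_system_nontrivial_solution:
  fixes a :: "'i \<Rightarrow> 'j \<Rightarrow> complex"
  assumes "finite J" "finite I" "card J < card I"
  shows "\<exists>x. (\<exists>i\<in>I. x i \<noteq> 0) \<and> (\<forall>j\<in>J. (\<Sum>i\<in>I. x i * a i j) = 0)"
  using assms
proof (induction J arbitrary: I a rule: finite_induct)
  case empty
  then obtain i where "i \<in> I" by fastforce
  then show ?case by (intro exI[of _ "\<lambda>_. 1"]) auto
next
  case (insert j J)
  show ?case
  proof (cases "\<forall>i\<in>I. a i j = 0")
    case True
    have "card J < card I" using insert.prems insert.hyps by simp
    from insert.IH[OF insert.prems(1) this]
    obtain x where "\<exists>i\<in>I. x i \<noteq> 0" "\<forall>j\<in>J. (\<Sum>i\<in>I. x i * a i j) = 0" by blast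
    then show ?thesis using True by (intro exI[of _ x]) auto
  next
    case False
    then obtain i0 where i0: "i0 \<in> I" "a i0 j \<noteq> 0" by blast
    define a' where "a' = (\<lambda>i l. a i l - a i j / a i0 j * a i0 l)"
    have "card J < card (I - {i0})" using insert.prems insert.hyps i0 by simp
    from insert.IH[OF _ this, of a'] insert.prems obtain x where
      x: "\<exists>i\<in>I - {i0}. x i \<noteq> 0" "\<And>l. l \<in> J \<Longrightarrow> (\<Sum>i\<in>I - {i0}. x i * a' i l) = 0"
      by blast
    define y where "y = x(i0 := - (\<Sum>i\<in>I - {i0}. x i * a i j) / a i0 j)"
    have y: "(\<Sum>i\<in>I. y i * a i l) = y i0 * a i0 l + (\<Sum>i\<in>I - {i0}. x i * a i l)" for l
      using insert.prems(1) i0 by (subst sum.remove[of _ i0]) (auto simp: y_def)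
    have "(\<Sum>i\<in>I. y i * a i j) = 0" unfolding y using i0 by (simp add: y_def)
    moreover have "(\<Sum>i\<in>I. y i * a i l) = 0" if "l \<in> J" for l
    proof -
      have "y i0 * a i0 l + (\<Sum>i\<in>I - {i0}. x i * a i l) = (\<Sum>i\<in>I - {i0}. x i * a' i l)"
        using i0(2)
        by (simp add: y_def a'_def algebra_simps sum_subtractf sum_distrib_left sum_divide_distrib)
      then show ?thesis unfolding y using x(2)[OF that] by simp
    qed
    moreover have "\<exists>i\<in>I. y i \<noteq> 0" using x(1) by (auto simp: y_def)
    ultimately show ?thesis by (intro exI[of _ y]) auto
  qed
qed

definition multi_index_count :: "'a::finite itself \<Rightarrow> nat \<Rightarrow> nat" where
  "multi_index_count _ n = card {I :: 'a \<Rightarrow> nat. sum I UNIV \<le> n}"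

text \<open>Division with remainder of each exponent by \<open>D\<close> embeds the multi-indices of size at most
  \<open>D B + E\<close> into the product of a cube of side \<open>D\<close> and the multi-indices of size at most \<open>B + E\<close>.\<close>

lemma multi_index_count_scaled:
  assumes "D > 0"
  shows "multi_index_count TYPE('a::finite) (D * B + E) \<le> D ^ CARD('a) * multi_index_count TYPE('a) (B + E)"
proof -
  let ?S = "{I :: 'a \<Rightarrow> nat. sum I UNIV \<le> D * B + E}"
  let ?T = "PiE (UNIV :: 'a set) (\<lambda>_. {..<D}) \<times> {I :: 'a \<Rightarrow> nat. sum I UNIV \<le> B + E}"
  let ?h = "\<lambda>I :: 'a \<Rightarrow> nat. (\<lambda>i. I i mod D, \<lambda>i. I i div D)"
  have "inj_on ?h ?S"
    by (auto simp: inj_on_def fun_eq_iff) (metis mult_div_mod_eq)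
  moreover have "?h ` ?S \<subseteq> ?T"
  proof -
    have "(\<Sum>i\<in>UNIV. I i div D) \<le> B + E" if "sum I UNIV \<le> D * B + E" for I :: "'a \<Rightarrow> nat"
    proof -
      have "D * (\<Sum>i\<in>UNIV. I i div D) \<le> sum I UNIV"
        by (simp add: sum_distrib_left sum_mono)
      also note that
      also have "D * B + E \<le> D * (B + E)" using assms by (simp add: distrib_left)
      finally show ?thesis using assms by simp
    qed
    then show ?thesis using assms by (auto simp: PiE_def)
  qed
  moreover have "finite ?T" by (intro finite_cartesian_product finite_PiE finite_multi_indices) auto
  ultimately have "card ?S \<le> card ?T" by (rule card_inj_on_le)
  also have "\<dots> = D ^ CARD('a) * multi_index_count TYPE('a) (B + E)"
    by (simp add: card_cartesian_product card_PiE multi_index_count_def)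
  finally show ?thesis by (simp add: multi_index_count_def)
qed

lemma multi_index_count_bound: "multi_index_count TYPE('a::finite) n \<le> (n + 1) ^ CARD('a)"
proof -
  have "card {I :: 'a \<Rightarrow> nat. sum I UNIV \<le> n} \<le> card (PiE (UNIV :: 'a set) (\<lambda>_. {..n}))"
  proof (rule card_mono)
    show "finite (PiE (UNIV :: 'a set) (\<lambda>_. {..n}))" by (intro finite_PiE) auto
  qed (use le_trans[OF multi_index_le_sum] in \<open>auto simp: PiE_def\<close>)
  then show ?thesis by (simp add: multi_index_count_def card_PiE)
qed

lemma multi_index_count_pos: "multi_index_count TYPE('a::finite) n > 0"
proof -
  have "(\<lambda>_. 0) \<in> {I :: 'a \<Rightarrow> nat. sum I UNIV \<le> n}" by simp
  then show ?thesis
    unfolding multi_index_count_def using finite_multi_indices card_gt_0_iff by blast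
qed

text \<open>Otherwise the count would grow exponentially in \<open>B\<close>, while \<open>multi_index_count_bound\<close> shows that it
  is bounded by a polynomial.\<close>

lemma multi_index_count_slow_growth:
  assumes "K > 0"
  shows "\<exists>B. K * multi_index_count TYPE('a::finite) (B + E) < (K + 1) * multi_index_count TYPE('a) B"
proof (rule ccontr)
  let ?c = "multi_index_count TYPE('a)"
  assume "\<not> ?thesis"
  then have *: "(K + 1) * ?c B \<le> K * ?c (B + E)" for B by (meson not_le)
  define r where "r = 1 + 1 / real K"
  have r: "r > 1" using assms by (simp add: r_def)
  have step: "r * ?c B \<le> ?c (B + E)" for B
  proof -
    have "real ((K + 1) * ?c B) \<le> real (K * ?c (B + E))" using * of_nat_le_iff by blast
    then show ?thesis using assms by (simp add: r_def field_simps)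
  qed
  have "r ^ n \<le> ?c (n * E)" for n
  proof (induction n)
    case 0
    then show ?case using multi_index_count_pos[where 'a='a, of 0] by simp
  next
    case (Suc n)
    have "r ^ Suc n \<le> r * ?c (n * E)" using Suc r by simp
    also have "\<dots> \<le> ?c (Suc n * E)" using step[of "n * E"] by (simp add: add.commute)
    finally show ?case .
  qed
  moreover have "real (?c (n * E)) \<le> (real n * real E + 1) ^ CARD('a)" for n
    using multi_index_count_bound[where 'a='a, of "n * E"]
    by (metis (mono_tags) of_nat_1 of_nat_add of_nat_le_iff of_nat_mult of_nat_power)
  moreover obtain n where "(real n * real E + 1) ^ CARD('a) < r ^ n"
  proof -
    define s where "s = root CARD('a) r"
    have s: "s > 1" "s ^ CARD('a) = r" using r by (auto simp: s_def)
    have "eventually (\<lambda>n::nat. real n * real E + 1 < s ^ n) at_top"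
      using s(1) by real_asymp
    then obtain n where "real n * real E + 1 < s ^ n"
      using eventually_happens'[OF sequentially_bot] by blast
    then have "(real n * real E + 1) ^ CARD('a) < (s ^ n) ^ CARD('a)"
      by (intro power_strict_mono) auto
    then show ?thesis using that[of n] s(2) by (metis mult.commute power_mult)
  qed
  ultimately show False by (meson leD order_trans)
qed

text \<open>The form with coefficients \<open>t, t\<^sup>2, \<dots>\<close> up to reindexing separates two given points unless \<open>t\<close> is a
  root of a nonzero polynomial.\<close>

lemma exists_separating_linear_form:
  fixes S :: "(complex ^ 'a::finite) set"
  assumes "finite S"
  shows "\<exists>a :: complex ^ 'a. inj_on (\<lambda>x. \<Sum>i\<in>UNIV. a $ i * x $ i) S"
proof -
  obtain e :: "'a \<Rightarrow> nat" where e: "inj e" using finite_imp_inj_to_nat_seg[of "UNIV :: 'a set"] by auto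
  define p where "p = (\<lambda>x :: complex ^ 'a. \<Sum>i\<in>UNIV. monom (x $ i) (e i))"
  have p0: "p x \<noteq> 0" if nz: "x \<noteq> 0" for x
  proof -
    obtain i where "x $ i \<noteq> 0" using nz by (metis vec_eq_iff zero_index)
    moreover have "coeff (p x) (e i) = x $ i"
      using e by (simp add: p_def coeff_sum inj_eq if_distrib cong: if_cong)
    ultimately show ?thesis by auto
  qed
  have "finite (\<Union>x\<in>S. \<Union>y\<in>S - {x}. {t. poly (p (x - y)) t = 0})"
    using assms p0 by (auto intro!: poly_roots_finite)
  then obtain t where t: "t \<notin> (\<Union>x\<in>S. \<Union>y\<in>S - {x}. {t. poly (p (x - y)) t = 0})"
    using ex_new_if_finite[OF infinite_UNIV_char_0[where 'a=complex]] by blast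
  have "inj_on (\<lambda>x. \<Sum>i\<in>UNIV. (\<chi> i. t ^ e i) $ i * x $ i) S"
  proof (rule inj_onI, rule ccontr)
    fix x y assume xy: "x \<in> S" "y \<in> S" "x \<noteq> y"
      "(\<Sum>i\<in>UNIV. (\<chi> i. t ^ e i) $ i * x $ i) = (\<Sum>i\<in>UNIV. (\<chi> i. t ^ e i) $ i * y $ i)"
    then have "poly (p (x - y)) t = 0"
      by (simp add: p_def poly_sum poly_monom algebra_simps sum_subtractf)
    then show False using t xy by blast
  qed
  then show ?thesis by blast
qed

text \<open>Perron's argument. Let \<open>l\<close> be a linear form that separates the points of \<open>S\<close> and \<open>A = D\<^sup>q\<close>, where
  \<open>q\<close> is the dimension. For large \<open>B\<close> the products \<open>l\<^sup>a \<Phi>\<^sup>b\<close> with \<open>a \<le> A\<close>, \<open>|b| \<le> B\<close> outnumber the monomials of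
  their degree, so they satisfy a linear relation. Read it as a polynomial of degree at most \<open>A\<close> in
  \<open>l\<close> whose coefficients are polynomials in the value \<open>w = \<Phi> x\<close>. At \<open>w0\<close> all coefficients may vanish,
  but at a suitable nearby \<open>w\<close> they do not, and openness of \<open>\<Phi>\<close> provides a preimage of \<open>w\<close> near each
  point of \<open>S\<close>. The values of \<open>l\<close> at these preimages are distinct roots.\<close>

lemma isolated_fibre_card_le:
  fixes \<Phi> :: "complex ^ 'a::finite \<Rightarrow> complex ^ 'a"
  assumes D: "D > 0" and \<Phi>: "\<And>i. polyfun D (\<lambda>x. \<Phi> x $ i)" and S: "finite S"
    and opn: "\<And>s T. s \<in> S \<Longrightarrow> open T \<Longrightarrow> s \<in> T \<Longrightarrow> w0 \<in> interior (\<Phi> ` T)"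
  shows "card S \<le> D ^ CARD('a)"
proof -
  define A where "A = D ^ CARD('a)"
  obtain a :: "complex ^ 'a" where inj: "inj_on (\<lambda>x. \<Sum>i\<in>UNIV. a $ i * x $ i) S"
    using exists_separating_linear_form[OF S] by blast
  define l where "l = (\<lambda>x. \<Sum>i\<in>UNIV. a $ i * x $ i)"
  have l: "polyfun 1 l" unfolding l_def
    using polyfun_nth[of 0] by (auto intro!: polyfun_sum polyfun_cmult)
  obtain B where B: "A * multi_index_count TYPE('a) (B + A) < (A + 1) * multi_index_count TYPE('a) B"
    using multi_index_count_slow_growth[of A] D by (auto simp: A_def)
  define M where "M = {I :: 'a \<Rightarrow> nat. sum I UNIV \<le> B}"
  define N where "N = {I :: 'a \<Rightarrow> nat. sum I UNIV \<le> D * B + A}"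
  have "card N < card ({..A} \<times> M)"
  proof -
    have "card N \<le> A * multi_index_count TYPE('a) (B + A)"
      using multi_index_count_scaled[OF D, of B A, where 'a='a] by (simp add: N_def multi_index_count_def A_def)
    also have "\<dots> < card ({..A} \<times> M)" using B by (simp add: M_def multi_index_count_def card_cartesian_product)
    finally show ?thesis .
  qed
  have "\<exists>c. \<forall>x. l x ^ fst p * monomial (snd p) (\<Phi> x) = (\<Sum>I\<in>N. c I * monomial I x)"
    if p: "p \<in> {..A} \<times> M" for p
  proof -
    have "polyfun (sum (snd p) UNIV * D) (\<lambda>x. monomial (snd p) (\<Phi> x))"
      by (rule polyfun_compose[OF polyfun_monomial \<Phi>])
    then have "polyfun (fst p * 1 + sum (snd p) UNIV * D) (\<lambda>x. l x ^ fst p * monomial (snd p) (\<Phi> x))"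
      by (intro polyfun_mult polyfun_power l)
    moreover have "fst p * 1 + sum (snd p) UNIV * D \<le> D * B + A"
    proof -
      have "fst p \<le> A" "sum (snd p) UNIV * D \<le> B * D" using p by (auto simp: M_def)
      then show ?thesis unfolding mult_1_right mult.commute[of D B] by linarith
    qed
    ultimately have "polyfun (D * B + A) (\<lambda>x. l x ^ fst p * monomial (snd p) (\<Phi> x))"
      by (rule polyfun_mono)
    from polyfun_repr[OF this] show ?thesis unfolding N_def .
  qed
  then obtain c where c: "\<And>p x. p \<in> {..A} \<times> M \<Longrightarrow> l x ^ fst p * monomial (snd p) (\<Phi> x) = (\<Sum>I\<in>N. c p I * monomial I x)"
    by metis
  have fin: "finite M" "finite N" unfolding M_def N_def by (rule finite_multi_indices)+
  obtain \<rho> where \<rho>: "\<exists>p\<in>{..A} \<times> M. \<rho> p \<noteq> 0" "\<And>I. I \<in> N \<Longrightarrow> (\<Sum>p\<in>{..A} \<times> M. \<rho> p * c p I) = 0"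
    using homogeneous_system_nontrivial_solution[OF fin(2) _ \<open>card N < card ({..A} \<times> M)\<close>, of c] fin(1) by blast
  define r where "r = (\<lambda>j w. \<Sum>b\<in>M. \<rho> (j, b) * monomial b w)"
  have rel: "(\<Sum>j\<le>A. r j (\<Phi> x) * l x ^ j) = 0" for x
  proof -
    have "(\<Sum>j\<le>A. r j (\<Phi> x) * l x ^ j) = (\<Sum>p\<in>{..A} \<times> M. \<rho> p * (l x ^ fst p * monomial (snd p) (\<Phi> x)))"
      by (simp add: r_def sum_distrib_left sum_distrib_right sum.cartesian_product case_prod_unfold mult_ac)
    also have "\<dots> = (\<Sum>p\<in>{..A} \<times> M. \<Sum>I\<in>N. \<rho> p * c p I * monomial I x)"
      by (rule sum.cong[OF refl]) (simp add: c sum_distrib_left mult.assoc)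
    also have "\<dots> = (\<Sum>I\<in>N. (\<Sum>p\<in>{..A} \<times> M. \<rho> p * c p I) * monomial I x)"
      by (subst sum.swap) (simp add: sum_distrib_right)
    finally show ?thesis using \<rho>(2) by simp
  qed
  obtain j b where jb: "j \<le> A" "b \<in> M" "\<rho> (j, b) \<noteq> 0" using \<rho>(1) by auto
  have polyr: "polyfun B (r j)"
    unfolding r_def by (intro polyfun_sum polyfun_cmult polyfun_mono[OF polyfun_monomial]) (simp add: M_def)
  obtain \<delta> where \<delta>: "\<delta> > 0" "\<And>s t. s \<in> S \<Longrightarrow> t \<in> S \<Longrightarrow> s \<noteq> t \<Longrightarrow> 2 * \<delta> \<le> dist (l s) (l t)"
  proof -
    define P where "P = insert 1 ((\<lambda>(s, t). dist (l s) (l t)) ` {(s, t). s \<in> S \<and> t \<in> S \<and> s \<noteq> t})"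
    have "finite {(s, t). s \<in> S \<and> t \<in> S \<and> s \<noteq> t}"
      by (rule finite_subset[of _ "S \<times> S"]) (use S in auto)
    then have P: "finite P" "P \<noteq> {}" by (auto simp: P_def)
    have "x > 0" if "x \<in> P" for x
      using that inj by (auto simp: P_def inj_on_def l_def)
    then have "Min P > 0" using P by simp
    moreover have "Min P \<le> dist (l s) (l t)" if "s \<in> S" "t \<in> S" "s \<noteq> t" for s t
      using P(1) that by (intro Min_le) (auto simp: P_def)
    ultimately show ?thesis using that[of "Min P / 2"] by auto
  qed
  define T where "T = (\<lambda>s. {x. dist (l s) (l x) < \<delta>})"
  have contl: "continuous_on UNIV l" by (rule holo_on_imp_continuous_on[OF holo_on_polyfun[OF l]])
  have openT: "open (T s)" for s
    unfolding T_def using contl by (intro open_Collect_less continuous_intros)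
  have sT: "s \<in> T s" for s using \<delta> by (simp add: T_def)
  define Om where "Om = (\<Inter>s\<in>S. interior (\<Phi> ` T s))"
  have "open Om" unfolding Om_def using S by auto
  moreover have "w0 \<in> Om" unfolding Om_def using opn openT sT by blast
  ultimately have "\<exists>w\<in>Om. r j w \<noteq> 0"
  proof -
    assume Om: "open Om" "w0 \<in> Om"
    have "\<not> (\<forall>x. r j x = 0)"
    proof
      assume "\<forall>x. r j x = 0"
      then have "\<And>x. (\<Sum>b\<in>M. \<rho> (j, b) * monomial b x) = 0" by (simp add: r_def)
      from monomials_independent[OF fin(1) this jb(2)] show False using jb(3) by simp
    qed
    then show ?thesis using polyfun_zero_on_open[OF polyr Om(1)] Om(2) by blast
  qed
  then obtain w where w: "w \<in> Om" "r j w \<noteq> 0" by blast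
  have "\<exists>x. x \<in> T s \<and> \<Phi> x = w" if "s \<in> S" for s
    using w(1) that interior_subset unfolding Om_def by blast
  then obtain X where X: "\<And>s. s \<in> S \<Longrightarrow> X s \<in> T s" "\<And>s. s \<in> S \<Longrightarrow> \<Phi> (X s) = w" by metis
  define q where "q = (\<Sum>i\<le>A. monom (r i w) i)"
  have "coeff q j = r j w" using jb(1) by (simp add: q_def coeff_sum if_distrib cong: if_cong)
  then have q0: "q \<noteq> 0" using w(2) by auto
  have degq: "degree q \<le> A" unfolding q_def by (intro degree_sum_le) (auto intro: order_trans[OF degree_monom_le])
  have "inj_on (\<lambda>s. l (X s)) S"
  proof (rule inj_onI, rule ccontr)
    fix s t assume st: "s \<in> S" "t \<in> S" "l (X s) = l (X t)" "s \<noteq> t"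
    have "dist (l s) (l t) \<le> dist (l s) (l (X s)) + dist (l t) (l (X t))"
      using st(3) by (metis dist_commute dist_triangle)
    also have "\<dots> < 2 * \<delta>" using X(1)[OF st(1)] X(1)[OF st(2)] by (simp add: T_def)
    finally show False using \<delta>(2)[OF st(1,2,4)] by simp
  qed
  moreover have "(\<lambda>s. l (X s)) ` S \<subseteq> {t. poly q t = 0}"
    using rel X(2) by (auto simp: q_def poly_sum poly_monom)
  ultimately have "card S \<le> card {t. poly q t = 0}"
    using card_inj_on_le poly_roots_finite[OF q0] by blast
  also have "\<dots> \<le> degree q" by (rule card_poly_roots_bound[OF q0])
  finally show ?thesis using degq by (simp add: A_def)
qed

section \<open>Homogeneous holomorphic functions\<close>

definition set_coord :: "complex ^ 'a::finite \<Rightarrow> 'a \<Rightarrow> complex \<Rightarrow> complex ^ 'a" where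
  "set_coord x i t = (\<chi> j. if j = i then t else x $ j)"

lemma set_coord_nth [simp]: "set_coord x i t $ j = (if j = i then t else x $ j)"
  by (simp add: set_coord_def)

lemma set_coord_same [simp]: "set_coord x i (x $ i) = x"
  by (simp add: vec_eq_iff)

lemma set_coord_eq_line: "set_coord x i t = set_coord x i 0 + t *s axis i 1"
  by (simp add: vec_eq_iff axis_def)

text \<open>The nodes \<open>1, \<dots>, K + 1\<close> are nonzero; this is what allows interpolation on a space without its
  origin.\<close>

lemma lagrange_interpolation:
  "\<exists>L. \<forall>p. degree p \<le> K \<longrightarrow> (\<forall>t::complex. poly p t = (\<Sum>m\<le>K. poly p (of_nat (Suc m)) * poly (L m) t))"
proof -
  define L :: "nat \<Rightarrow> complex poly" where
    "L = (\<lambda>m. \<Prod>j\<in>{..K} - {m}. smult (1 / (of_nat (Suc m) - of_nat (Suc j))) [:- of_nat (Suc j), 1:])"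
  have L: "poly (L m) (of_nat (Suc n)) = (if n = m then 1 else 0)" if "m \<le> K" "n \<le> K" for m n
  proof (cases "n = m")
    case True
    have "poly (smult (1 / (of_nat (Suc m) - of_nat (Suc j))) [:- of_nat (Suc j), 1:]) (of_nat (Suc m)) = (1::complex)"
      if "j \<in> {..K} - {m}" for j
    proof -
      have "of_nat (Suc m) - of_nat (Suc j) \<noteq> (0::complex)" using that by (auto simp del: of_nat_Suc)
      then show ?thesis by (simp add: diff_divide_distrib[symmetric] del: of_nat_Suc)
    qed
    then show ?thesis using True unfolding L_def poly_prod by simp
  next
    case False
    then have "n \<in> {..K} - {m}" using that by auto
    then show ?thesis using False by (auto simp: L_def poly_prod simp del: of_nat_Suc intro!: prod_zero bexI[of _ n])
  qed
  have degL: "degree (L m) \<le> K" if "m \<le> K" for m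
  proof -
    define F where "F = (\<lambda>j. smult (1 / (of_nat (Suc m) - of_nat (Suc j))) [:- of_nat (Suc j), 1::complex:])"
    have "degree (L m) \<le> (\<Sum>j\<in>{..K} - {m}. degree (F j))"
      using degree_prod_sum_le[of "{..K} - {m}" F] by (simp only: L_def F_def o_def finite_Diff finite_atMost simp_thms)
    also have "\<dots> \<le> (\<Sum>j\<in>{..K} - {m}. 1)"
      unfolding F_def by (intro sum_mono order_trans[OF degree_smult_le]) auto
    also have "\<dots> = K" using that by simp
    finally show ?thesis .
  qed
  have "poly p t = (\<Sum>m\<le>K. poly p (of_nat (Suc m)) * poly (L m) t)" if p: "degree p \<le> K" for p t
  proof -
    define q where "q = p - (\<Sum>m\<le>K. smult (poly p (of_nat (Suc m))) (L m))"
    have dq: "degree q \<le> K"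
      unfolding q_def
      by (intro degree_diff_le p degree_sum_le order_trans[OF degree_smult_le] degL) auto
    have roots: "poly q (of_nat (Suc n)) = 0" if "n \<le> K" for n
      using that by (simp add: q_def poly_sum L if_distrib[of "\<lambda>c. _ * c"] del: of_nat_Suc cong: if_cong)
    have "q = 0"
    proof (rule ccontr)
      assume "q \<noteq> 0"
      have "K + 1 = card ((\<lambda>n. of_nat (Suc n) :: complex) ` {..K})"
        by (subst card_image) (auto simp: inj_on_def simp del: of_nat_Suc)
      also have "\<dots> \<le> card {t. poly q t = 0}"
        by (rule card_mono) (use roots poly_roots_finite[OF \<open>q \<noteq> 0\<close>] in auto)
      also have "\<dots> \<le> degree q" by (rule card_poly_roots_bound[OF \<open>q \<noteq> 0\<close>])
      finally show False using dq by simp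
    qed
    then have "poly q t = 0" by simp
    then show ?thesis by (simp add: q_def poly_sum)
  qed
  then show ?thesis by blast
qed

lemma polyfun_poly_nth: "\<exists>n. polyfun n (\<lambda>x. poly p (x $ i))"
proof -
  have "polyfun (Suc n) (\<lambda>x. x $ i) \<Longrightarrow> \<exists>n. polyfun n (\<lambda>x. poly p (x $ i))" for n
  proof (induction p)
    case 0
    then show ?case using polyfun_const[of 0 0] by auto
  next
    case (pCons a p)
    then obtain m where "polyfun m (\<lambda>x. poly p (x $ i))" by blast
    then have "polyfun (Suc n + m) (\<lambda>x. a + x $ i * poly p (x $ i))"
      by (intro polyfun_add polyfun_const polyfun_mult polyfun_nth)
    then show ?case by (auto simp: mult.commute)
  qed
  then show ?thesis using polyfun_nth[of 0 i] by blast
qed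

lemma polyfun_ex_mult:
  "\<exists>n. polyfun n f \<Longrightarrow> \<exists>n. polyfun n g \<Longrightarrow> \<exists>n. polyfun n (\<lambda>x. f x * g x)"
  by (elim exE, rule exI, erule polyfun_mult)

lemma polyfun_ex_sum:
  assumes "finite I" "\<And>i. i \<in> I \<Longrightarrow> \<exists>n. polyfun n (f i)"
  shows "\<exists>n. polyfun n (\<lambda>x. \<Sum>i\<in>I. f i x)"
  using assms
proof (induction I rule: finite_induct)
  case empty
  then show ?case using polyfun_const[of 0 0] by auto
next
  case (insert i I)
  have "\<exists>n. polyfun n (\<lambda>x. \<Sum>i\<in>I. f i x)" by (rule insert.IH) (use insert.prems in auto)
  then obtain m n where "polyfun m (f i)" "polyfun n (\<lambda>x. \<Sum>i\<in>I. f i x)"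
    using insert.prems[of i] by blast
  then have "polyfun (m + n) (f i)" "polyfun (m + n) (\<lambda>x. \<Sum>i\<in>I. f i x)"
    by (auto elim: polyfun_mono)
  from polyfun_add[OF this] insert.hyps show ?case by auto
qed

text \<open>Interpolation in one coordinate of \<open>S\<close> leaves functions that depend on the others only.\<close>

lemma separately_polynomial_imp_polyfun_aux:
  fixes h :: "complex ^ 'a::finite \<Rightarrow> complex"
  assumes "finite S"
    and "\<And>x i. i \<in> S \<Longrightarrow> \<exists>p. degree p \<le> K \<and> (\<forall>t. h (set_coord x i t) = poly p t)"
    and "\<And>x y. (\<And>i. i \<in> S \<Longrightarrow> x $ i = y $ i) \<Longrightarrow> h x = h y"
  shows "\<exists>n. polyfun n h"
  using assms
proof (induction S arbitrary: h rule: finite_induct)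
  case empty
  have "h x = h 0" for x using empty(2)[of x 0] by simp
  then have "h = (\<lambda>_. h 0)" by auto
  then show ?case using polyfun_const[of 0 "h 0"] by metis
next
  case (insert i S)
  obtain L where L: "\<And>(p :: complex poly) t. degree p \<le> K \<Longrightarrow> poly p t = (\<Sum>m\<le>K. poly p (of_nat (Suc m)) * poly (L m) t)"
    using lagrange_interpolation by metis
  have h: "h x = (\<Sum>m\<le>K. h (set_coord x i (of_nat (Suc m))) * poly (L m) (x $ i))" for x
  proof -
    obtain p where p: "degree p \<le> K" "\<And>t. h (set_coord x i t) = poly p t"
      using insert.prems(1)[of i x] by blast
    show ?thesis using L[OF p(1), of "x $ i"] by (simp del: of_nat_Suc flip: p(2))
  qed
  have "\<exists>n. polyfun n (\<lambda>x :: complex ^ 'a. h (set_coord x i t))" for t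
  proof (rule insert.IH)
    fix x :: "complex ^ 'a" and j assume j: "j \<in> S"
    then have "set_coord (set_coord x j s) i t = set_coord (set_coord x i t) j s" for s
      using insert.hyps by (auto simp: vec_eq_iff)
    then show "\<exists>p. degree p \<le> K \<and> (\<forall>s. h (set_coord (set_coord x j s) i t) = poly p s)"
      using insert.prems(1)[of j "set_coord x i t"] j by simp
  next
    fix x y :: "complex ^ 'a" assume "\<And>j. j \<in> S \<Longrightarrow> x $ j = y $ j"
    then show "h (set_coord x i t) = h (set_coord y i t)" by (intro insert.prems(2)) auto
  qed
  then have "\<exists>n. polyfun n (\<lambda>x. \<Sum>m\<le>K. h (set_coord x i (of_nat (Suc m))) * poly (L m) (x $ i))"
    by (intro polyfun_ex_sum polyfun_ex_mult polyfun_poly_nth finite_atMost)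
  moreover have "h = (\<lambda>x. \<Sum>m\<le>K. h (set_coord x i (of_nat (Suc m))) * poly (L m) (x $ i))"
    by (rule ext, rule h)
  ultimately show ?case by (simp only:)
qed

lemma separately_polynomial_imp_polyfun:
  fixes h :: "complex ^ 'a::finite \<Rightarrow> complex"
  assumes "\<And>x i. \<exists>p. degree p \<le> K \<and> (\<forall>t. h (set_coord x i t) = poly p t)"
  shows "\<exists>n. polyfun n h"
proof (rule separately_polynomial_imp_polyfun_aux[of UNIV K])
  fix x y :: "complex ^ 'a" assume "\<And>i. i \<in> UNIV \<Longrightarrow> x $ i = y $ i"
  then have "x = y" by (simp add: vec_eq_iff)
  then show "h x = h y" by simp
qed (use assms in auto)

lemma entire_polynomial_growth:
  assumes "f holomorphic_on UNIV" "\<And>z. A \<le> norm z \<Longrightarrow> norm (f z) \<le> B * norm z ^ n"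
  shows "\<exists>p. degree p \<le> n \<and> (\<forall>z::complex. f z = poly p z)"
proof -
  define p where "p = (\<Sum>k\<le>n. monom ((deriv ^^ k) f 0 / fact k) k)"
  have "degree p \<le> n"
    unfolding p_def by (intro degree_sum_le) (auto intro: order_trans[OF degree_monom_le])
  moreover have "f z = poly p z" for z
    using Liouville_polynomial[OF assms, where \<xi>=z] by (simp add: p_def poly_sum poly_monom)
  ultimately show ?thesis by blast
qed

lemma holo_on_line_polynomial:
  fixes h :: "complex ^ 'a::finite \<Rightarrow> complex"
  assumes h: "holo_on (- {0}) h" and growth: "\<And>z. 1 \<le> norm z \<Longrightarrow> norm (h z) \<le> M * norm z ^ n"
    and off: "\<And>t. z + t *s v \<noteq> 0" and v: "v \<noteq> 0"
  shows "\<exists>p. degree p \<le> n \<and> (\<forall>t. h (z + t *s v) = poly p t)"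
proof (rule entire_polynomial_growth)
  show "(\<lambda>t. h (z + t *s v)) holomorphic_on UNIV"
    by (rule holo_on_compose_line_holomorphic[OF h]) (use off in auto)
  fix t :: complex assume t: "max ((norm z + 1) / norm v) 1 \<le> norm t"
  have nv: "norm v > 0" using v by simp
  have M: "M \<ge> 0"
  proof -
    define w where "w = (1 / norm v) *\<^sub>R v"
    have "norm w = 1" using nv by (simp add: w_def)
    then show ?thesis using order_trans[OF norm_ge_zero growth[of w]] by simp
  qed
  have tv: "norm z + 1 \<le> norm t * norm v" using t nv by (simp add: field_simps)
  have "norm (z + t *s v) \<ge> norm (t *s v) - norm z"
    using norm_diff_ineq[of "t *s v" z] by (simp add: add.commute)
  then have "1 \<le> norm (z + t *s v)" using tv by (simp add: norm_smult_complex)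
  then have "norm (h (z + t *s v)) \<le> M * norm (z + t *s v) ^ n" by (rule growth)
  also have "\<dots> \<le> M * (2 * norm v * norm t) ^ n"
  proof (intro mult_left_mono power_mono M)
    show "norm (z + t *s v) \<le> 2 * norm v * norm t"
      using norm_triangle_ineq[of z "t *s v"] tv by (simp add: norm_smult_complex mult.commute)
  qed auto
  finally show "norm (h (z + t *s v)) \<le> (M * (2 * norm v) ^ n) * norm t ^ n"
    by (simp add: power_mult_distrib mult.assoc)
qed

text \<open>On a coordinate line that avoids the origin the function is entire of polynomial growth, so it is a
  polynomial by Liouville's theorem. Interpolating first in a coordinate \<open>i0\<close> at nonzero nodes keeps
  all remaining lines away from the origin, and the resulting polynomial agrees with \<open>h\<close> off the axis
  of \<open>i0\<close>, hence everywhere by continuity. This replaces Hartogs' extension theorem.\<close>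

lemma holo_on_punctured_space_polynomial:
  fixes h :: "complex ^ 'a::finite \<Rightarrow> complex"
  assumes card: "CARD('a) \<ge> 2" and h: "holo_on (- {0}) h"
    and growth: "\<And>z. 1 \<le> norm z \<Longrightarrow> norm (h z) \<le> M * norm z ^ n"
  shows "\<exists>m p. polyfun m p \<and> (\<forall>z. z \<noteq> 0 \<longrightarrow> h z = p z)"
proof -
  obtain i0 i1 :: 'a where i01: "i0 \<noteq> i1"
    using card by (metis One_nat_def Suc_1 card_1_singleton_iff card_le_Suc0_iff_eq finite not_less_eq_eq UNIV_I)
  have line: "\<exists>p. degree p \<le> n \<and> (\<forall>t. h (set_coord x i t) = poly p t)" if ji: "j \<noteq> i" "x $ j \<noteq> 0" for x i j
  proof -
    have "set_coord x i 0 + t *s axis i 1 \<noteq> 0" for t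
      using ji by (auto simp: vec_eq_iff axis_def)
    moreover have "axis i 1 \<noteq> (0 :: complex ^ 'a)" by simp
    ultimately have "\<exists>p. degree p \<le> n \<and> (\<forall>t. h (set_coord x i 0 + t *s axis i 1) = poly p t)"
      by (intro holo_on_line_polynomial[OF h growth]) auto
    then show ?thesis by (subst set_coord_eq_line)
  qed
  obtain L where L: "\<And>(p :: complex poly) t. degree p \<le> n \<Longrightarrow> poly p t = (\<Sum>m\<le>n. poly p (of_nat (Suc m)) * poly (L m) t)"
    using lagrange_interpolation by metis
  define P where "P = (\<lambda>x. \<Sum>m\<le>n. h (set_coord x i0 (of_nat (Suc m))) * poly (L m) (x $ i0))"
  have "\<exists>k. polyfun k (\<lambda>x. h (set_coord x i0 (of_nat (Suc m))))" for m
  proof (rule separately_polynomial_imp_polyfun)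
    fix x :: "complex ^ 'a" and i
    show "\<exists>p. degree p \<le> n \<and> (\<forall>t. h (set_coord (set_coord x i t) i0 (of_nat (Suc m))) = poly p t)"
    proof (cases "i = i0")
      case True
      then have "set_coord (set_coord x i t) i0 (of_nat (Suc m)) = set_coord x i0 (of_nat (Suc m))" for t
        by (simp add: vec_eq_iff)
      then show ?thesis by (intro exI[of _ "[:h (set_coord x i0 (of_nat (Suc m))):]"]) simp
    next
      case False
      then have "set_coord (set_coord x i t) i0 (of_nat (Suc m)) = set_coord (set_coord x i0 (of_nat (Suc m))) i t" for t
        by (auto simp: vec_eq_iff)
      then show ?thesis
        using line[of i0 i "set_coord x i0 (of_nat (Suc m))"] False
        by (simp add: of_nat_neq_0 del: of_nat_Suc)
    qed
  qed
  then have "\<exists>k. polyfun k P"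
    unfolding P_def
    by (intro polyfun_ex_sum polyfun_ex_mult polyfun_poly_nth finite_atMost)
  then obtain k where k: "polyfun k P" by blast
  have eq: "h x = P x" if off: "j \<noteq> i0" "x $ j \<noteq> 0" for x j
  proof -
    obtain p where p: "degree p \<le> n" "\<And>t. h (set_coord x i0 t) = poly p t"
      using line[OF off] by blast
    show ?thesis using L[OF p(1), of "x $ i0"] by (simp add: P_def del: of_nat_Suc flip: p(2))
  qed
  have "h x = P x" if x: "x \<noteq> 0" for x
  proof (cases "\<exists>j. j \<noteq> i0 \<and> x $ j \<noteq> 0")
    case True
    then show ?thesis using eq by blast
  next
    case False
    define g where "g = (\<lambda>t. x + t *s axis i1 (1::complex))"
    have gx: "h (g t) = P (g t)" if "t \<noteq> 0" for t
    proof (rule eq)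
      have "x $ i1 = 0" using False i01 by auto
      then show "g t $ i1 \<noteq> 0" using that by (simp add: g_def axis_def)
    qed (use i01 in auto)
    have g0: "(g \<longlongrightarrow> x) (at 0)"
      unfolding g_def by (auto intro!: tendsto_eq_intros)
    have "isCont h x"
      using holo_on_imp_continuous_on[OF h] x by (simp add: continuous_on_eq_continuous_at open_Compl)
    then have "((\<lambda>t. h (g t)) \<longlongrightarrow> h x) (at 0)" using g0 isCont_tendsto_compose by blast
    moreover have "isCont P x"
      using holo_on_imp_continuous_on[OF holo_on_polyfun[OF k], of UNIV] by (simp add: continuous_on_eq_continuous_at)
    then have "((\<lambda>t. P (g t)) \<longlongrightarrow> P x) (at 0)" using g0 isCont_tendsto_compose by blast
    then have "((\<lambda>t. h (g t)) \<longlongrightarrow> P x) (at 0)"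
      by (rule Lim_transform_eventually) (auto simp: eventually_at_filter gx)
    ultimately show ?thesis using LIM_unique by blast
  qed
  then show ?thesis using k by blast
qed

lemma exists_norm_bound_sphere:
  fixes h :: "complex ^ 'a::finite \<Rightarrow> complex"
  assumes "continuous_on (- {0}) h"
  shows "\<exists>M. \<forall>z. norm z = 1 \<longrightarrow> norm (h z) \<le> M"
proof -
  have "continuous_on (sphere 0 1) h" by (rule continuous_on_subset[OF assms]) auto
  then have "compact (h ` sphere 0 1)" by (intro compact_continuous_image) auto
  then obtain M where "\<forall>w\<in>h ` sphere 0 1. norm w \<le> M" using compact_imp_bounded bounded_iff by blast
  then show ?thesis by (auto intro!: exI[of _ M])
qed

lemma homogeneous_growth:
  fixes h :: "complex ^ 'a::finite \<Rightarrow> complex"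
  assumes cont: "continuous_on (- {0}) h"
    and hom: "\<And>c z. c \<noteq> 0 \<Longrightarrow> z \<noteq> 0 \<Longrightarrow> h (c *s z) = \<kappa> c * h z"
    and \<kappa>: "\<And>c. 1 \<le> norm c \<Longrightarrow> norm (\<kappa> c) \<le> norm c ^ n"
  shows "\<exists>M. \<forall>z. 1 \<le> norm z \<longrightarrow> norm (h z) \<le> M * norm z ^ n"
proof -
  obtain M where M: "\<And>z. norm z = 1 \<Longrightarrow> norm (h z) \<le> M" using exists_norm_bound_sphere[OF cont] by blast
  have "norm (h z) \<le> M * norm z ^ n" if z: "1 \<le> norm z" for z
  proof -
    define c where "c = complex_of_real (norm z)"
    define w where "w = (1 / c) *s z"
    have c: "c \<noteq> 0" "norm c = norm z" using z by (auto simp: c_def)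
    have w: "norm w = 1" using z by (auto simp: w_def norm_smult_complex c norm_divide)
    have "w \<noteq> 0" using w by auto
    have "z = c *s w" using c by (simp add: w_def vector_smult_assoc)
    then have "norm (h z) = norm (\<kappa> c) * norm (h w)" using hom[OF c(1) \<open>w \<noteq> 0\<close>] by (simp add: norm_mult)
    also have "\<dots> \<le> norm z ^ n * M"
      using \<kappa>[of c] z c M[OF w] by (intro mult_mono) auto
    finally show ?thesis by (simp add: mult.commute)
  qed
  then show ?thesis by blast
qed

lemma holo_on_homogeneous_polynomial:
  fixes h :: "complex ^ 'a::finite \<Rightarrow> complex"
  assumes card: "CARD('a) \<ge> 2" and h: "holo_on (- {0}) h"
    and hom: "\<And>c z. c \<noteq> 0 \<Longrightarrow> z \<noteq> 0 \<Longrightarrow> h (c *s z) = c ^ n * h z"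
  shows "\<exists>p. polyfun n p \<and> (\<forall>z. z \<noteq> 0 \<longrightarrow> h z = p z) \<and> (\<forall>c z. c \<noteq> 0 \<longrightarrow> p (c *s z) = c ^ n * p z)"
proof -
  obtain M where "\<And>z. 1 \<le> norm z \<Longrightarrow> norm (h z) \<le> M * norm z ^ n"
    using homogeneous_growth[OF holo_on_imp_continuous_on[OF h], of "\<lambda>c. c ^ n" n] hom
    by (auto simp: norm_power)
  from holo_on_punctured_space_polynomial[OF card h this]
  obtain m p where p: "polyfun m p" "\<And>z. z \<noteq> 0 \<Longrightarrow> h z = p z" by blast
  have ph: "p (c *s z) = c ^ n * p z" if c: "c \<noteq> 0" for c z
  proof -
    have "polyfun m (\<lambda>z. p (c *s z))"
    proof -
      have "polyfun 1 (\<lambda>z. (c *s z) $ i)" for i :: 'a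
        using polyfun_cmult[OF polyfun_nth[of 0 i], of c] by simp
      from polyfun_compose[OF p(1) this] show ?thesis by simp
    qed
    then have "polyfun m (\<lambda>z. p (c *s z) + (- (c ^ n)) * p z)"
      by (intro polyfun_add polyfun_cmult p(1))
    from polyfun_zero_on_open[OF this, of "- {0}" z]
    show ?thesis using hom[OF c] p(2) c by (auto simp: open_Compl vec_eq_iff)
  qed
  have "polyfun n p" by (rule polyfun_homogeneous_degree[OF p(1) ph])
  then show ?thesis using p(2) ph by blast
qed

section \<open>Divisors on a punctured vector space\<close>

text \<open>A divisor on the space of nonzero vectors, invariant under scaling, with local equations \<open>f i\<close> and
  transition units \<open>g i j\<close>. The factor \<open>\<kappa>\<close> records the homogeneity of the local equations. The
  vector \<open>e\<close> lies outside the support and fixes the direction of the lines on which the divisor is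
  studied.\<close>

locale cone_divisor =
  fixes V :: "'i \<Rightarrow> (complex ^ 'm::finite) set" and f :: "'i \<Rightarrow> complex ^ 'm \<Rightarrow> complex"
    and g :: "'i \<Rightarrow> 'i \<Rightarrow> complex ^ 'm \<Rightarrow> complex" and \<kappa> :: "complex \<Rightarrow> complex" and e :: "complex ^ 'm"
  assumes card_ge: "CARD('m) \<ge> 2"
    and open_V: "open (V i)"
    and V_nonzero: "z \<in> V i \<Longrightarrow> z \<noteq> 0"
    and cover: "z \<noteq> 0 \<Longrightarrow> \<exists>i. z \<in> V i"
    and cone: "z \<in> V i \<Longrightarrow> c \<noteq> 0 \<Longrightarrow> c *s z \<in> V i"
    and holo_f: "holo_on (V i) (f i)"
    and transition: "z \<in> V i \<Longrightarrow> z \<in> V j \<Longrightarrow> f i z = g i j z * f j z"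
    and g_nonzero: "z \<in> V i \<Longrightarrow> z \<in> V j \<Longrightarrow> g i j z \<noteq> 0"
    and holo_g: "holo_on (V i \<inter> V j) (g i j)"
    and hom: "z \<in> V i \<Longrightarrow> c \<noteq> 0 \<Longrightarrow> f i (c *s z) = \<kappa> c * f i z"
    and kappa_nonzero: "c \<noteq> 0 \<Longrightarrow> \<kappa> c \<noteq> 0"
    and e_nonzero: "\<exists>i. e \<in> V i \<and> f i e \<noteq> 0"
begin

definition zeros :: "(complex ^ 'm) set" where
  "zeros = {z. z \<noteq> 0 \<and> (\<exists>i. z \<in> V i \<and> f i z = 0)}"

lemma zeros_iff: "z \<in> V i \<Longrightarrow> z \<in> zeros \<longleftrightarrow> f i z = 0"
proof -
  assume i: "z \<in> V i"
  have "f i z = 0" if "z \<in> V j" "f j z = 0" for j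
    using transition[OF i that(1)] that(2) by simp
  then show ?thesis using i V_nonzero[OF i] by (auto simp: zeros_def)
qed

lemma e_not_0: "e \<noteq> 0"
  using e_nonzero V_nonzero by blast

lemma open_nonzero_part: "open {z \<in> V i. f i z \<noteq> 0}"
proof -
  have "{z \<in> V i. f i z \<noteq> 0} = V i \<inter> f i -` (- {0})" by auto
  moreover have "open (V i \<inter> f i -` (- {0}))"
    by (rule continuous_open_preimage[OF holo_on_imp_continuous_on[OF holo_f] open_V]) auto
  ultimately show ?thesis by simp
qed

lemma compl_zeros_eq: "{z. z \<noteq> 0 \<and> z \<notin> zeros} = (\<Union>i. {z \<in> V i. f i z \<noteq> 0})"
proof (rule set_eqI)
  fix z
  show "z \<in> {z. z \<noteq> 0 \<and> z \<notin> zeros} \<longleftrightarrow> z \<in> (\<Union>i. {z \<in> V i. f i z \<noteq> 0})"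
    using cover[of z] V_nonzero[of z] zeros_iff[of z] by auto
qed

lemma open_compl_zeros: "open {z. z \<noteq> 0 \<and> z \<notin> zeros}"
  unfolding compl_zeros_eq using open_nonzero_part by blast

lemma zeros_smult: "c \<noteq> 0 \<Longrightarrow> c *s z \<in> zeros \<longleftrightarrow> z \<in> zeros"
proof -
  have *: "c *s z \<in> zeros" if zc: "z \<in> zeros" "c \<noteq> 0" for c z
  proof -
    obtain i where i: "z \<in> V i" "f i z = 0" using zc unfolding zeros_def by blast
    then show ?thesis using hom[OF i(1) zc(2)] zeros_iff[OF cone[OF i(1) zc(2)]] by simp
  qed
  assume c: "c \<noteq> 0"
  have "z = (1 / c) *s (c *s z)" using c by (simp add: vector_smult_assoc)
  then show ?thesis using *[of z c] *[of "c *s z" "1 / c"] c by auto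
qed

text \<open>The axis is left out because the divisor is not defined at the origin: on every other line of
  direction \<open>e\<close> the divisor can be followed over the whole complex plane.\<close>

definition off_axis :: "(complex ^ 'm) set" where
  "off_axis = {z. \<forall>c. z \<noteq> c *s e}"

lemma off_axis_nonzero: "z \<in> off_axis \<Longrightarrow> z \<noteq> 0"
  unfolding off_axis_def by (metis (mono_tags) mem_Collect_eq vector_smult_lzero)

lemma off_axis_add: "z + s *s e \<in> off_axis \<longleftrightarrow> z \<in> off_axis"
proof -
  have "z + s *s e = c *s e \<longleftrightarrow> z = (c - s) *s e" for c
    by (auto simp: vec_eq_iff algebra_simps)
  moreover have "(\<forall>c. z \<noteq> (c - s) *s e) \<longleftrightarrow> (\<forall>c. z \<noteq> c *s e)"
    by (metis add_diff_cancel_right')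
  ultimately show ?thesis unfolding off_axis_def by blast
qed

lemma off_axis_smult: "c \<noteq> 0 \<Longrightarrow> c *s z \<in> off_axis \<longleftrightarrow> z \<in> off_axis"
proof -
  assume c: "c \<noteq> 0"
  have "c *s z = a *s e \<longleftrightarrow> z = (a / c) *s e" for a
    using c by (auto simp: vec_eq_iff field_simps)
  moreover have "(\<forall>a. z \<noteq> (a / c) *s e) \<longleftrightarrow> (\<forall>a. z \<noteq> a *s e)"
    using c by (metis nonzero_mult_div_cancel_right)
  ultimately show ?thesis unfolding off_axis_def by blast
qed

lemma open_off_axis: "open off_axis"
proof -
  have "subspace (range (\<lambda>c. c *s e))"
    using linear_subspace_image[OF bounded_linear.linear[OF bounded_linear_smult_left] subspace_UNIV] .
  then have "closed (range (\<lambda>c. c *s e))" by (rule closed_subspace)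
  moreover have "off_axis = - range (\<lambda>c. c *s e)" unfolding off_axis_def by auto
  ultimately show ?thesis by (simp add: open_Compl)
qed

text \<open>The parameter is measured from \<open>z\<close>, so that the product of the \<open>- s\<close> is the value at \<open>z\<close> of the monic
  polynomial with these roots.\<close>

definition roots :: "complex ^ 'm \<Rightarrow> complex set" where
  "roots z = {s. z + s *s e \<in> zeros}"

lemma roots_add: "roots (z + t *s e) = (\<lambda>s. s - t) ` roots z"
proof -
  have *: "z + t *s e + s *s e = z + (s + t) *s e" for s by (simp add: vec_eq_iff algebra_simps)
  show ?thesis
  proof
    show "roots (z + t *s e) \<subseteq> (\<lambda>s. s - t) ` roots z"
      by (auto simp: roots_def * intro!: image_eqI[of _ _ "_ + t"])
    show "(\<lambda>s. s - t) ` roots z \<subseteq> roots (z + t *s e)"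
      by (auto simp: roots_def *)
  qed
qed

lemma roots_smult: "c \<noteq> 0 \<Longrightarrow> roots (c *s z) = (\<lambda>s. c * s) ` roots z"
proof -
  assume c: "c \<noteq> 0"
  have *: "c *s z + (c * s) *s e = c *s (z + s *s e)" for s by (simp add: vec_eq_iff algebra_simps)
  have "s \<in> (\<lambda>s. c * s) ` roots z" if "s \<in> roots (c *s z)" for s
  proof (rule image_eqI)
    show s: "s = c * (s / c)" using c by simp
    have "c *s z + s *s e \<in> zeros" using that by (simp add: roots_def)
    then have "c *s (z + (s / c) *s e) \<in> zeros" unfolding *[symmetric] s[symmetric] .
    then have "z + (s / c) *s e \<in> zeros" by (rule zeros_smult[OF c, THEN iffD1])
    then show "s / c \<in> roots z" by (simp add: roots_def)
  qed
  moreover have "c * s \<in> roots (c *s z)" if "s \<in> roots z" for s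
    using that unfolding roots_def mem_Collect_eq * by (rule zeros_smult[OF c, THEN iffD2])
  ultimately show ?thesis by blast
qed

text \<open>Far out on a line of direction \<open>e\<close> the points are close to the ray of \<open>e\<close>, where the divisor is
  absent.\<close>

lemma roots_bound:
  obtains B where "B > 0" "\<And>z s. z + s *s e \<in> zeros \<Longrightarrow> norm s \<le> B * norm z"
proof -
  have "e \<in> {z. z \<noteq> 0 \<and> z \<notin> zeros}" using e_nonzero zeros_iff e_not_0 by auto
  then obtain \<delta> where \<delta>: "\<delta> > 0" "ball e \<delta> \<subseteq> {z. z \<noteq> 0 \<and> z \<notin> zeros}"
    using open_compl_zeros open_contains_ball by blast
  have "norm s \<le> (1 / \<delta>) * norm z" if zs: "z + s *s e \<in> zeros" for z s
  proof (rule ccontr)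
    assume "\<not> ?thesis"
    then have s: "norm z < \<delta> * norm s" using \<delta> by (simp add: field_simps)
    then have s0: "s \<noteq> 0" using \<delta> norm_ge_zero[of z] by auto
    have "dist e (e + (1 / s) *s z) = norm z / norm s"
      by (simp add: dist_norm norm_smult_complex norm_divide)
    also have "\<dots> < \<delta>" using s s0 by (simp add: field_simps)
    finally have "e + (1 / s) *s z \<in> ball e \<delta>" by simp
    then have "e + (1 / s) *s z \<notin> zeros" using \<delta> by auto
    have "z + s *s e = s *s (e + (1 / s) *s z)"
      using s0 by (simp add: vec_eq_iff field_simps)
    then have "s *s (e + (1 / s) *s z) \<in> zeros" using zs by metis
    moreover note \<open>e + (1 / s) *s z \<notin> zeros\<close>
    ultimately show False using zeros_smult[OF s0] by blast
  qed
  then show ?thesis using that[of "1 / \<delta>"] \<delta> by simp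
qed

lemma line_holomorphic: "(\<lambda>s. f i (z + s *s e)) holomorphic_on {s. z + s *s e \<in> V i}"
  by (rule holo_on_compose_line_holomorphic[OF holo_f]) auto

lemma open_line: "open {s. z + s *s e \<in> V i}"
  by (rule open_line_preimage[OF open_V])

lemma line_nonzero: "z \<in> off_axis \<Longrightarrow> z + s *s e \<noteq> 0"
  using off_axis_add off_axis_nonzero by blast

text \<open>The limit points of the roots form an open and closed set, by the identity theorem applied to the
  local equations, and this set is bounded.\<close>

lemma roots_no_limit_point:
  assumes z: "z \<in> off_axis"
  shows "\<not> s islimpt roots z"
proof
  assume s: "s islimpt roots z"
  define L where "L = {s. s islimpt roots z}"
  have "closed L" unfolding L_def by (rule closed_limpts)
  moreover have "open L"
    unfolding open_contains_ball
  proof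
    fix s assume "s \<in> L"
    then have s: "s islimpt roots z" by (simp add: L_def)
    obtain i where i: "z + s *s e \<in> V i" using cover line_nonzero[OF z] by blast
    obtain r where r: "r > 0" "ball s r \<subseteq> {s. z + s *s e \<in> V i}"
      using open_line[of z i] i unfolding open_contains_ball by blast
    have iff: "t \<in> roots z \<longleftrightarrow> f i (z + t *s e) = 0" if "t \<in> ball s r" for t
      using r that zeros_iff by (auto simp: roots_def)
    have "s islimpt (ball s r \<inter> roots z)"
    proof (rule islimptI)
      fix T assume "s \<in> T" "open T"
      then show "\<exists>y\<in>ball s r \<inter> roots z. y \<in> T \<and> y \<noteq> s"
        using islimptE[OF s, of "T \<inter> ball s r"] r(1) by (metis Int_iff centre_in_ball open_Int open_ball)
    qed
    then have lim: "s islimpt {t \<in> ball s r. f i (z + t *s e) = 0}"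
      by (rule islimpt_subset) (use iff in auto)
    have "f i (z + t *s e) = 0" if "t \<in> ball s r" for t
      by (rule analytic_continuation[of "\<lambda>t. f i (z + t *s e)" "ball s r" "{t \<in> ball s r. f i (z + t *s e) = 0}" s])
         (use r lim that holomorphic_on_subset[OF line_holomorphic] in auto)
    then have sub: "ball s r \<subseteq> roots z" using iff by blast
    have "ball s r \<subseteq> L"
    proof
      fix t assume "t \<in> ball s r"
      then have "t islimpt ball s r" by (simp add: open_imp_islimpt)
      then show "t \<in> L" unfolding L_def using sub islimpt_subset by blast
    qed
    then show "\<exists>r>0. ball s r \<subseteq> L" using r by blast
  qed
  ultimately have "L = UNIV" using s clopen[of L] by (auto simp: L_def)
  obtain B where B: "\<And>z s. z + s *s e \<in> zeros \<Longrightarrow> norm s \<le> B * norm z" using roots_bound by metis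
  then have "roots z \<subseteq> cball 0 (B * norm z)" by (auto simp: roots_def)
  then have "L \<subseteq> cball 0 (B * norm z)"
    unfolding L_def using closed_cball[of "0::complex" "B * norm z"]
    by (auto simp: closed_limpt dest: islimpt_subset)
  then have "bounded (UNIV :: complex set)" using \<open>L = UNIV\<close> bounded_subset bounded_cball by metis
  then show False using not_bounded_UNIV by blast
qed

lemma finite_roots:
  assumes z: "z \<in> off_axis"
  shows "finite (roots z)"
proof (rule ccontr)
  assume inf: "infinite (roots z)"
  obtain B where B: "\<And>z s. z + s *s e \<in> zeros \<Longrightarrow> norm s \<le> B * norm z" using roots_bound by metis
  then have "roots z \<subseteq> cball 0 (B * norm z)" by (auto simp: roots_def)
  moreover have "compact (cball (0::complex) (B * norm z))" by simp
  ultimately obtain x where "x islimpt roots z"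
    using inf unfolding compact_eq_Bolzano_Weierstrass by blast
  then show False using roots_no_limit_point[OF z] by blast
qed

lemma eventually_not_root:
  assumes "z \<in> off_axis"
  shows "eventually (\<lambda>s. s \<notin> roots z) (at s0)"
  using roots_no_limit_point[OF assms, of s0] by (simp add: islimpt_iff_eventually)

lemma eventually_nonzero:
  assumes "z \<in> off_axis" "z + s0 *s e \<in> V i"
  shows "eventually (\<lambda>s. z + s *s e \<in> V i \<and> f i (z + s *s e) \<noteq> 0) (at s0)"
proof -
  have "eventually (\<lambda>s. z + s *s e \<in> V i) (at s0)"
    using eventually_at_in_open'[OF open_line[of z i], of s0] assms(2) by simp
  then show ?thesis
    using eventually_not_root[OF assms(1), of s0]
    by eventually_elim (auto simp: roots_def zeros_iff)
qed

definition mult :: "complex ^ 'm \<Rightarrow> complex \<Rightarrow> int" where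
  "mult z s = zorder (\<lambda>t. f (SOME i. z + s *s e \<in> V i) (z + t *s e)) s"

lemma analytic_line: "z + s *s e \<in> V i \<Longrightarrow> (\<lambda>t. f i (z + t *s e)) analytic_on {s}"
  using analytic_at line_holomorphic open_line by blast

text \<open>The multiplicity of a root is independent of the local equation, since the equations differ by
  units.\<close>

lemma mult_eq:
  assumes z: "z \<in> off_axis" and i: "z + s *s e \<in> V i"
  shows "mult z s = zorder (\<lambda>t. f i (z + t *s e)) s"
proof -
  define j where "j = (SOME i. z + s *s e \<in> V i)"
  have j: "z + s *s e \<in> V j" unfolding j_def using i by (rule someI)
  have op: "open {t. z + t *s e \<in> V j \<inter> V i}"
    by (rule open_line_preimage) (use open_V in auto)
  have hg: "(\<lambda>t. g j i (z + t *s e)) holomorphic_on {t. z + t *s e \<in> V j \<inter> V i}"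
    by (rule holo_on_compose_line_holomorphic[OF holo_g]) auto
  have ag: "(\<lambda>t. g j i (z + t *s e)) analytic_on {s}"
    unfolding analytic_at using hg op i j by blast
  have ev: "eventually (\<lambda>t. z + t *s e \<in> V j \<inter> V i) (nhds s)"
    using eventually_nhds_in_open[OF op] i j by simp
  have "mult z s = zorder (\<lambda>t. f j (z + t *s e)) s" by (simp add: mult_def j_def)
  also have "\<dots> = zorder (\<lambda>t. g j i (z + t *s e) * f i (z + t *s e)) s"
  proof (rule zorder_cong)
    have "eventually (\<lambda>t. z + t *s e \<in> V j \<inter> V i) (at s)" using ev by (simp add: eventually_nhds_conv_at)
    then show "eventually (\<lambda>t. f j (z + t *s e) = g j i (z + t *s e) * f i (z + t *s e)) (at s)"
      by eventually_elim (auto intro: transition)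
  qed auto
  also have "\<dots> = zorder (\<lambda>t. g j i (z + t *s e)) s + zorder (\<lambda>t. f i (z + t *s e)) s"
  proof (rule zorder_times_analytic[OF ag analytic_line[OF i]])
    have "eventually (\<lambda>t. z + t *s e \<in> V j \<inter> V i) (at s)" using ev by (simp add: eventually_nhds_conv_at)
    then show "eventually (\<lambda>t. g j i (z + t *s e) * f i (z + t *s e) \<noteq> 0) (at s)"
      using eventually_nonzero[OF z i] by eventually_elim (auto simp: g_nonzero)
  qed
  also have "zorder (\<lambda>t. g j i (z + t *s e)) s = 0"
    by (rule zorder_eq_0I[OF ag]) (use g_nonzero i j in auto)
  finally show ?thesis by simp
qed

lemma mult_pos:
  assumes z: "z \<in> off_axis" and s: "s \<in> roots z"
  shows "mult z s > 0"
proof -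
  obtain i where i: "z + s *s e \<in> V i" using cover line_nonzero[OF z] by blast
  have "frequently (\<lambda>t. f i (z + t *s e) \<noteq> 0) (at s)"
    using eventually_frequently[OF _ eventually_nonzero[OF z i]]
    by (auto elim: frequently_elim1)
  then show ?thesis
    unfolding mult_eq[OF z i] using zorder_pos_iff'[OF analytic_line[OF i]] s zeros_iff[OF i]
    by (simp add: roots_def)
qed

lemma mult_add:
  assumes z: "z \<in> off_axis"
  shows "mult (z + t *s e) (s - t) = mult z s"
proof -
  obtain i where i: "z + s *s e \<in> V i" using cover line_nonzero[OF z] by blast
  have *: "z + t *s e + u *s e = z + (u + t) *s e" for u by (simp add: vec_eq_iff algebra_simps)
  have "mult (z + t *s e) (s - t) = zorder (\<lambda>u. f i (z + (u + t) *s e)) (s - t)"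
    by (subst mult_eq[of _ _ i]) (use z i in \<open>auto simp: off_axis_add *\<close>)
  also have "\<dots> = zorder (\<lambda>u. f i (z + (u + s) *s e)) 0"
    by (subst zorder_shift) (simp add: algebra_simps)
  also have "\<dots> = zorder (\<lambda>u. f i (z + u *s e)) s" by (rule zorder_shift[symmetric])
  also have "\<dots> = mult z s" by (rule mult_eq[OF z i, symmetric])
  finally show ?thesis .
qed

lemma mult_smult:
  assumes z: "z \<in> off_axis" and c: "c \<noteq> 0"
  shows "mult (c *s z) (c * s) = mult z s"
proof -
  obtain i where i: "z + s *s e \<in> V i" using cover line_nonzero[OF z] by blast
  have *: "c *s z + (c * u) *s e = c *s (z + u *s e)" for u by (simp add: vec_eq_iff algebra_simps)
  have ci: "c *s z + (c * s) *s e \<in> V i" unfolding * by (rule cone[OF i c])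
  have cz: "c *s z \<in> off_axis" using z off_axis_smult[OF c] by simp
  have "mult (c *s z) (c * s) = zorder (\<lambda>u. f i (c *s z + u *s e)) (c * s)"
    by (rule mult_eq[OF cz ci])
  also have "\<dots> = zorder (\<lambda>u. f i (c *s z + (c * u) *s e)) s"
    by (rule Laurent_Convergence.zorder_scale[symmetric, of "\<lambda>u. f i (c *s z + u *s e)"])
       (use analytic_line[OF ci] c in \<open>auto intro: eventually_mono[OF eventually_nonzero[OF cz ci]]\<close>)
  also have "\<dots> = zorder (\<lambda>u. \<kappa> c * f i (z + u *s e)) s"
  proof (rule zorder_cong)
    have "eventually (\<lambda>u. z + u *s e \<in> V i \<and> f i (z + u *s e) \<noteq> 0) (at s)"
      by (rule eventually_nonzero[OF z i])
    then show "eventually (\<lambda>u. f i (c *s z + (c * u) *s e) = \<kappa> c * f i (z + u *s e)) (at s)"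
      by eventually_elim (simp only: * hom[OF _ c])
  qed simp
  also have "\<dots> = zorder (\<lambda>u. \<kappa> c) s + zorder (\<lambda>u. f i (z + u *s e)) s"
    by (rule zorder_times_analytic)
       (use analytic_line[OF i] kappa_nonzero[OF c] in \<open>auto intro: eventually_mono[OF eventually_nonzero[OF z i]]\<close>)
  also have "zorder (\<lambda>u. \<kappa> c) s = 0"
    by (rule zorder_eq_0I) (use kappa_nonzero[OF c] in auto)
  finally show ?thesis using mult_eq[OF z i] by simp
qed

end

lemma eventually_line_tube:
  fixes z0 e :: "complex ^ 'a::finite"
  assumes "compact K" "open G" "\<And>s. s \<in> K \<Longrightarrow> z0 + s *s e \<in> G"
  shows "eventually (\<lambda>z. \<forall>s\<in>K. z + s *s e \<in> G) (nhds z0)"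
proof -
  have "compact ((\<lambda>s. z0 + s *s e) ` K)"
    by (intro compact_continuous_image continuous_intros assms(1))
  moreover have "(\<lambda>s. z0 + s *s e) ` K \<subseteq> G" using assms(3) by blast
  ultimately obtain \<epsilon> where \<epsilon>: "\<epsilon> > 0" "(\<Union>x\<in>(\<lambda>s. z0 + s *s e) ` K. ball x \<epsilon>) \<subseteq> G"
    using compact_subset_open_imp_ball_epsilon_subset[OF _ assms(2)] by metis
  have "z + s *s e \<in> G" if "dist z z0 < \<epsilon>" "s \<in> K" for z s
  proof -
    have "z + s *s e \<in> ball (z0 + s *s e) \<epsilon>" using that by (simp add: dist_norm norm_minus_commute)
    then show ?thesis using \<epsilon> that by blast
  qed
  then show ?thesis unfolding eventually_nhds_metric using \<epsilon>(1) by blast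
qed

context cone_divisor
begin

text \<open>The argument principle with the weight \<open>H\<close> in a disc on which one local equation is available.\<close>

lemma root_cluster_sum:
  assumes r: "r > 0" and z: "z \<in> off_axis"
    and V: "\<And>s. s \<in> ball c (2 * r) \<Longrightarrow> z + s *s e \<in> V i"
    and nz: "\<And>s. s \<in> ball c (2 * r) - ball c r \<Longrightarrow> s \<notin> roots z"
    and H: "H holomorphic_on ball c (2 * r)"
  shows "(\<Sum>s\<in>roots z \<inter> ball c r. of_int (mult z s) * H s) =
    contour_integral (circlepath c r) (\<lambda>s. deriv (\<lambda>t. f i (z + s *s e + t *s e)) 0 / f i (z + s *s e) * H s)
    / (2 * pi * \<i>)"
proof -
  let ?S = "ball c (2 * r)"
  let ?F = "\<lambda>s. f i (z + s *s e)"
  have holF: "?F holomorphic_on ?S"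
    by (rule holomorphic_on_subset[OF line_holomorphic]) (use V in auto)
  have pz: "{w \<in> ?S. ?F w = 0 \<or> w \<in> {}} = roots z \<inter> ball c r"
    using zeros_iff[OF V] nz r by (fastforce simp: roots_def)
  have fin: "finite (roots z \<inter> ball c r)" using finite_roots[OF z] by blast
  have path: "path_image (circlepath c r) = sphere c r" using r by (simp add: path_image_circlepath_nonneg)
  have AP: "contour_integral (circlepath c r) (\<lambda>x. deriv ?F x * H x / ?F x) =
     2 * pi * \<i> * (\<Sum>p\<in>{w \<in> ?S. ?F w = 0 \<or> w \<in> {}}. winding_number (circlepath c r) p * H p * zorder ?F p)"
  proof (rule argument_principle)
    show "path_image (circlepath c r) \<subseteq> ?S - {w \<in> ?S. ?F w = 0 \<or> w \<in> {}}"
      unfolding path pz using r by auto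
    show "\<forall>w. w \<notin> ?S \<longrightarrow> winding_number (circlepath c r) w = 0"
    proof (intro allI impI)
      fix w assume "w \<notin> ?S"
      then show "winding_number (circlepath c r) w = 0"
        by (intro winding_number_zero_outside[of _ "cball c r"]) (use r path in auto)
    qed
    show "finite {w \<in> ?S. ?F w = 0 \<or> w \<in> {}}" unfolding pz by (rule fin)
  qed (use holF H in auto)
  have integrand: "deriv ?F s = deriv (\<lambda>t. f i (z + s *s e + t *s e)) 0" if "s \<in> ball c (2 * r)" for s
  proof -
    have "z + s *s e \<in> V i" using V that .
    then have "(\<lambda>t. f i ((z + s *s e) + t *s e)) field_differentiable (at 0)"
      using holo_on_compose_line[OF holo_f, of "z + s *s e" 0 e i] by simp
    from field_differentiable_line_shift[OF this] show ?thesis by (rule DERIV_imp_deriv)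
  qed
  have "contour_integral (circlepath c r) (\<lambda>x. deriv ?F x * H x / ?F x) =
    contour_integral (circlepath c r) (\<lambda>s. deriv (\<lambda>t. f i (z + s *s e + t *s e)) 0 / f i (z + s *s e) * H s)"
    by (rule contour_integral_cong) (use integrand r path in auto)
  moreover have "(\<Sum>p\<in>roots z \<inter> ball c r. winding_number (circlepath c r) p * H p * zorder ?F p)
     = (\<Sum>s\<in>roots z \<inter> ball c r. of_int (mult z s) * H s)"
  proof (rule sum.cong[OF refl])
    fix p assume p: "p \<in> roots z \<inter> ball c r"
    then have "winding_number (circlepath c r) p = 1"
      by (intro winding_number_circlepath) (auto simp: dist_norm norm_minus_commute)
    moreover have "z + p *s e \<in> V i" using V p r by auto
    ultimately show "winding_number (circlepath c r) p * H p * zorder ?F p = of_int (mult z p) * H p"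
      using mult_eq[OF z] by simp
  qed
  ultimately have "2 * pi * \<i> * (\<Sum>s\<in>roots z \<inter> ball c r. of_int (mult z s) * H s) =
    contour_integral (circlepath c r) (\<lambda>s. deriv (\<lambda>t. f i (z + s *s e + t *s e)) 0 / f i (z + s *s e) * H s)"
    using AP unfolding pz by (simp only:)
  then show ?thesis by (subst eq_divide_eq) (simp add: mult.commute)
qed

lemma holo_on_root_cluster_sum:
  assumes \<Omega>: "open \<Omega>" "\<Omega> \<subseteq> off_axis" and r: "r > 0"
    and V: "\<And>z s. z \<in> \<Omega> \<Longrightarrow> s \<in> ball c (2 * r) \<Longrightarrow> z + s *s e \<in> V i"
    and nz: "\<And>z s. z \<in> \<Omega> \<Longrightarrow> s \<in> ball c (2 * r) - ball c r \<Longrightarrow> s \<notin> roots z"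
    and H: "H holomorphic_on ball c (2 * r)"
  shows "holo_on \<Omega> (\<lambda>z. \<Sum>s\<in>roots z \<inter> ball c r. of_int (mult z s) * H s)"
proof -
  define D where "D = (\<lambda>w. deriv (\<lambda>t. f i (w + t *s e)) 0)"
  have hD: "holo_on (V i) D" unfolding D_def by (rule holo_on_directional_deriv[OF open_V holo_f])
  let ?W = "{w \<in> V i. f i w \<noteq> 0}"
  have hW: "holo_on ?W (\<lambda>w. D w / f i w)"
    by (rule holo_on_divide[OF holo_on_subset[OF hD] holo_on_subset[OF holo_f]]) auto
  have "holo_on \<Omega> (\<lambda>z. contour_integral (circlepath c r) (\<lambda>s. D (z + s *s e) / f i (z + s *s e) * H s))"
  proof (rule holo_on_contour_integral_circlepath[OF open_nonzero_part hW \<Omega>(1) r])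
    fix z s assume zs: "z \<in> \<Omega>" "s \<in> sphere c r"
    then have "z + s *s e \<in> V i" "s \<notin> roots z" using V nz r by auto
    then show "z + s *s e \<in> ?W" using zeros_iff by (auto simp: roots_def)
  next
    show "continuous_on (sphere c r) H"
      by (rule continuous_on_subset[OF holomorphic_on_imp_continuous_on[OF H]]) (use r in auto)
  qed
  then have h: "holo_on \<Omega> (\<lambda>z. contour_integral (circlepath c r) (\<lambda>s. D (z + s *s e) / f i (z + s *s e) * H s)
     * (1 / (2 * pi * \<i>)))"
    by (intro holo_on_mult holo_on_const)
  show ?thesis
  proof (rule holo_on_cong[OF \<Omega>(1) h])
    fix z assume z: "z \<in> \<Omega>"
    show "contour_integral (circlepath c r) (\<lambda>s. D (z + s *s e) / f i (z + s *s e) * H s) * (1 / (2 * pi * \<i>))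
      = (\<Sum>s\<in>roots z \<inter> ball c r. of_int (mult z s) * H s)"
      by (subst root_cluster_sum[OF r _ V nz H]) (use z \<Omega> in \<open>auto simp: D_def\<close>)
  qed
qed

text \<open>The roots at \<open>z0\<close> are enclosed in small discs, each contained in the domain of one local equation.
  For \<open>z\<close> near \<open>z0\<close> all roots stay in these discs: inside a large disc by compactness, outside it by
  \<open>roots_bound\<close>. In each disc the weighted sum of the roots is a contour integral.\<close>

lemma holo_on_root_sum:
  assumes z0: "z0 \<in> off_axis" and U: "open U" "roots z0 \<subseteq> U" and H: "H holomorphic_on U"
  obtains \<Omega> where "open \<Omega>" "z0 \<in> \<Omega>" "\<Omega> \<subseteq> off_axis" "\<And>z. z \<in> \<Omega> \<Longrightarrow> roots z \<subseteq> U"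
    "holo_on \<Omega> (\<lambda>z. \<Sum>s\<in>roots z. of_int (mult z s) * H s)"
proof -
  let ?R = "roots z0"
  have finR: "finite ?R" by (rule finite_roots[OF z0])
  obtain B where B: "B > 0" "\<And>z s. z + s *s e \<in> zeros \<Longrightarrow> norm s \<le> B * norm z" using roots_bound by metis
  have "\<forall>s. \<exists>i. z0 + s *s e \<in> V i" using cover line_nonzero[OF z0] by blast
  then obtain ix where ix: "\<And>s. z0 + s *s e \<in> V (ix s)" by metis
  define A where "A = (\<lambda>s. {t. z0 + t *s e \<in> V (ix s)} \<inter> U)"
  have A: "open (A s)" "s \<in> ?R \<Longrightarrow> s \<in> A s" for s
    using open_line U ix by (auto simp: A_def)
  let ?G = "{z. z \<noteq> 0 \<and> z \<notin> zeros}"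
  have notroot: "z0 + s *s e \<in> ?G" if "s \<notin> ?R" for s
    using that line_nonzero[OF z0] by (auto simp: roots_def)
  have "eventually (\<lambda>\<rho>. \<rho> > 0 \<and> (\<forall>s\<in>?R. cball s (2 * \<rho>) \<subseteq> A s \<and> (\<forall>t\<in>?R - {s}. 4 * \<rho> < dist s t))) (at_right 0)"
  proof (intro eventually_conj eventually_ball_finite finR ballI)
    show "eventually (\<lambda>\<rho>::real. \<rho> > 0) (at_right 0)" by (rule eventually_at_right_less)
  next
    fix s assume "s \<in> ?R"
    then obtain \<epsilon> where \<epsilon>: "\<epsilon> > 0" "cball s \<epsilon> \<subseteq> A s" using A open_contains_cball by blast
    have "eventually (\<lambda>\<rho>::real. \<rho> < \<epsilon> / 2) (at_right 0)"
      using \<epsilon> by (intro order_tendstoD(2)[OF tendsto_ident_at]) auto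
    then show "eventually (\<lambda>\<rho>. cball s (2 * \<rho>) \<subseteq> A s) (at_right 0)"
      by eventually_elim (use \<epsilon> in auto)
  next
    show "finite (?R - {s})" for s using finR by blast
  next
    fix s t assume "s \<in> ?R" "t \<in> ?R - {s}"
    then have "0 < dist s t / 4" by auto
    then have "eventually (\<lambda>\<rho>::real. \<rho> < dist s t / 4) (at_right 0)"
      by (intro order_tendstoD(2)[OF tendsto_ident_at])
    then show "eventually (\<lambda>\<rho>. 4 * \<rho> < dist s t) (at_right 0)"
      by eventually_elim simp
  qed
  then obtain \<rho> where raw: "\<rho> > 0 \<and> (\<forall>s\<in>?R. cball s (2 * \<rho>) \<subseteq> A s \<and> (\<forall>t\<in>?R - {s}. 4 * \<rho> < dist s t))"
    using eventually_happens'[OF trivial_limit_at_right_real] by blast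
  have \<rho>: "\<rho> > 0" "\<And>s. s \<in> ?R \<Longrightarrow> cball s (2 * \<rho>) \<subseteq> A s"
    "\<And>s t. s \<in> ?R \<Longrightarrow> t \<in> ?R \<Longrightarrow> s \<noteq> t \<Longrightarrow> 4 * \<rho> < dist s t"
    using raw by auto
  \<comment> \<open>All roots at points \<open>z\<close> with \<open>|z| < |z0| + 1\<close> lie in the disc of radius \<open>B (|z0| + 1)\<close>.\<close>
  define K where "K = cball 0 (B * (norm z0 + 1)) - (\<Union>s\<in>?R. ball s \<rho>)"
  have K: "compact K" unfolding K_def by (intro compact_diff compact_cball open_UN ballI open_ball)
  have KR: "s \<notin> ?R" if "s \<in> K" for s using that \<rho>(1) by (auto simp: K_def)
  have annR: "t \<notin> ?R" if "s \<in> ?R" "t \<in> cball s (2 * \<rho>) - ball s \<rho>" for s t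
    using \<rho>(3)[OF that(1), of t] that \<rho>(1) by (cases "s = t") auto
  have "eventually (\<lambda>z. (z \<in> off_axis \<and> norm z < norm z0 + 1) \<and> (\<forall>s\<in>K. z + s *s e \<in> ?G) \<and>
     (\<forall>s\<in>?R. (\<forall>t\<in>cball s (2 * \<rho>). z + t *s e \<in> V (ix s)) \<and>
             (\<forall>t\<in>cball s (2 * \<rho>) - ball s \<rho>. z + t *s e \<in> ?G))) (nhds z0)"
  proof (intro eventually_conj eventually_ball_finite[OF finR] ballI)
    show "eventually (\<lambda>z. z \<in> off_axis) (nhds z0)"
      using eventually_nhds_in_open[OF open_off_axis z0] .
    have "open {z. norm z < norm z0 + 1}" by (intro open_Collect_less continuous_intros)
    from eventually_nhds_in_open[OF this, of z0]
    show "eventually (\<lambda>z. norm z < norm z0 + 1) (nhds z0)" by simp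
    show "eventually (\<lambda>z. \<forall>s\<in>K. z + s *s e \<in> ?G) (nhds z0)"
      by (rule eventually_line_tube[OF K open_compl_zeros]) (use notroot KR in blast)
  next
    fix s assume s: "s \<in> ?R"
    show "eventually (\<lambda>z. \<forall>t\<in>cball s (2 * \<rho>). z + t *s e \<in> V (ix s)) (nhds z0)"
      by (rule eventually_line_tube[OF compact_cball open_V]) (use \<rho>(2)[OF s] in \<open>auto simp: A_def\<close>)
    show "eventually (\<lambda>z. \<forall>t\<in>cball s (2 * \<rho>) - ball s \<rho>. z + t *s e \<in> ?G) (nhds z0)"
      by (rule eventually_line_tube[OF compact_diff[OF compact_cball open_ball] open_compl_zeros])
         (use notroot annR[OF s] in blast)
  qed
  then obtain \<Omega> where \<Omega>: "open \<Omega>" "z0 \<in> \<Omega>" "\<And>z. z \<in> \<Omega> \<Longrightarrow> z \<in> off_axis"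
    "\<And>z. z \<in> \<Omega> \<Longrightarrow> norm z < norm z0 + 1" "\<And>z s. z \<in> \<Omega> \<Longrightarrow> s \<in> K \<Longrightarrow> z + s *s e \<notin> zeros"
    "\<And>z s t. z \<in> \<Omega> \<Longrightarrow> s \<in> ?R \<Longrightarrow> t \<in> cball s (2 * \<rho>) \<Longrightarrow> z + t *s e \<in> V (ix s)"
    "\<And>z s t. z \<in> \<Omega> \<Longrightarrow> s \<in> ?R \<Longrightarrow> t \<in> cball s (2 * \<rho>) - ball s \<rho> \<Longrightarrow> z + t *s e \<notin> zeros"
    unfolding eventually_nhds by auto
  have near: "roots z \<subseteq> (\<Union>s\<in>?R. ball s \<rho>)" if z: "z \<in> \<Omega>" for z
  proof
    fix t assume t: "t \<in> roots z"
    then have "norm t \<le> B * norm z" using B(2) by (simp add: roots_def)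
    also have "\<dots> \<le> B * (norm z0 + 1)" using \<Omega>(4)[OF z] B(1) by simp
    finally have "t \<in> cball 0 (B * (norm z0 + 1))" by simp
    then show "t \<in> (\<Union>s\<in>?R. ball s \<rho>)" using \<Omega>(5)[OF z, of t] t by (auto simp: K_def roots_def)
  qed
  have "holo_on \<Omega> (\<lambda>z. \<Sum>s\<in>?R. \<Sum>t\<in>roots z \<inter> ball s \<rho>. of_int (mult z t) * H t)"
  proof (rule holo_on_sum)
    fix s assume s: "s \<in> ?R"
    show "holo_on \<Omega> (\<lambda>z. \<Sum>t\<in>roots z \<inter> ball s \<rho>. of_int (mult z t) * H t)"
    proof (rule holo_on_root_cluster_sum[OF \<Omega>(1) _ \<rho>(1)])
      show "H holomorphic_on ball s (2 * \<rho>)"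
        by (rule holomorphic_on_subset[OF H]) (use \<rho>(2)[OF s] in \<open>auto simp: A_def\<close>)
      fix z t assume "z \<in> \<Omega>"
      then show "t \<in> ball s (2 * \<rho>) \<Longrightarrow> z + t *s e \<in> V (ix s)"
        "t \<in> ball s (2 * \<rho>) - ball s \<rho> \<Longrightarrow> t \<notin> roots z"
        using \<Omega>(6,7)[OF _ s, of z t] by (auto simp: roots_def)
    qed (use \<Omega> in auto)
  qed
  then have "holo_on \<Omega> (\<lambda>z. \<Sum>s\<in>roots z. of_int (mult z s) * H s)"
  proof (rule holo_on_cong[OF \<Omega>(1)])
    fix z assume z: "z \<in> \<Omega>"
    have "(\<Union>s\<in>?R. roots z \<inter> ball s \<rho>) = roots z" using near[OF z] by blast
    moreover have "(\<Sum>t\<in>(\<Union>s\<in>?R. roots z \<inter> ball s \<rho>). of_int (mult z t) * H t)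
       = (\<Sum>s\<in>?R. \<Sum>t\<in>roots z \<inter> ball s \<rho>. of_int (mult z t) * H t)"
    proof (rule sum.UNION_disjoint[OF finR])
      show "\<forall>s\<in>?R. finite (roots z \<inter> ball s \<rho>)" using finite_roots \<Omega>(3)[OF z] by blast
      show "\<forall>s\<in>?R. \<forall>t\<in>?R. s \<noteq> t \<longrightarrow> (roots z \<inter> ball s \<rho>) \<inter> (roots z \<inter> ball t \<rho>) = {}"
      proof (intro ballI impI equals0I)
        fix s t u assume st: "s \<in> ?R" "t \<in> ?R" "s \<noteq> t" and u: "u \<in> (roots z \<inter> ball s \<rho>) \<inter> (roots z \<inter> ball t \<rho>)"
        have "dist s t \<le> dist s u + dist t u" using dist_triangle[of s t u] by (simp add: dist_commute)
        then show False using \<rho>(3)[OF st] u \<rho>(1) by auto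
      qed
    qed
    ultimately show "(\<Sum>s\<in>?R. \<Sum>t\<in>roots z \<inter> ball s \<rho>. of_int (mult z t) * H t) = (\<Sum>s\<in>roots z. of_int (mult z s) * H s)"
      by simp
  qed
  moreover have "roots z \<subseteq> U" if "z \<in> \<Omega>" for z
    using near[OF that] \<rho>(1,2) by (fastforce simp: A_def)
  ultimately show ?thesis using that \<Omega>(1,2,3) by blast
qed

text \<open>The number of roots is locally constant, being continuous with integer values, and any two points
  off the axis lie on a complex line that meets the axis in at most one point.\<close>

lemma root_count_constant:
  obtains n :: nat where "\<And>z. z \<in> off_axis \<Longrightarrow> (\<Sum>s\<in>roots z. nat (mult z s)) = n"
proof -
  define N where "N = (\<lambda>z. \<Sum>s\<in>roots z. nat (mult z s))"
  have N: "(\<Sum>s\<in>roots z. of_int (mult z s) * 1) = (of_nat (N z) :: complex)" if "z \<in> off_axis" for z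
  proof -
    have "of_int (mult z s) * 1 = (of_nat (nat (mult z s)) :: complex)" if "s \<in> roots z" for s
      using mult_pos[OF \<open>z \<in> off_axis\<close> that] by simp
    then show ?thesis by (simp add: N_def)
  qed
  have cont: "continuous_on off_axis (\<lambda>z. of_nat (N z) :: complex)"
  proof -
    have "isCont (\<lambda>z. of_nat (N z) :: complex) z0" if z0: "z0 \<in> off_axis" for z0
    proof -
      obtain \<Omega> where \<Omega>: "open \<Omega>" "z0 \<in> \<Omega>" "\<Omega> \<subseteq> off_axis"
        "holo_on \<Omega> (\<lambda>z. \<Sum>s\<in>roots z. of_int (mult z s) * (1::complex))"
        using holo_on_root_sum[OF z0 open_UNIV, of "\<lambda>_. 1"] by auto
      have "holo_on \<Omega> (\<lambda>z. of_nat (N z))"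
        by (rule holo_on_cong[OF \<Omega>(1,4)]) (use N \<Omega>(3) in auto)
      then show ?thesis
        using \<Omega>(1,2) holo_on_imp_continuous_on continuous_on_eq_continuous_at by blast
    qed
    then show ?thesis by (simp add: continuous_at_imp_continuous_on)
  qed
  have const: "N w1 = N w2" if w: "w1 \<in> off_axis" "w2 \<in> off_axis" for w1 w2
  proof -
    define T where "T = {t. w1 + t *s (w2 - w1) \<in> off_axis}"
    have "connected T"
    proof -
      have "t1 = t2" if t12: "t1 \<notin> T" "t2 \<notin> T" for t1 t2
      proof (rule ccontr)
        assume ne: "t1 \<noteq> t2"
        obtain c1 c2 where c: "w1 + t1 *s (w2 - w1) = c1 *s e" "w1 + t2 *s (w2 - w1) = c2 *s e"
          using t12 unfolding T_def off_axis_def by blast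
        have "w1 $ i = ((t2 * c1 - t1 * c2) / (t2 - t1)) * e $ i" for i
        proof -
          have "w1 $ i + t1 * (w2 $ i - w1 $ i) = c1 * e $ i" "w1 $ i + t2 * (w2 $ i - w1 $ i) = c2 * e $ i"
            using c[unfolded vec_eq_iff] by (auto simp: right_diff_distrib)
          then have "(t2 - t1) * w1 $ i = (t2 * c1 - t1 * c2) * e $ i" by algebra
          then show ?thesis using ne by (simp add: field_simps)
        qed
        then have "w1 = ((t2 * c1 - t1 * c2) / (t2 - t1)) *s e" by (simp add: vec_eq_iff)
        then show False using w(1) unfolding off_axis_def by blast
      qed
      then have "T = UNIV \<or> (\<exists>t. T = - {t})" by blast
      moreover have "connected (- {t::complex})" for t
        by (rule connected_punctured_universe) simp
      ultimately show ?thesis by (auto simp: connected_UNIV)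
    qed
    moreover have "continuous_on T (\<lambda>t. of_nat (N (w1 + t *s (w2 - w1))) :: complex)"
      by (rule continuous_on_compose2[OF cont]) (auto simp: T_def intro!: continuous_intros)
    ultimately have "(\<lambda>t. of_nat (N (w1 + t *s (w2 - w1))) :: complex) constant_on T"
    proof (rule continuous_discrete_range_constant)
      fix x
      show "\<exists>\<epsilon>>0. \<forall>y. y \<in> T \<and> (of_nat (N (w1 + y *s (w2 - w1))) :: complex) \<noteq> of_nat (N (w1 + x *s (w2 - w1))) \<longrightarrow>
        \<epsilon> \<le> norm (of_nat (N (w1 + y *s (w2 - w1))) - of_nat (N (w1 + x *s (w2 - w1))) :: complex)"
      proof (intro exI[of _ 1] conjI allI impI)
        fix y assume y: "y \<in> T \<and> (of_nat (N (w1 + y *s (w2 - w1))) :: complex) \<noteq> of_nat (N (w1 + x *s (w2 - w1)))"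
        define a b where "a = N (w1 + y *s (w2 - w1))" and "b = N (w1 + x *s (w2 - w1))"
        have "a \<noteq> b" using y by (auto simp: a_def b_def)
        have "norm (of_nat a - of_nat b :: complex) = norm (of_int (int a - int b) :: complex)" by simp
        also have "\<dots> = \<bar>of_int (int a - int b)\<bar>" by (simp only: norm_of_int)
        also have "\<dots> \<ge> 1" using \<open>a \<noteq> b\<close> by linarith
        finally show "1 \<le> norm (of_nat (N (w1 + y *s (w2 - w1))) - of_nat (N (w1 + x *s (w2 - w1))) :: complex)"
          by (simp add: a_def b_def)
      qed simp
    qed
    moreover have "0 \<in> T" "1 \<in> T" using w by (auto simp: T_def)
    ultimately have "(of_nat (N (w1 + 0 *s (w2 - w1))) :: complex) = of_nat (N (w1 + 1 *s (w2 - w1)))"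
      unfolding constant_on_def by metis
    then show ?thesis by simp
  qed
  show ?thesis
  proof (cases "off_axis = {}")
    case True
    then show ?thesis using that by blast
  next
    case False
    then obtain w where w: "w \<in> off_axis" by blast
    show ?thesis
    proof (rule that[of "N w"])
      fix z assume "z \<in> off_axis"
      then show "(\<Sum>s\<in>roots z. nat (mult z s)) = N w" using const[OF _ w] by (simp add: N_def)
    qed
  qed
qed

end

lemma holo_on_transform:
  assumes "open V" "S \<subseteq> V" "holo_on S f" "\<And>z. z \<in> V \<Longrightarrow> f z = g z"
  shows "holo_on S g"
  unfolding holo_on_def
proof
  fix z assume z: "z \<in> S"
  then obtain D where "(f has_derivative D) (at z)" "\<forall>c v. D (c *s v) = c * D v"
    using assms(3) unfolding holo_on_def by blast
  then show "\<exists>D. (g has_derivative D) (at z) \<and> (\<forall>c v. D (c *s v) = c * D v)"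
    using has_derivative_transform_within_open[of f D z UNIV V g] assms z by blast
qed

text \<open>A finite set without zero misses some ray from the origin; the branch is cut along this ray.\<close>

lemma exists_log_branch:
  fixes R :: "complex set"
  assumes "finite R" "0 \<notin> R"
  obtains U H where "open U" "R \<subseteq> U" "H holomorphic_on U" "\<And>s. s \<in> U \<Longrightarrow> exp (H s) = - s"
proof -
  have "finite {n::nat. Im s + Re s * n = 0}" if "s \<in> R" for s
  proof (rule finite_subset)
    have "s \<noteq> 0" using that assms by auto
    then show "{n::nat. Im s + Re s * n = 0} \<subseteq> {nat \<lfloor>- Im s / Re s\<rfloor>}"
      by (auto simp: complex_eq_iff field_simps eq_neg_iff_add_eq_0[symmetric])
  qed auto
  then have "finite (\<Union>s\<in>R. {n::nat. Im s + Re s * n = 0})" using assms(1) by blast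
  then obtain n :: nat where n: "\<And>s. s \<in> R \<Longrightarrow> Im s + Re s * n \<noteq> 0"
    using ex_new_if_finite[OF infinite_UNIV_nat] by blast
  \<comment> \<open>The rays through \<open>1 + i n\<close> are pairwise distinct, so all but finitely many \<open>n\<close> are suitable.\<close>
  define \<zeta> where "\<zeta> = Complex 1 n"
  have \<zeta>: "\<zeta> \<noteq> 0" by (simp add: \<zeta>_def complex_eq_iff)
  define U where "U = (\<lambda>s. - s * \<zeta>) -` (- \<real>\<^sub>\<le>\<^sub>0)"
  define H where "H = (\<lambda>s. Ln (- s * \<zeta>) - Ln \<zeta>)"
  have "open U" unfolding U_def
    by (intro open_vimage open_Compl closed_nonpos_Reals_complex continuous_intros)
  moreover have "R \<subseteq> U"
  proof
    fix s assume "s \<in> R"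
    have "Im (- s * \<zeta>) = - (Im s + Re s * n)" by (simp add: \<zeta>_def)
    then have "Im (- s * \<zeta>) \<noteq> 0" using n[OF \<open>s \<in> R\<close>] by linarith
    then show "s \<in> U" by (auto simp: U_def complex_nonpos_Reals_iff)
  qed
  moreover have "H holomorphic_on U"
    unfolding H_def U_def by (intro holomorphic_intros) auto
  moreover have "exp (H s) = - s" if "s \<in> U" for s
  proof -
    have "- s * \<zeta> \<noteq> 0" using that unfolding U_def by (metis ComplD nonpos_Reals_zero_I vimageE)
    then show ?thesis using \<zeta> by (simp add: H_def exp_diff)
  qed
  ultimately show ?thesis using that by blast
qed

text \<open>Expanding the product, the error is at most what it would be if all terms were positive.\<close>

lemma prod_power_close:
  fixes a :: "'j \<Rightarrow> complex"
  assumes "\<And>j. j \<in> J \<Longrightarrow> norm (a j - t) \<le> \<eta>"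
  shows "norm ((\<Prod>j\<in>J. a j ^ m j) - t ^ (\<Sum>j\<in>J. m j)) \<le> (norm t + \<eta>) ^ (\<Sum>j\<in>J. m j) - norm t ^ (\<Sum>j\<in>J. m j)"
proof -
  have mult: "norm (A * C - t ^ (p + q)) \<le> (norm t + \<eta>) ^ (p + q) - norm t ^ (p + q)"
    if A: "norm (A - t ^ p) \<le> (norm t + \<eta>) ^ p - norm t ^ p"
      and C: "norm (C - t ^ q) \<le> (norm t + \<eta>) ^ q - norm t ^ q" for A C :: complex and p q
  proof -
    have nA: "norm A \<le> (norm t + \<eta>) ^ p"
      using A norm_triangle_ineq2[of A "t ^ p"] by (simp add: norm_power)
    have "A * C - t ^ (p + q) = A * (C - t ^ q) + t ^ q * (A - t ^ p)"
      by (simp add: algebra_simps power_add)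
    then have "norm (A * C - t ^ (p + q)) \<le> norm A * norm (C - t ^ q) + norm t ^ q * norm (A - t ^ p)"
      by (metis norm_mult norm_power norm_triangle_ineq)
    also have "\<dots> \<le> (norm t + \<eta>) ^ p * ((norm t + \<eta>) ^ q - norm t ^ q)
        + norm t ^ q * ((norm t + \<eta>) ^ p - norm t ^ p)"
      using order_trans[OF norm_ge_zero C] order_trans[OF norm_ge_zero nA]
      by (intro add_mono mult_mono nA A C) auto
    finally show ?thesis by (simp add: algebra_simps power_add)
  qed
  have pow: "norm (x ^ k - t ^ k) \<le> (norm t + \<eta>) ^ k - norm t ^ k" if "norm (x - t) \<le> \<eta>" for x k
    using mult[of x 1 "x ^ n" n for n] that
    by (induction k) (use mult[of x 1 "x ^ n" n for n] that in auto)
  show ?thesis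
    using assms
  proof (induction J rule: infinite_finite_induct)
    case (insert j J)
    then show ?case using mult[OF pow[of "a j" "m j"] insert.IH] by simp
  qed auto
qed

context cone_divisor
begin

definition degree_of_divisor :: nat where
  "degree_of_divisor = (SOME n. \<forall>z\<in>off_axis. (\<Sum>s\<in>roots z. nat (mult z s)) = n)"

lemma root_count: "z \<in> off_axis \<Longrightarrow> (\<Sum>s\<in>roots z. nat (mult z s)) = degree_of_divisor"
proof -
  have "\<exists>n. \<forall>z\<in>off_axis. (\<Sum>s\<in>roots z. nat (mult z s)) = n" using root_count_constant by metis
  then show "z \<in> off_axis \<Longrightarrow> (\<Sum>s\<in>roots z. nat (mult z s)) = degree_of_divisor"
    unfolding degree_of_divisor_def by (rule someI2_ex) blast
qed

text \<open>Off the axis, the value at zero of the monic polynomial that defines the divisor on the line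
  through \<open>z\<close>. On the axis the line passes through the origin, where there is no divisor, and the
  value is the limit from nearby lines.\<close>

definition eqn :: "complex ^ 'm \<Rightarrow> complex" where
  "eqn z = (if z \<in> off_axis then \<Prod>s\<in>roots z. (- s) ^ nat (mult z s)
            else (THE c. z = c *s e) ^ degree_of_divisor)"

lemma eqn_axis: "eqn (c *s e) = c ^ degree_of_divisor"
proof -
  have "(THE a. c *s e = a *s e) = c"
    using e_not_0 by (intro the_equality) (auto simp: vec_eq_iff)
  moreover have "c *s e \<notin> off_axis" unfolding off_axis_def by blast
  ultimately show ?thesis by (simp add: eqn_def)
qed

lemma eqn_line:
  assumes "z \<in> off_axis"
  shows "eqn (z + t *s e) = (\<Prod>s\<in>roots z. (t - s) ^ nat (mult z s))"
proof -
  have "eqn (z + t *s e) = (\<Prod>s\<in>(\<lambda>s. s - t) ` roots z. (- s) ^ nat (mult (z + t *s e) s))"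
    using assms by (simp add: eqn_def off_axis_add roots_add)
  also have "\<dots> = (\<Prod>s\<in>roots z. (- (s - t)) ^ nat (mult (z + t *s e) (s - t)))"
    by (subst prod.reindex) (auto simp: inj_on_def)
  finally show ?thesis by (simp add: mult_add[OF assms])
qed

lemma eqn_smult: "c \<noteq> 0 \<Longrightarrow> eqn (c *s z) = c ^ degree_of_divisor * eqn z"
proof (cases "z \<in> off_axis")
  case True
  assume c: "c \<noteq> 0"
  have "eqn (c *s z) = (\<Prod>s\<in>(\<lambda>s. c * s) ` roots z. (- s) ^ nat (mult (c *s z) s))"
    using True c by (simp add: eqn_def off_axis_smult roots_smult)
  also have "\<dots> = (\<Prod>s\<in>roots z. (- (c * s)) ^ nat (mult (c *s z) (c * s)))"
    using c by (subst prod.reindex) (auto simp: inj_on_def)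
  also have "\<dots> = (\<Prod>s\<in>roots z. c ^ nat (mult z s) * (- s) ^ nat (mult z s))"
    by (simp add: mult_smult[OF True c] power_mult_distrib[symmetric])
  also have "\<dots> = c ^ degree_of_divisor * eqn z"
    using True by (simp add: prod.distrib power_sum[symmetric] root_count eqn_def)
  finally show ?thesis .
next
  case False
  then obtain a where "z = a *s e" unfolding off_axis_def by blast
  then show ?thesis using eqn_axis[of a] eqn_axis[of "c * a"]
    by (simp add: power_mult_distrib vector_smult_assoc)
qed

lemma axis_not_zero: "c *s e \<notin> zeros"
proof (cases "c = 0")
  case True
  then show ?thesis by (simp add: zeros_def)
next
  case False
  then show ?thesis using zeros_smult[OF False, of e] e_nonzero zeros_iff by blast
qed

lemma eqn_eq_0_iff: "z \<noteq> 0 \<Longrightarrow> eqn z = 0 \<longleftrightarrow> z \<in> zeros"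
proof (cases "z \<in> off_axis")
  case True
  have "eqn z = 0 \<longleftrightarrow> (\<exists>s\<in>roots z. (- s) ^ nat (mult z s) = 0)"
    using True finite_roots[OF True] by (simp add: eqn_def)
  also have "\<dots> \<longleftrightarrow> 0 \<in> roots z"
    using mult_pos[OF True] by auto
  finally show ?thesis by (simp add: roots_def)
next
  case False
  assume "z \<noteq> 0"
  obtain a where a: "z = a *s e" using False unfolding off_axis_def by blast
  then have "a \<noteq> 0" using \<open>z \<noteq> 0\<close> by auto
  then show ?thesis using axis_not_zero by (simp add: a eqn_axis)
qed

text \<open>Near a point outside the divisor, the product of the roots is the exponential of a sum of
  logarithms, which is a weighted root sum.\<close>

lemma holo_on_eqn_nonzero:
  assumes z0: "z0 \<in> off_axis" and nz: "z0 \<notin> zeros"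
  shows "holo_on {z0} eqn"
proof -
  have "0 \<notin> roots z0" using nz by (simp add: roots_def)
  then obtain U H where U: "open U" "roots z0 \<subseteq> U" "H holomorphic_on U" "\<And>s. s \<in> U \<Longrightarrow> exp (H s) = - s"
    using exists_log_branch[OF finite_roots[OF z0]] by metis
  obtain \<Omega> where \<Omega>: "open \<Omega>" "z0 \<in> \<Omega>" "\<Omega> \<subseteq> off_axis" "\<And>z. z \<in> \<Omega> \<Longrightarrow> roots z \<subseteq> U"
    "holo_on \<Omega> (\<lambda>z. \<Sum>s\<in>roots z. of_int (mult z s) * H s)"
    by (rule holo_on_root_sum[OF z0 U(1-3)]) blast
  have "holo_on \<Omega> (\<lambda>z. exp (\<Sum>s\<in>roots z. of_int (mult z s) * H s))"
    by (rule holo_on_compose_holomorphic[OF \<Omega>(5), of exp UNIV]) (auto intro: holomorphic_intros)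
  then have "holo_on \<Omega> eqn"
  proof (rule holo_on_cong[OF \<Omega>(1)])
    fix z assume z: "z \<in> \<Omega>"
    then have zo: "z \<in> off_axis" using \<Omega>(3) by blast
    have "exp (\<Sum>s\<in>roots z. of_int (mult z s) * H s) = (\<Prod>s\<in>roots z. exp (of_int (mult z s) * H s))"
      by (rule exp_sum[OF finite_roots[OF zo]])
    also have "\<dots> = (\<Prod>s\<in>roots z. (- s) ^ nat (mult z s))"
    proof (rule prod.cong[OF refl])
      fix s assume s: "s \<in> roots z"
      then have "of_int (mult z s) = (of_nat (nat (mult z s)) :: complex)" using mult_pos[OF zo s] by simp
      then have "exp (of_int (mult z s) * H s) = exp (H s) ^ nat (mult z s)"
        by (simp add: exp_of_nat_mult)
      then show "exp (of_int (mult z s) * H s) = (- s) ^ nat (mult z s)"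
        using U(4) \<Omega>(4)[OF z] s by auto
    qed
    finally show "exp (\<Sum>s\<in>roots z. of_int (mult z s) * H s) = eqn z" using zo by (simp add: eqn_def)
  qed
  then show ?thesis using holo_on_subset \<Omega>(2) by blast
qed

text \<open>On the line through \<open>z\<close> the function is a polynomial of fixed degree in the parameter. Its value
  at \<open>z\<close> is a fixed linear combination of values at points of the line that lie off the divisor, where
  \<open>holo_on_eqn_nonzero\<close> applies.\<close>

lemma holo_on_eqn_off_axis: "holo_on off_axis eqn"
proof -
  have "holo_on {z0} eqn" if z0: "z0 \<in> off_axis" for z0
  proof -
    obtain L where L: "\<And>(p :: complex poly) t. degree p \<le> degree_of_divisor \<Longrightarrow>
        poly p t = (\<Sum>m\<le>degree_of_divisor. poly p (of_nat (Suc m)) * poly (L m) t)"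
      using lagrange_interpolation by metis
    \<comment> \<open>The interpolation nodes \<open>1, \<dots>, n + 1\<close> are scaled by \<open>\<eta>\<close> to avoid the roots at \<open>z0\<close>.\<close>
    have "finite (insert 0 (\<Union>m\<le>degree_of_divisor. (\<lambda>s. s / of_nat (Suc m)) ` roots z0))"
      using finite_roots[OF z0] by simp
    then obtain \<eta> where \<eta>: "\<eta> \<notin> insert 0 (\<Union>m\<le>degree_of_divisor. (\<lambda>s. s / of_nat (Suc m)) ` roots z0)"
      using ex_new_if_finite[OF infinite_UNIV_char_0[where 'a=complex]] by blast
    have \<eta>': "\<eta> * of_nat (Suc m) \<notin> roots z0" if "m \<le> degree_of_divisor" for m
    proof
      assume "\<eta> * of_nat (Suc m) \<in> roots z0"
      then have "\<eta> * of_nat (Suc m) / of_nat (Suc m) \<in> (\<lambda>s. s / of_nat (Suc m)) ` roots z0" by blast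
      moreover have "\<eta> * of_nat (Suc m) / of_nat (Suc m) = \<eta>" by (simp del: of_nat_Suc)
      ultimately show False using \<eta> that by auto
    qed
    have "holo_on {z0} (\<lambda>z. \<Sum>m\<le>degree_of_divisor. eqn (z + (\<eta> * of_nat (Suc m)) *s e) * poly (L m) 0)"
    proof (intro holo_on_sum holo_on_mult holo_on_const)
      fix m assume m: "m \<in> {..degree_of_divisor}"
      have "holo_on {z0 + (\<eta> * of_nat (Suc m)) *s e} eqn"
        by (rule holo_on_eqn_nonzero) (use z0 \<eta>'[of m] m in \<open>auto simp: off_axis_add roots_def simp del: of_nat_Suc\<close>)
      then show "holo_on {z0} (\<lambda>z. eqn (z + (\<eta> * of_nat (Suc m)) *s e))"
        by (rule holo_on_compose[rotated]) (auto intro: holo_intros)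
    qed
    then show ?thesis
    proof (rule holo_on_transform[OF open_off_axis, rotated])
      fix z assume z: "z \<in> off_axis"
      define q where "q = (\<Prod>s\<in>roots z. [:- s, \<eta>:] ^ nat (mult z s))"
      have pq: "poly q t = eqn (z + (\<eta> * t) *s e)" for t
        by (simp add: eqn_line[OF z] q_def poly_prod algebra_simps)
      have "degree q \<le> (\<Sum>s\<in>roots z. degree ([:- s, \<eta>:] ^ nat (mult z s)))"
        unfolding q_def using degree_prod_sum_le[OF finite_roots[OF z], of "\<lambda>s. [:- s, \<eta>:] ^ nat (mult z s)"]
        by (simp add: o_def)
      also have "\<dots> \<le> (\<Sum>s\<in>roots z. nat (mult z s))"
        by (intro sum_mono order_trans[OF degree_power_le]) simp
      finally have "degree q \<le> degree_of_divisor" by (simp add: root_count[OF z])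
      from L[OF this, of 0] show "(\<Sum>m\<le>degree_of_divisor. eqn (z + (\<eta> * of_nat (Suc m)) *s e) * poly (L m) 0) = eqn z"
        by (simp add: pq del: of_nat_Suc)
    qed (use z0 in auto)
  qed
  then show ?thesis unfolding holo_on_def by blast
qed

text \<open>As \<open>z\<close> approaches \<open>t e\<close>, all roots approach \<open>- t\<close> by \<open>roots_bound\<close>.\<close>

lemma eqn_tendsto_axis: "isCont eqn (t *s e)"
proof -
  obtain B where B: "B > 0" "\<And>z s. z + s *s e \<in> zeros \<Longrightarrow> norm s \<le> B * norm z" using roots_bound by metis
  define B' where "B' = max B (1 / norm e)"
  define n where "n = degree_of_divisor"
  define bd where "bd = (\<lambda>z. (norm t + B' * norm (z - t *s e)) ^ n - norm t ^ n)"
  have B': "B' \<ge> B" "B' \<ge> 1 / norm e" by (auto simp: B'_def)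
  have "norm (eqn z - t ^ n) \<le> bd z" for z
  proof (cases "z \<in> off_axis")
    case True
    have "norm (- s - t) \<le> B' * norm (z - t *s e)" if "s \<in> roots z" for s
    proof -
      have "(z - t *s e) + (s + t) *s e = z + s *s e" by (simp add: vec_eq_iff algebra_simps)
      then have "norm (s + t) \<le> B * norm (z - t *s e)" using B(2) that by (simp only: roots_def mem_Collect_eq)
      also have "\<dots> \<le> B' * norm (z - t *s e)" using B' by (intro mult_right_mono) auto
      finally show ?thesis by (metis add.commute minus_add_distrib norm_minus_cancel uminus_add_conv_diff)
    qed
    from prod_power_close[of "roots z" "\<lambda>s. - s" t, OF this, of "\<lambda>s. nat (mult z s)"] show ?thesis
      using True by (simp add: bd_def eqn_def root_count n_def)
  next
    case False
    then obtain a where a: "z = a *s e" unfolding off_axis_def by blast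
    have "norm (a - t) = (1 / norm e) * norm (z - t *s e)"
      using e_not_0 by (simp add: a norm_smult_complex flip: vector_sub_rdistrib)
    also have "\<dots> \<le> B' * norm (z - t *s e)" using B' by (intro mult_right_mono) auto
    finally show ?thesis
      using prod_power_close[of "{()}" "\<lambda>_. a" t _ "\<lambda>_. n"] by (simp add: a bd_def eqn_axis n_def)
  qed
  moreover have "(bd \<longlongrightarrow> 0) (at (t *s e))"
    unfolding bd_def by (auto intro!: tendsto_eq_intros)
  ultimately have "((\<lambda>z. eqn z - t ^ n) \<longlongrightarrow> 0) (at (t *s e))"
    by (rule_tac Lim_null_comparison) auto
  then show ?thesis by (simp add: isCont_def eqn_axis n_def LIM_zero_iff)
qed

text \<open>At points of the axis, continuity removes the singularity on each line that meets the axis once.\<close>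

lemma holo_on_eqn: "holo_on (- {0}) eqn"
proof (rule holo_onI)
  show "open (- {0 :: complex ^ 'm})" by (simp add: open_Compl)
  have cont: "isCont eqn z" if "z \<noteq> 0" for z
  proof (cases "z \<in> off_axis")
    case True
    then show ?thesis
      using holo_on_imp_continuous_on[OF holo_on_eqn_off_axis] open_off_axis continuous_on_eq_continuous_at by blast
  next
    case False
    then show ?thesis using eqn_tendsto_axis unfolding off_axis_def by blast
  qed
  then show contE: "continuous_on (- {0}) eqn" by (auto intro: continuous_at_imp_continuous_on)
  fix z v :: "complex ^ 'm" assume z: "z \<in> - {0}"
  show "(\<lambda>t. eqn (z + t *s v)) field_differentiable (at 0)"
  proof (cases "z \<in> off_axis")
    case True
    then show ?thesis using holo_on_compose_line[OF holo_on_eqn_off_axis, of z 0 v] by simp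
  next
    case False
    then obtain a where a: "z = a *s e" unfolding off_axis_def by blast
    show ?thesis
    proof (cases "v \<in> off_axis")
      case False
      then obtain b where b: "v = b *s e" unfolding off_axis_def by blast
      have "z + t *s v = (a + t * b) *s e" for t by (simp add: a b vec_eq_iff algebra_simps)
      then have "(\<lambda>t. eqn (z + t *s v)) = (\<lambda>t. (a + t * b) ^ degree_of_divisor)"
        by (simp only: eqn_axis)
      then show ?thesis by (auto intro!: field_differentiable_power field_differentiable_add field_differentiable_mult)
    next
      case True
      define S where "S = {t. z + t *s v \<in> - {0}}"
      have S: "open S" unfolding S_def by (rule open_line_preimage) (simp add: open_Compl)
      have "(\<lambda>t. eqn (z + t *s v)) holomorphic_on S"
      proof (rule no_isolated_singularity[OF _ _ S])
        show "continuous_on S (\<lambda>t. eqn (z + t *s v))"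
          by (rule continuous_on_compose2[OF contE]) (auto simp: S_def intro!: continuous_intros)
        show "(\<lambda>t. eqn (z + t *s v)) holomorphic_on S - {0}"
        proof (rule holo_on_compose_line_holomorphic[OF holo_on_eqn_off_axis])
          fix t assume "t \<in> S - {0}"
          then have "t *s v \<in> off_axis" using True off_axis_smult by simp
          then have "t *s v + a *s e \<in> off_axis" by (simp add: off_axis_add)
          then show "z + t *s v \<in> off_axis" by (simp add: a add.commute)
        qed
      qed simp
      moreover have "0 \<in> S" using z by (simp add: S_def)
      ultimately show ?thesis using S holomorphic_on_imp_differentiable_at by blast
    qed
  qed
qed

text \<open>The quotient of the global equation by a local one, extended over the divisor along lines of
  direction \<open>e\<close>.\<close>

definition unit_factor :: "'i \<Rightarrow> complex ^ 'm \<Rightarrow> complex" where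
  "unit_factor i z = Lim (at 0) (\<lambda>s. eqn (z + s *s e) / f i (z + s *s e))"

lemma unit_factor_off_zeros:
  assumes z: "z \<in> V i" and nz: "z \<notin> zeros"
  shows "unit_factor i z = eqn z / f i z"
  unfolding unit_factor_def
proof (rule tendsto_Lim)
  have z0: "z \<noteq> 0" using z V_nonzero by blast
  have lim: "((\<lambda>s. z + s *s e) \<longlongrightarrow> z) (at 0)" by (auto intro!: tendsto_eq_intros)
  have "isCont eqn z"
    using holo_on_imp_continuous_on[OF holo_on_eqn] z0 by (simp add: continuous_on_eq_continuous_at open_Compl)
  moreover have "isCont (f i) z"
    using holo_on_imp_continuous_on[OF holo_f] z open_V continuous_on_eq_continuous_at by blast
  ultimately show "((\<lambda>s. eqn (z + s *s e) / f i (z + s *s e)) \<longlongrightarrow> eqn z / f i z) (at 0)"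
    using nz zeros_iff[OF z] by (intro tendsto_divide isCont_tendsto_compose[OF _ lim]) auto
qed simp

text \<open>On the line both functions have the same zeros with the same multiplicities.\<close>

lemma line_factorization:
  assumes z: "z \<in> off_axis" and S: "open S" "\<And>s. s \<in> S \<Longrightarrow> z + s *s e \<in> V i"
  obtains w where "w holomorphic_on S" "\<And>s. s \<in> S \<Longrightarrow> w s \<noteq> 0"
    "\<And>s. s \<in> S \<Longrightarrow> eqn (z + s *s e) = w s * f i (z + s *s e)"
proof -
  let ?a = "\<lambda>s. eqn (z + s *s e)" and ?b = "\<lambda>s. f i (z + s *s e)"
  define w where "w = (\<lambda>s. Lim (at s) (\<lambda>t. ?a t / ?b t))"
  have local: "\<exists>r>0. \<exists>q. q holomorphic_on ball s r \<and> (\<forall>t\<in>ball s r. q t \<noteq> 0 \<and> t \<in> S \<and> ?a t = q t * ?b t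
      \<and> (t \<noteq> s \<longrightarrow> ?b t \<noteq> 0))"
    if s: "s \<in> S" for s
  proof -
    obtain \<rho> where \<rho>: "\<rho> > 0" "ball s \<rho> \<subseteq> S" using S(1) s openE by blast
    have hb: "?b holomorphic_on ball s \<rho>"
      by (rule holomorphic_on_subset[OF line_holomorphic]) (use \<rho> S in auto)
    have iV: "z + s *s e \<in> V i" using S s by blast
    have "\<exists>x\<in>ball s \<rho>. ?b x \<noteq> 0"
    proof -
      have "eventually (\<lambda>t. t \<in> ball s \<rho> \<and> ?b t \<noteq> 0) (at s)"
        using eventually_nonzero[OF z iV] eventually_at_in_open'[of "ball s \<rho>" s] \<rho>(1)
        by (auto elim: eventually_elim2)
      from eventually_happens'[OF at_neq_bot this] show ?thesis by blast
    qed
    moreover have "s \<in> ball s \<rho>" using \<rho>(1) by simp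
    ultimately have "\<exists>r>0. cball s r \<subseteq> ball s \<rho> \<and> zor_poly ?b s holomorphic_on cball s r \<and>
      (\<forall>t\<in>cball s r. ?b t = zor_poly ?b s t * (t - s) ^ nat (zorder ?b s) \<and> zor_poly ?b s t \<noteq> 0)"
      using zorder_exist_zero[OF hb open_ball connected_ball] by blast
    then obtain r where r: "r > 0" "cball s r \<subseteq> ball s \<rho>" "zor_poly ?b s holomorphic_on cball s r"
      "\<And>t. t \<in> cball s r \<Longrightarrow> ?b t = zor_poly ?b s t * (t - s) ^ nat (zorder ?b s) \<and> zor_poly ?b s t \<noteq> 0"
      by blast
    define k where "k = nat (zorder ?b s)"
    have a: "?a t = (\<Prod>u\<in>roots z - {s}. (t - u) ^ nat (mult z u)) * (t - s) ^ k" for t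
    proof (cases "s \<in> roots z")
      case True
      then show ?thesis
        using finite_roots[OF z] mult_eq[OF z iV]
        by (simp add: eqn_line[OF z] prod.remove[of _ s] k_def mult.commute)
    next
      case False
      then have "?b s \<noteq> 0" using zeros_iff[OF iV] by (simp add: roots_def)
      then have "k = 0" using analytic_line[OF iV] by (simp add: k_def zorder_eq_0I)
      then show ?thesis using False by (simp add: eqn_line[OF z])
    qed
    have "eventually (\<lambda>t. t \<notin> roots z \<and> t \<in> ball s r) (at s)"
      using eventually_not_root[OF z, of s] eventually_at_in_open'[of "ball s r" s] r(1)
      by (auto elim: eventually_elim2)
    then obtain r' where r': "r' > 0" "\<And>t. t \<noteq> s \<Longrightarrow> dist t s < r' \<Longrightarrow> t \<notin> roots z \<and> t \<in> ball s r"
      unfolding eventually_at by auto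
    define q where "q = (\<lambda>t. (\<Prod>u\<in>roots z - {s}. (t - u) ^ nat (mult z u)) / zor_poly ?b s t)"
    have inb: "t \<in> cball s r" if "t \<in> ball s r'" for t
      using r'(2)[of t] that r(1) by (cases "t = s") (auto simp: dist_commute)
    have "zor_poly ?b s holomorphic_on ball s r'"
      by (rule holomorphic_on_subset[OF r(3)]) (use inb in blast)
    then have "q holomorphic_on ball s r'"
      unfolding q_def using r(4) inb by (intro holomorphic_intros) auto
    moreover have "q t \<noteq> 0 \<and> t \<in> S \<and> ?a t = q t * ?b t \<and> (t \<noteq> s \<longrightarrow> ?b t \<noteq> 0)" if t: "t \<in> ball s r'" for t
    proof -
      have nz: "t - u \<noteq> 0" if "u \<in> roots z - {s}" for u
        using r'(2)[of t] t that by (cases "t = s") (auto simp: dist_commute)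
      have b: "?b t = zor_poly ?b s t * (t - s) ^ k" "zor_poly ?b s t \<noteq> 0"
        using r(4)[OF inb[OF t]] by (auto simp: k_def)
      then show ?thesis
        using a[of t] nz finite_roots[OF z] inb[OF t] r(2) \<rho>(2) by (auto simp: q_def)
    qed
    ultimately show ?thesis using r'(1) by blast
  qed
  have weq: "w t = q t" if q: "q holomorphic_on ball s r" "\<And>t. t \<in> ball s r \<Longrightarrow> q t \<noteq> 0 \<and> t \<in> S \<and> ?a t = q t * ?b t
      \<and> (t \<noteq> s \<longrightarrow> ?b t \<noteq> 0)" and t: "t \<in> ball s r" for q s r t
  proof -
    have "isCont q t" using holomorphic_on_imp_continuous_on[OF q(1)] t continuous_on_eq_continuous_at by blast
    then have "(q \<longlongrightarrow> q t) (at t)" by (simp add: isCont_def)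
    moreover have "eventually (\<lambda>u. q u = ?a u / ?b u) (at t)"
    proof -
      have "eventually (\<lambda>u. u \<in> ball s r - {s} - {t}) (at t)"
      proof (cases "t = s")
        case True
        then show ?thesis using eventually_at_in_open[of "ball s r" t] t by simp
      next
        case False
        have "open (ball s r - {s})" by blast
        then show ?thesis using eventually_at_in_open[of "ball s r - {s}" t] t False by simp
      qed
      then show ?thesis by eventually_elim (use q(2) in auto)
    qed
    ultimately have "((\<lambda>u. ?a u / ?b u) \<longlongrightarrow> q t) (at t)" by (rule Lim_transform_eventually)
    then show ?thesis unfolding w_def by (intro tendsto_Lim) simp
  qed
  have "w holomorphic_on S"
    unfolding holomorphic_on_def
  proof
    fix s assume "s \<in> S"
    then obtain r q where rq: "r > 0" "q holomorphic_on ball s r" "\<And>t. t \<in> ball s r \<Longrightarrow> q t \<noteq> 0 \<and> t \<in> S \<and> ?a t = q t * ?b t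
      \<and> (t \<noteq> s \<longrightarrow> ?b t \<noteq> 0)" using local by metis
    have "w holomorphic_on ball s r"
      by (rule holomorphic_transform[OF rq(2)]) (use weq[OF rq(2,3)] in simp)
    then show "w field_differentiable (at s within S)"
      using rq(1) holomorphic_on_imp_differentiable_at[of w "ball s r" s] field_differentiable_at_within by auto
  qed
  moreover have "w s \<noteq> 0 \<and> ?a s = w s * ?b s" if s: "s \<in> S" for s
  proof -
    obtain r q where rq: "r > 0" "q holomorphic_on ball s r" "\<And>t. t \<in> ball s r \<Longrightarrow> q t \<noteq> 0 \<and> t \<in> S \<and> ?a t = q t * ?b t
      \<and> (t \<noteq> s \<longrightarrow> ?b t \<noteq> 0)" using local[OF s] by metis
    show ?thesis using rq(3)[of s] weq[OF rq(2,3), of s] rq(1) by simp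
  qed
  ultimately show ?thesis using that by blast
qed

text \<open>On a small circle around \<open>z0\<close> in direction \<open>e\<close> the local equation has no zeros, also for nearby
  lines, and Cauchy's formula expresses the quotient by its values there.\<close>

lemma unit_factor_at_zero:
  assumes z0: "z0 \<in> V i" "z0 \<in> zeros"
  shows "holo_on {z0} (unit_factor i)" "unit_factor i z0 \<noteq> 0" "eqn z0 = unit_factor i z0 * f i z0"
proof -
  have off: "z0 \<in> off_axis" using axis_not_zero z0(2) unfolding off_axis_def by blast
  obtain r where r: "r > 0" "\<And>s. s \<in> cball 0 r \<Longrightarrow> z0 + s *s e \<in> V i"
    "\<And>s. s \<in> cball 0 r \<Longrightarrow> s \<noteq> 0 \<Longrightarrow> z0 + s *s e \<notin> zeros"
  proof -
    have "eventually (\<lambda>s. z0 + s *s e \<in> V i \<and> f i (z0 + s *s e) \<noteq> 0) (at 0)"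
      by (rule eventually_nonzero[OF off]) (use z0 in simp)
    then obtain d where d: "d > 0" "\<And>s. s \<noteq> 0 \<Longrightarrow> norm s < d \<Longrightarrow> z0 + s *s e \<in> V i \<and> f i (z0 + s *s e) \<noteq> 0"
      unfolding eventually_at by (auto simp: dist_norm)
    show ?thesis
    proof (rule that[of "d / 2"])
      fix s :: complex assume "s \<in> cball 0 (d / 2)"
      then have "norm s < d" using d(1) by (simp add: dist_norm)
      then show "z0 + s *s e \<in> V i" "s \<noteq> 0 \<Longrightarrow> z0 + s *s e \<notin> zeros"
        using d(2)[of s] z0 zeros_iff by (cases "s = 0", auto)+
    qed (use d in auto)
  qed
  let ?W = "{z \<in> V i. f i z \<noteq> 0}"
  have "eventually (\<lambda>z. z \<in> off_axis \<and> (\<forall>s\<in>cball 0 r. z + s *s e \<in> V i) \<and> (\<forall>s\<in>sphere 0 r. z + s *s e \<in> ?W)) (nhds z0)"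
  proof (intro eventually_conj)
    show "eventually (\<lambda>z. z \<in> off_axis) (nhds z0)" using eventually_nhds_in_open[OF open_off_axis off] .
    show "eventually (\<lambda>z. \<forall>s\<in>cball 0 r. z + s *s e \<in> V i) (nhds z0)"
      by (rule eventually_line_tube[OF compact_cball open_V r(2)])
    show "eventually (\<lambda>z. \<forall>s\<in>sphere 0 r. z + s *s e \<in> ?W) (nhds z0)"
    proof (rule eventually_line_tube[OF compact_sphere open_nonzero_part])
      fix s :: complex assume "s \<in> sphere 0 r"
      then show "z0 + s *s e \<in> ?W" using r(1) r(2,3)[of s] zeros_iff by auto
    qed
  qed
  then obtain \<Omega> where \<Omega>: "open \<Omega>" "z0 \<in> \<Omega>" "\<And>z. z \<in> \<Omega> \<Longrightarrow> z \<in> off_axis"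
    "\<And>z s. z \<in> \<Omega> \<Longrightarrow> s \<in> cball 0 r \<Longrightarrow> z + s *s e \<in> V i" "\<And>z s. z \<in> \<Omega> \<Longrightarrow> s \<in> sphere 0 r \<Longrightarrow> z + s *s e \<in> ?W"
    unfolding eventually_nhds by (auto simp: dist_norm)
  have main: "unit_factor i z = contour_integral (circlepath 0 r)
      (\<lambda>s. eqn (z + s *s e) / f i (z + s *s e) * (1 / (2 * pi * \<i> * s))) \<and> unit_factor i z \<noteq> 0
      \<and> eqn z = unit_factor i z * f i z" if z: "z \<in> \<Omega>" for z
  proof -
    define S where "S = {s. z + s *s e \<in> V i}"
    have oS: "open S" unfolding S_def by (rule open_line)
    have cS: "cball 0 r \<subseteq> S" using \<Omega>(4)[OF z] by (auto simp: S_def)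
    obtain w where w: "w holomorphic_on S" "\<And>s. s \<in> S \<Longrightarrow> w s \<noteq> 0"
      "\<And>s. s \<in> S \<Longrightarrow> eqn (z + s *s e) = w s * f i (z + s *s e)"
      by (rule line_factorization[OF \<Omega>(3)[OF z] oS, of i]) (auto simp: S_def)
    have S0: "0 \<in> S" using cS r(1) by auto
    have "unit_factor i z = w 0"
      unfolding unit_factor_def
    proof (rule tendsto_Lim)
      have "isCont w 0" using holomorphic_on_imp_continuous_on[OF w(1)] oS S0 continuous_on_eq_continuous_at by blast
      then have "(w \<longlongrightarrow> w 0) (at 0)" by (simp add: isCont_def)
      moreover have "eventually (\<lambda>s. w s = eqn (z + s *s e) / f i (z + s *s e)) (at 0)"
      proof -
        have "eventually (\<lambda>s. z + s *s e \<in> V i \<and> f i (z + s *s e) \<noteq> 0) (at 0)"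
          by (rule eventually_nonzero[OF \<Omega>(3)[OF z]]) (use S0 in \<open>simp add: S_def\<close>)
        then show ?thesis by eventually_elim (use w(3) in \<open>auto simp: S_def\<close>)
      qed
      ultimately show "((\<lambda>s. eqn (z + s *s e) / f i (z + s *s e)) \<longlongrightarrow> w 0) (at 0)"
        by (rule Lim_transform_eventually)
    qed simp
    moreover have "w 0 = contour_integral (circlepath 0 r)
      (\<lambda>s. eqn (z + s *s e) / f i (z + s *s e) * (1 / (2 * pi * \<i> * s)))"
    proof -
      have hw: "w holomorphic_on cball 0 r" by (rule holomorphic_on_subset[OF w(1) cS])
      have "((\<lambda>u. w u / (u - 0)) has_contour_integral (2 * of_real pi * \<i> * w 0)) (circlepath 0 r)"
        by (rule Cauchy_integral_circlepath)
           (use r(1) holomorphic_on_imp_continuous_on[OF hw] holomorphic_on_subset[OF hw ball_subset_cball] in auto)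
      then have "((\<lambda>u. 1 / (2 * of_real pi * \<i>) * (w u / (u - 0))) has_contour_integral
          1 / (2 * of_real pi * \<i>) * (2 * of_real pi * \<i> * w 0)) (circlepath 0 r)"
        by (rule has_contour_integral_lmul)
      then have "((\<lambda>u. 1 / (2 * of_real pi * \<i>) * (w u / (u - 0))) has_contour_integral w 0) (circlepath 0 r)"
        by simp
      then have "((\<lambda>s. eqn (z + s *s e) / f i (z + s *s e) * (1 / (2 * pi * \<i> * s))) has_contour_integral w 0) (circlepath 0 r)"
      proof (rule has_contour_integral_eq)
        fix s assume "s \<in> path_image (circlepath 0 r)"
        then have s: "s \<in> sphere 0 r" using r(1) by (simp add: path_image_circlepath_nonneg)
        then have "s \<in> S" using cS by auto
        then show "1 / (2 * of_real pi * \<i>) * (w s / (s - 0)) = eqn (z + s *s e) / f i (z + s *s e) * (1 / (2 * pi * \<i> * s))"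
          using w(3) \<Omega>(5)[OF z s] by simp
      qed
      then show ?thesis by (rule contour_integral_unique[symmetric])
    qed
    ultimately show ?thesis using w(2)[OF S0] w(3)[OF S0] by simp
  qed
  show "unit_factor i z0 \<noteq> 0" "eqn z0 = unit_factor i z0 * f i z0" using main[OF \<Omega>(2)] by auto
  have hW: "holo_on ?W (\<lambda>z. eqn z / f i z)"
    by (rule holo_on_divide[OF holo_on_subset[OF holo_on_eqn] holo_on_subset[OF holo_f]])
       (use V_nonzero in auto)
  have "holo_on \<Omega> (\<lambda>z. contour_integral (circlepath 0 r)
      (\<lambda>s. eqn (z + s *s e) / f i (z + s *s e) * (1 / (2 * pi * \<i> * s))))"
    by (rule holo_on_contour_integral_circlepath[OF open_nonzero_part hW \<Omega>(1) r(1) \<Omega>(5)])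
       (use r(1) in \<open>auto intro!: continuous_intros\<close>)
  then have "holo_on \<Omega> (unit_factor i)"
    by (rule holo_on_cong[OF \<Omega>(1)]) (use main in auto)
  then show "holo_on {z0} (unit_factor i)" using holo_on_subset \<Omega>(2) by blast
qed

lemma holo_on_unit_factor: "holo_on (V i) (unit_factor i)"
proof -
  let ?W = "{z \<in> V i. f i z \<noteq> 0}"
  have "holo_on ?W (\<lambda>z. eqn z / f i z)"
    by (rule holo_on_divide[OF holo_on_subset[OF holo_on_eqn] holo_on_subset[OF holo_f]])
       (use V_nonzero in auto)
  then have "holo_on ?W (unit_factor i)"
    by (rule holo_on_cong[OF open_nonzero_part]) (use unit_factor_off_zeros zeros_iff in auto)
  moreover have "holo_on {z} (unit_factor i)" if "z \<in> V i" "f i z = 0" for z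
    using unit_factor_at_zero(1) that zeros_iff by blast
  ultimately show ?thesis unfolding holo_on_def by blast
qed

lemma unit_factor_nonzero: "z \<in> V i \<Longrightarrow> unit_factor i z \<noteq> 0"
  using unit_factor_at_zero(2)[of z i] unit_factor_off_zeros[of z i] eqn_eq_0_iff[of z] V_nonzero[of z i] zeros_iff[of z i]
  by (cases "z \<in> zeros") auto

lemma eqn_eq_unit_factor_mult: "z \<in> V i \<Longrightarrow> eqn z = unit_factor i z * f i z"
  using unit_factor_at_zero(3)[of z i] unit_factor_off_zeros[of z i] zeros_iff[of z i]
  by (cases "z \<in> zeros") auto

text \<open>On a line of direction \<open>e\<close> the divisor is discrete, so identities between continuous functions
  extend across it.\<close>

lemma nonzero_dense:
  assumes "z \<noteq> 0" "isCont a z" "isCont b z" "open S" "z \<in> S" "\<And>w. w \<in> S \<Longrightarrow> w \<notin> zeros \<Longrightarrow> a w = (b w :: complex)"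
  shows "a z = b z"
proof (cases "z \<in> zeros")
  case False
  then show ?thesis using assms by blast
next
  case True
  then have off: "z \<in> off_axis" using axis_not_zero unfolding off_axis_def by blast
  have lim: "((\<lambda>s. z + s *s e) \<longlongrightarrow> z) (at 0)" by (auto intro!: tendsto_eq_intros)
  have "eventually (\<lambda>s. z + s *s e \<in> S) (at 0)" using topological_tendstoD[OF lim assms(4,5)] .
  then have "eventually (\<lambda>s. a (z + s *s e) = b (z + s *s e)) (at 0)"
    using eventually_not_root[OF off, of 0]
    by eventually_elim (auto simp: roots_def intro: assms(6))
  note ev = this
  have a: "((\<lambda>s. a (z + s *s e)) \<longlongrightarrow> a z) (at 0)" by (rule isCont_tendsto_compose[OF assms(2) lim])
  have b: "((\<lambda>s. b (z + s *s e)) \<longlongrightarrow> b z) (at 0)" by (rule isCont_tendsto_compose[OF assms(3) lim])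
  show ?thesis by (rule LIM_unique[OF Lim_transform_eventually[OF a ev] b])
qed

lemma isCont_unit_factor: "z \<in> V i \<Longrightarrow> isCont (unit_factor i) z"
  using holo_on_imp_continuous_on[OF holo_on_unit_factor] open_V continuous_on_eq_continuous_at by blast

lemma unit_factor_transition:
  assumes "z \<in> V i" "z \<in> V j"
  shows "unit_factor i z * g i j z = unit_factor j z"
proof (rule nonzero_dense[of z "\<lambda>z. unit_factor i z * g i j z" "unit_factor j" "V i \<inter> V j"])
  have "isCont (g i j) z"
    using holo_on_imp_continuous_on[OF holo_g] assms open_V continuous_on_eq_continuous_at by (metis IntI open_Int)
  then show "isCont (\<lambda>z. unit_factor i z * g i j z) z"
    by (intro continuous_intros isCont_unit_factor assms(1))
  fix w assume w: "w \<in> V i \<inter> V j" "w \<notin> zeros"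
  have "unit_factor i w * g i j w * f j w = unit_factor j w * f j w"
    using eqn_eq_unit_factor_mult[of w i] eqn_eq_unit_factor_mult[of w j] transition[of w i j] w
    by (metis IntD1 IntD2 mult.assoc)
  then show "unit_factor i w * g i j w = unit_factor j w" using w zeros_iff[of w j] by auto
qed (use assms V_nonzero isCont_unit_factor open_V in auto)

lemma unit_factor_smult:
  assumes z: "z \<in> V i" and c: "c \<noteq> 0"
  shows "unit_factor i (c *s z) * \<kappa> c = c ^ degree_of_divisor * unit_factor i z"
proof (rule nonzero_dense[of z "\<lambda>z. unit_factor i (c *s z) * \<kappa> c" "\<lambda>z. c ^ degree_of_divisor * unit_factor i z" "V i"])
  have "isCont (\<lambda>z. c *s z) z" by (rule linear_continuous_at[OF bounded_linear_smult_right])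
  then have "isCont (\<lambda>z. unit_factor i (c *s z)) z"
    using isCont_unit_factor[OF cone[OF z c]] by (rule isCont_o2)
  then show "isCont (\<lambda>z. unit_factor i (c *s z) * \<kappa> c) z" by (intro continuous_intros)
  show "isCont (\<lambda>z. c ^ degree_of_divisor * unit_factor i z) z"
    by (intro continuous_intros isCont_unit_factor z)
  fix w assume w: "w \<in> V i" "w \<notin> zeros"
  have "unit_factor i (c *s w) * \<kappa> c * f i w = c ^ degree_of_divisor * unit_factor i w * f i w"
    using eqn_eq_unit_factor_mult[OF w(1)] eqn_eq_unit_factor_mult[OF cone[OF w(1) c]] hom[OF w(1) c]
      eqn_smult[OF c, of w] by (metis mult.assoc)
  then show "unit_factor i (c *s w) * \<kappa> c = c ^ degree_of_divisor * unit_factor i w"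
    using w zeros_iff[of w i] by auto
qed (use z V_nonzero open_V in auto)


text \<open>Sections of the bundle with transition functions \<open>g\<close> become functions after multiplication by the
  unit factors, which trivialize the bundle.\<close>

definition glue :: "('i \<Rightarrow> complex ^ 'm \<Rightarrow> complex) \<Rightarrow> complex ^ 'm \<Rightarrow> complex" where
  "glue h z = unit_factor (SOME i. z \<in> V i) z * h (SOME i. z \<in> V i) z"

lemma glue_eq:
  assumes h: "\<And>i j z. z \<in> V i \<Longrightarrow> z \<in> V j \<Longrightarrow> h i z = g i j z * h j z" and z: "z \<in> V i"
  shows "glue h z = unit_factor i z * h i z"
proof -
  define j where "j = (SOME i. z \<in> V i)"
  have j: "z \<in> V j" unfolding j_def using z by (rule someI)
  have "glue h z = unit_factor j z * h j z" by (simp add: glue_def j_def)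
  also have "\<dots> = unit_factor i z * h i z"
    using unit_factor_transition[OF z j] h[OF z j] by (simp add: mult.assoc)
  finally show ?thesis .
qed

lemma holo_on_glue:
  assumes h: "\<And>i j z. z \<in> V i \<Longrightarrow> z \<in> V j \<Longrightarrow> h i z = g i j z * h j z" and "\<And>i. holo_on (V i) (h i)"
  shows "holo_on (- {0}) (glue h)"
proof (rule holo_on_local)
  fix z :: "complex ^ 'm" assume "z \<in> - {0}"
  then obtain i where i: "z \<in> V i" using cover by auto
  have "holo_on (V i) (glue h)"
    by (rule holo_on_cong[OF open_V holo_on_mult[OF holo_on_unit_factor assms(2)]])
       (use glue_eq[of h, OF h] in auto)
  then show "\<exists>W. open W \<and> z \<in> W \<and> holo_on W (glue h)" using i open_V by blast
qed

lemma glue_smult: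
  assumes h: "\<And>i j z. z \<in> V i \<Longrightarrow> z \<in> V j \<Longrightarrow> h i z = g i j z * h j z"
    and hom: "\<And>i c z. z \<in> V i \<Longrightarrow> c \<noteq> 0 \<Longrightarrow> h i (c *s z) = \<kappa> c * h i z"
    and c: "c \<noteq> 0" and z: "z \<noteq> 0"
  shows "glue h (c *s z) = c ^ degree_of_divisor * glue h z"
proof -
  obtain i where i: "z \<in> V i" using cover[OF z] by blast
  have "glue h (c *s z) = (unit_factor i (c *s z) * \<kappa> c) * h i z"
    using glue_eq[of h, OF h cone[OF i c]] hom[OF i c] by simp
  also have "\<dots> = c ^ degree_of_divisor * glue h z"
    unfolding unit_factor_smult[OF i c] using glue_eq[of h, OF h i] by simp
  finally show ?thesis .
qed

end

section \<open>Homogeneous coordinates and charts\<close>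

lemma matrix_inv_mult:
  fixes A :: "complex ^ 'n ^ 'n"
  assumes "invertible A"
  shows "A ** matrix_inv A = mat 1" "matrix_inv A ** A = mat 1"
  using assms someI_ex[of "\<lambda>A'. A ** A' = mat 1 \<and> A' ** A = mat 1"]
  unfolding matrix_inv_def invertible_def by auto

lemma matrix_inv_vector [simp]:
  fixes A :: "complex ^ 'n ^ 'n"
  assumes "invertible A"
  shows "A *v (matrix_inv A *v x) = x" "matrix_inv A *v (A *v x) = x"
  using matrix_inv_mult[OF assms] by (auto simp: matrix_vector_mul_assoc)

lemma invertible_nonzero:
  fixes A :: "complex ^ 'n ^ 'n"
  assumes "invertible A" "x \<noteq> 0" shows "A *v x \<noteq> 0"
  using matrix_inv_vector(2)[OF assms(1), of x] assms(2) by (metis matrix_vector_mult_0_right)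

lemma matrix_vector_smult: "A *v (c *s x) = c *s (A *v (x :: complex ^ 'n))" for A :: "complex ^ 'n ^ 'm"
  by (simp add: matrix_vector_mult_def vec_eq_iff sum_distrib_left mult_ac)

lemma ppt_eq_iff:
  assumes "z \<noteq> 0" "w \<noteq> 0"
  shows "ppt z = ppt w \<longleftrightarrow> (\<exists>c. c \<noteq> 0 \<and> w = c *s z)"
proof -
  have "proj_rel x x" if "x \<noteq> 0" for x :: "complex ^ ('a option)"
    using that unfolding proj_rel_def by (auto intro!: exI[of _ 1])
  then show ?thesis
    using Quotient3_rel[OF Quotient3_proj, of z w] assms unfolding proj_rel_def by auto
qed

lemma ppt_smult: "z \<noteq> 0 \<Longrightarrow> c \<noteq> 0 \<Longrightarrow> ppt (c *s z) = ppt z"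
  using ppt_eq_iff[of z "c *s z"] by auto

lemma rep_proj_nonzero: "rep_proj x \<noteq> 0"
  using Quotient3_rep_reflp[OF Quotient3_proj, of x] unfolding proj_rel_def by blast

lemma ppt_rep_proj [simp]: "ppt (rep_proj x) = x"
  by (rule Quotient3_abs_rep[OF Quotient3_proj])

lemma proj_cases: obtains z where "z \<noteq> 0" "x = ppt z"
  using rep_proj_nonzero ppt_rep_proj by metis

lemma ptan_eq_iff:
  assumes "z \<noteq> 0" "w \<noteq> 0"
  shows "ptan (z, v) = ptan (w, u) \<longleftrightarrow> (\<exists>c \<mu>. c \<noteq> 0 \<and> w = c *s z \<and> u = c *s v + \<mu> *s z)"
proof -
  have "tan_rel (x, y) (x, y)" if "x \<noteq> 0" for x y :: "complex ^ ('a option)"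
    using that unfolding tan_rel_def by (intro conjI exI[of _ 1] exI[of _ 0]) auto
  then show ?thesis
    using Quotient3_rel[OF Quotient3_ptangent, of "(z, v)" "(w, u)"] assms unfolding tan_rel_def by auto
qed

lemma ptan_cases: obtains z v where "z \<noteq> 0" "\<tau> = ptan (z, v)"
proof -
  have "fst (rep_ptangent \<tau>) \<noteq> 0"
    using Quotient3_rep_reflp[OF Quotient3_ptangent, of \<tau>] unfolding tan_rel_def by blast
  moreover have "\<tau> = ptan (fst (rep_ptangent \<tau>), snd (rep_ptangent \<tau>))"
    using Quotient3_abs_rep[OF Quotient3_ptangent, of \<tau>] by simp
  ultimately show ?thesis using that by blast
qed

lemma base_point_ptan: 
  assumes "z \<noteq> 0" shows "base_point (ptan (z, v)) = ppt z"
proof -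
  have 1: "fst (rep_ptangent (ptan (z, v))) \<noteq> 0"
    using Quotient3_rep_reflp[OF Quotient3_ptangent, of "ptan (z, v)"] unfolding tan_rel_def by blast
  have "ptan (fst (rep_ptangent (ptan (z, v))), snd (rep_ptangent (ptan (z, v)))) = ptan (z, v)"
    using Quotient3_abs_rep[OF Quotient3_ptangent, of "ptan (z, v)"] by simp
  then have "\<exists>c. c \<noteq> 0 \<and> z = c *s fst (rep_ptangent (ptan (z, v)))"
    using ptan_eq_iff[OF 1 assms] by blast
  then show ?thesis unfolding base_point_def using ppt_eq_iff[OF 1 assms] by blast
qed

lemma aff_point_nonzero: "aff_point x \<noteq> 0"
  by (auto simp: aff_point_def vec_eq_iff intro!: exI[of _ None])

lemma aff_point_nth [simp]: "aff_point x $ None = 1" "aff_point x $ Some j = x $ j"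
  by (simp_all add: aff_point_def)

lemma aff_vector_nth [simp]: "aff_vector x $ None = 0" "aff_vector x $ Some j = x $ j"
  by (simp_all add: aff_vector_def)

lemma chart_nonzero: "invertible (A :: complex ^ ('n::finite option) ^ ('n option)) \<Longrightarrow> A *v aff_point x \<noteq> 0"
  by (rule invertible_nonzero[OF _ aff_point_nonzero])

definition chart_height :: "complex ^ ('n::finite option) ^ ('n option) \<Rightarrow> complex ^ ('n option) \<Rightarrow> complex" where
  "chart_height A z = (matrix_inv A *v z) $ None"

definition chart_coords :: "complex ^ ('n::finite option) ^ ('n option) \<Rightarrow> complex ^ ('n option) \<Rightarrow> complex ^ 'n" where
  "chart_coords A z = (\<chi> j. (matrix_inv A *v z) $ Some j / chart_height A z)"

lemma chart_decomposition:
  assumes "invertible A" "chart_height A z \<noteq> 0"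
  shows "z = chart_height A z *s (A *v aff_point (chart_coords A z))"
proof -
  have "matrix_inv A *v z = chart_height A z *s aff_point (chart_coords A z)"
    using assms(2) by (simp add: vec_eq_iff chart_coords_def chart_height_def aff_point_def split: option.split)
  then have "A *v (matrix_inv A *v z) = A *v (chart_height A z *s aff_point (chart_coords A z))" by simp
  then show ?thesis using assms(1) by (simp add: matrix_vector_smult)
qed

lemma chart_chart_coords:
  assumes "invertible A" "chart_height A z \<noteq> 0"
  shows "chart A (chart_coords A z) = ppt z"
  using chart_decomposition[OF assms] ppt_smult[OF chart_nonzero[OF assms(1)] assms(2)]
  unfolding chart_def by metis

lemma chart_height_smult: "chart_height A (c *s z) = c * chart_height A z"
  by (simp add: chart_height_def matrix_vector_smult)

lemma chart_coords_smult: "c \<noteq> 0 \<Longrightarrow> chart_coords A (c *s z) = chart_coords A z"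
  by (simp add: chart_coords_def chart_height_smult) (simp add: matrix_vector_smult)

lemma chart_height_aff_point [simp]: "invertible A \<Longrightarrow> chart_height A (A *v aff_point x) = 1"
  by (simp add: chart_height_def)

lemma holo_on_chart_height: "holo_on S (chart_height A)"
  unfolding chart_height_def by (rule holo_on_matrix_vector_mult)

lemma holo_on_chart_coords: "(\<And>z. z \<in> S \<Longrightarrow> chart_height A z \<noteq> 0) \<Longrightarrow> holo_on S (\<lambda>z. chart_coords A z $ j)"
  unfolding chart_coords_def
  by (simp, intro holo_on_divide holo_on_matrix_vector_mult holo_on_chart_height) auto

text \<open>A coordinate that does not vanish at \<open>z\<close> is moved to the first place by a transposition.\<close>

lemma exists_chart:
  fixes z :: "complex ^ ('n::finite option)"
  assumes "z \<noteq> 0"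
  obtains A :: "complex ^ ('n option) ^ ('n option)" and x where "invertible A" "A *v aff_point x = z"
proof -
  obtain i where i: "z $ i \<noteq> 0" using assms by (metis vec_eq_iff zero_index)
  define \<pi> where "\<pi> = (\<lambda>a. if a = None then i else if a = i then None else a)"
  have \<pi>: "\<pi> (\<pi> a) = a" "\<pi> i = None" "\<pi> None = i" for a by (auto simp: \<pi>_def)
  define M where "M = (\<lambda>c :: complex. \<chi> a b. if b = \<pi> a then c else 0)"
  have M: "(M c *v x) $ a = c * x $ \<pi> a" for c x a
    by (simp add: M_def matrix_vector_mult_def if_distrib[of "\<lambda>y. y * _"] cong: if_cong)
  have mat: "(mat k *v x) $ a = k * x $ a" for k :: complex and x :: "complex ^ ('n option)" and a
    by (simp add: mat_def matrix_vector_mult_def if_distrib[of "\<lambda>y. y * _"] cong: if_cong)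
  have MM: "M c ** M d = mat (c * d)" for c d
    unfolding matrix_eq matrix_vector_mul_assoc[symmetric] by (simp add: vec_eq_iff M \<pi> mat)
  have "invertible (M (z $ i))"
    unfolding invertible_def by (intro exI[of _ "M (1 / z $ i)"]) (use i in \<open>simp add: MM\<close>)
  moreover have "M (z $ i) *v aff_point (\<chi> j. z $ \<pi> (Some j) / z $ i) = z"
  proof -
    have "z $ i * aff_point (\<chi> j. z $ \<pi> (Some j) / z $ i) $ \<pi> a = z $ a" for a
    proof (cases "\<pi> a")
      case None
      then have "a = i" using \<pi>(1)[of a] \<pi>(3) by simp
      then show ?thesis using None by simp
    next
      case (Some j)
      then show ?thesis using \<pi>(1)[of a] i by simp
    qed
    then show ?thesis by (simp add: vec_eq_iff M)
  qed
  ultimately show ?thesis by (rule that)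
qed

lemma exists_chart_height:
  assumes "z \<noteq> 0"
  obtains A where "invertible A" "chart_height A z \<noteq> 0"
  using exists_chart[OF assms] chart_height_aff_point by (metis zero_neq_one)

lemma exists_tan_chart:
  fixes \<tau> :: "'n::finite ptangent"
  obtains A x v where "invertible A" "\<tau> = tan_chart A x v"
proof -
  obtain z u where z: "z \<noteq> 0" "\<tau> = ptan (z, u)" by (rule ptan_cases)
  obtain A :: "complex ^ ('n option) ^ ('n option)" and x where A: "invertible A" "A *v aff_point x = z" using exists_chart[OF z(1)] by metis
  define w where "w = matrix_inv A *v u"
  define v where "v = (\<chi> j. w $ Some j - w $ None * x $ j)"
  have "w = aff_vector v + w $ None *s aff_point x"
    by (simp add: v_def vec_eq_iff aff_vector_def aff_point_def split: option.split)
  then have "A *v w = A *v aff_vector v + w $ None *s z"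
    by (metis A(2) matrix_vector_right_distrib matrix_vector_smult)
  moreover have "A *v w = u" using A(1) by (simp add: w_def)
  ultimately have "u = 1 *s (A *v aff_vector v) + w $ None *s z" by simp
  then have "ptan (z, A *v aff_vector v) = ptan (z, u)"
    using ptan_eq_iff[OF z(1) z(1)] by (metis vector_smult_lid zero_neq_one)
  then have "\<tau> = tan_chart A x v" using A z by (simp add: tan_chart_def)
  then show ?thesis using that A(1) by blast
qed

lemma open_proj_preimage: "open U \<Longrightarrow> open {z. z \<noteq> 0 \<and> ppt z \<in> (U :: 'n::finite proj set)}"
  by (simp add: open_proj_def)

lemma continuous_on_aff_point: "continuous_on S (\<lambda>x. A *v aff_point x)"
  for A :: "complex ^ ('n::finite option) ^ ('n option)"
proof -
  have "continuous_on S (\<lambda>x. aff_point x $ i)" for i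
    by (cases i) (auto intro!: continuous_intros)
  then have "continuous_on S (\<lambda>x. \<chi> i. \<Sum>j\<in>UNIV. A $ i $ j * aff_point x $ j)"
    by (intro continuous_on_vec_lambda continuous_on_sum continuous_on_mult continuous_on_const)
  then show ?thesis by (simp add: matrix_vector_mult_def)
qed

lemma open_chart_preimage:
  assumes "open U" "invertible A" shows "open (chart A -` U)"
proof -
  have "chart A -` U = (\<lambda>x. A *v aff_point x) -` {z. z \<noteq> 0 \<and> ppt z \<in> U}"
    using chart_nonzero[OF assms(2)] by (auto simp: chart_def)
  then show ?thesis
    using open_vimage[OF open_proj_preimage[OF assms(1)] continuous_on_aff_point] by simp
qed

section \<open>Holomorphic self-maps\<close>

type_synonym 'n chart_datum = "(complex ^ ('n option) ^ ('n option)) \<times> (complex ^ ('n option) ^ ('n option))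
   \<times> (complex ^ 'n) set \<times> (complex ^ 'n \<Rightarrow> complex ^ 'n)"

text \<open>The cone over the domain of a chart expression of \<open>T\<close>; on it \<open>local_lift\<close> is a lift of \<open>T\<close>, constant
  along rays. All chart expressions of \<open>T\<close> together index the covering.\<close>

definition lift_domain :: "('n::finite proj \<Rightarrow> 'n proj) \<Rightarrow> 'n chart_datum \<Rightarrow> (complex ^ ('n option)) set" where
  "lift_domain T i = (case i of (A, B, W, F) \<Rightarrow>
     {z. chart_expression T A B W F \<and> chart_height A z \<noteq> 0 \<and> chart_coords A z \<in> W})"

definition local_lift :: "'n::finite chart_datum \<Rightarrow> complex ^ ('n option) \<Rightarrow> complex ^ ('n option)" where
  "local_lift i z = (case i of (A, B, W, F) \<Rightarrow> B *v aff_point (F (chart_coords A z)))"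

lemma lift_domain_nonzero: "z \<in> lift_domain T i \<Longrightarrow> z \<noteq> 0"
  by (auto simp: lift_domain_def chart_height_def split: prod.splits)

lemma local_lift_nonzero: "z \<in> lift_domain T i \<Longrightarrow> local_lift i z \<noteq> 0"
  by (auto simp: lift_domain_def local_lift_def chart_expression_def chart_nonzero split: prod.splits)

lemma ppt_local_lift: "z \<in> lift_domain T i \<Longrightarrow> ppt (local_lift i z) = T (ppt z)"
  by (auto simp: lift_domain_def local_lift_def chart_expression_def split: prod.splits)
     (metis chart_chart_coords chart_def)

lemma open_lift_domain: "open (lift_domain T i)"
proof -
  obtain A B W F where i: "i = (A, B, W, F)" by (metis surj_pair)
  show ?thesis
  proof (cases "chart_expression T A B W F")
    case True
    let ?H = "{z. chart_height A z \<noteq> 0}"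
    have oH: "open ?H"
      using holo_on_imp_continuous_on[OF holo_on_chart_height, of UNIV A]
      by (intro open_Collect_neq continuous_intros) auto
    have "continuous_on ?H (\<lambda>z. chart_coords A z)"
    proof -
      have "continuous_on ?H (\<lambda>z. \<chi> j. chart_coords A z $ j)"
        by (intro continuous_on_vec_lambda holo_on_imp_continuous_on holo_on_chart_coords) auto
      then show ?thesis by simp
    qed
    from continuous_open_preimage[OF this oH, of W]
    have "open (?H \<inter> chart_coords A -` W)" using True by (simp add: chart_expression_def)
    moreover have "lift_domain T i = ?H \<inter> chart_coords A -` W"
      using True by (auto simp: lift_domain_def i)
    ultimately show ?thesis by simp
  qed (simp add: lift_domain_def i)
qed

lemma holo_on_local_lift: "holo_on (lift_domain T i) (\<lambda>z. local_lift i z $ b)"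
proof -
  obtain A B W F where i: "i = (A, B, W, F)" by (metis surj_pair)
  have 1: "holo_on (lift_domain T i) (\<lambda>z. aff_point (F (chart_coords A z)) $ c)" for c
  proof (cases c)
    case (Some j)
    show ?thesis
    proof (cases "chart_expression T A B W F")
      case True
      then have "holo_on W (\<lambda>x. F x $ j)" by (simp add: chart_expression_def)
      then have "holo_on (lift_domain T i) (\<lambda>z. F (chart_coords A z) $ j)"
        by (rule holo_on_compose[rotated]) (auto simp: lift_domain_def i intro!: holo_on_chart_coords)
      then show ?thesis by (simp add: Some)
    qed (simp add: lift_domain_def i holo_on_def)
  qed simp
  then have "holo_on (lift_domain T i) (\<lambda>z. \<Sum>c\<in>UNIV. B $ b $ c * aff_point (F (chart_coords A z)) $ c)"
    by (intro holo_on_sum holo_on_mult holo_on_const)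
  then show ?thesis by (simp add: local_lift_def i matrix_vector_mult_def)
qed

lemma lift_domain_cone:
  assumes "z \<in> lift_domain T i" "c \<noteq> 0"
  shows "c *s z \<in> lift_domain T i" "local_lift i (c *s z) = local_lift i z"
  using assms by (auto simp: lift_domain_def local_lift_def chart_height_smult chart_coords_smult split: prod.splits)

lemma lift_domain_cover:
  assumes "holo_map T" "z \<noteq> 0"
  shows "\<exists>i. z \<in> lift_domain T i"
proof -
  obtain A where A: "invertible A" "chart_height A z \<noteq> 0" using exists_chart_height[OF assms(2)] by metis
  then obtain B W F where "chart_coords A z \<in> W" "chart_expression T A B W F"
    using assms(1) unfolding holo_map_def by blast
  then have "z \<in> lift_domain T (A, B, W, F)" using A by (simp add: lift_domain_def)
  then show ?thesis by blast
qed

definition lift_ratio :: "'n::finite chart_datum \<Rightarrow> 'n chart_datum \<Rightarrow> complex ^ ('n option) \<Rightarrow> complex" where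
  "lift_ratio i j z = (THE c. local_lift i z = c *s local_lift j z)"

lemma local_lift_transition:
  assumes "z \<in> lift_domain T i" "z \<in> lift_domain T j"
  shows "local_lift i z = lift_ratio i j z *s local_lift j z" "lift_ratio i j z \<noteq> 0"
proof -
  obtain c where c: "c \<noteq> 0" "local_lift i z = c *s local_lift j z"
    using ppt_eq_iff[OF local_lift_nonzero local_lift_nonzero] assms ppt_local_lift by metis
  obtain b where b: "local_lift j z $ b \<noteq> 0" using local_lift_nonzero[OF assms(2)] by (metis vec_eq_iff zero_index)
  have "lift_ratio i j z = c"
    unfolding lift_ratio_def
  proof (rule the_equality)
    fix d assume "local_lift i z = d *s local_lift j z"
    then have "c * local_lift j z $ b = d * local_lift j z $ b" using c(2) by (metis vector_smult_component)
    then show "d = c" using b by simp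
  qed (rule c(2))
  then show "local_lift i z = lift_ratio i j z *s local_lift j z" "lift_ratio i j z \<noteq> 0" using c by auto
qed

lemma holo_on_lift_ratio: "holo_on (lift_domain T i \<inter> lift_domain T j) (lift_ratio i j)"
proof (rule holo_on_local)
  fix z assume z: "z \<in> lift_domain T i \<inter> lift_domain T j"
  obtain b where b: "local_lift j z $ b \<noteq> 0" using local_lift_nonzero z by (metis IntD2 vec_eq_iff zero_index)
  let ?W = "(lift_domain T i \<inter> lift_domain T j) \<inter> (\<lambda>z. local_lift j z $ b) -` (- {0})"
  have op: "open ?W"
  proof (rule continuous_open_preimage)
    show "continuous_on (lift_domain T i \<inter> lift_domain T j) (\<lambda>z. local_lift j z $ b)"
      by (rule holo_on_imp_continuous_on, rule holo_on_subset[OF holo_on_local_lift]) (rule Int_lower2)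
    show "open (lift_domain T i \<inter> lift_domain T j)" by (intro open_Int open_lift_domain)
  qed (simp add: open_Compl)
  have "holo_on ?W (\<lambda>z. local_lift i z $ b / local_lift j z $ b)"
    by (rule holo_on_divide) (auto intro: holo_on_subset[OF holo_on_local_lift])
  then have "holo_on ?W (lift_ratio i j)"
  proof (rule holo_on_cong[OF op])
    fix w assume w: "w \<in> ?W"
    then have "local_lift i w $ b = lift_ratio i j w * local_lift j w $ b"
      using local_lift_transition(1)[of w T i j] by (metis IntD1 IntD2 vector_smult_component)
    then show "local_lift i w $ b / local_lift j w $ b = lift_ratio i j w" using w by simp
  qed
  then show "\<exists>W. open W \<and> z \<in> W \<and> holo_on W (lift_ratio i j)" using op z b by blast
qed

text \<open>A component of the local lifts that does not vanish at one point defines a divisor; the unit factors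
  of this divisor glue the local lifts.\<close>

lemma holo_map_polynomial_lift:
  fixes T :: "'n::finite proj \<Rightarrow> 'n proj"
  assumes "holo_map T"
  obtains n P where "\<And>b. polyfun n (\<lambda>z. P z $ b)" "\<And>c z. c \<noteq> 0 \<Longrightarrow> P (c *s z) = c ^ n *s P z"
    "\<And>z. z \<noteq> 0 \<Longrightarrow> P z \<noteq> 0" "\<And>z. z \<noteq> 0 \<Longrightarrow> ppt (P z) = T (ppt z)"
proof -
  define e :: "complex ^ ('n option)" where "e = 1"
  have e: "e \<noteq> 0" by (simp add: e_def)
  obtain i0 where i0: "e \<in> lift_domain T i0" using lift_domain_cover[OF assms e] by blast
  obtain b0 where b0: "local_lift i0 e $ b0 \<noteq> 0" using local_lift_nonzero[OF i0] by (metis vec_eq_iff zero_index)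
  interpret cone_divisor "lift_domain T" "\<lambda>i z. local_lift i z $ b0" lift_ratio "\<lambda>_. 1" e
  proof
    show "2 \<le> CARD('n option)" by (simp add: card_UNIV_option Suc_le_eq)
    show "local_lift i z $ b0 = lift_ratio i j z * local_lift j z $ b0"
      if "z \<in> lift_domain T i" "z \<in> lift_domain T j" for z i j
      using local_lift_transition(1)[OF that] by (metis vector_smult_component)
    show "open (lift_domain T i)" for i by (rule open_lift_domain)
    show "z \<noteq> 0" if "z \<in> lift_domain T i" for z i by (rule lift_domain_nonzero[OF that])
    show "\<exists>i. z \<in> lift_domain T i" if "z \<noteq> 0" for z by (rule lift_domain_cover[OF assms that])
    show "c *s z \<in> lift_domain T i" if "z \<in> lift_domain T i" "c \<noteq> 0" for z i c
      by (rule lift_domain_cone[OF that])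
    show "holo_on (lift_domain T i) (\<lambda>z. local_lift i z $ b0)" for i by (rule holo_on_local_lift)
    show "lift_ratio i j z \<noteq> 0" if "z \<in> lift_domain T i" "z \<in> lift_domain T j" for z i j
      by (rule local_lift_transition(2)[OF that])
    show "holo_on (lift_domain T i \<inter> lift_domain T j) (lift_ratio i j)" for i j by (rule holo_on_lift_ratio)
    show "local_lift i (c *s z) $ b0 = 1 * local_lift i z $ b0" if "z \<in> lift_domain T i" "c \<noteq> 0" for z i c
      using lift_domain_cone(2)[OF that] by simp
    show "\<exists>i. e \<in> lift_domain T i \<and> local_lift i e $ b0 \<noteq> 0" using i0 b0 by blast
  qed simp
  define G where "G = (\<lambda>b. glue (\<lambda>i z. local_lift i z $ b))"
  have tr: "local_lift i z $ b = lift_ratio i j z * local_lift j z $ b"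
    if "z \<in> lift_domain T i" "z \<in> lift_domain T j" for b z i j
    using local_lift_transition(1)[OF that] by (metis vector_smult_component)
  have "holo_on (- {0}) (G b)" for b
    unfolding G_def by (rule holo_on_glue[OF tr holo_on_local_lift])
  moreover have "G b (c *s z) = c ^ degree_of_divisor * G b z" if "c \<noteq> 0" "z \<noteq> 0" for b c z
    unfolding G_def
  proof (rule glue_smult[OF tr _ that])
    show "local_lift i (c *s z) $ b = 1 * local_lift i z $ b" if "z \<in> lift_domain T i" "c \<noteq> 0" for i c z
      using lift_domain_cone(2)[OF that] by simp
  qed
  ultimately have "\<forall>b. \<exists>p. polyfun degree_of_divisor p \<and> (\<forall>z. z \<noteq> 0 \<longrightarrow> G b z = p z) \<and>
      (\<forall>c z. c \<noteq> 0 \<longrightarrow> p (c *s z) = c ^ degree_of_divisor * p z)"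
    by (intro allI holo_on_homogeneous_polynomial[OF card_ge])
  from choice[OF this] obtain p where p: "\<And>b. polyfun degree_of_divisor (p b)" "\<And>b z. z \<noteq> 0 \<Longrightarrow> G b z = p b z"
      "\<And>b c z. c \<noteq> 0 \<Longrightarrow> p b (c *s z) = c ^ degree_of_divisor * p b z"
    by blast
  define P where "P = (\<lambda>z. \<chi> b. p b z)"
  have P: "\<exists>u i. u \<noteq> 0 \<and> z \<in> lift_domain T i \<and> P z = u *s local_lift i z" if z: "z \<noteq> 0" for z
  proof -
    obtain i where i: "z \<in> lift_domain T i" using cover[OF z] by blast
    have "G b z = unit_factor i z * local_lift i z $ b" for b
      unfolding G_def by (rule glue_eq[OF tr i])
    then have "P z = unit_factor i z *s local_lift i z" using p(2)[OF z] by (simp add: P_def vec_eq_iff)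
    then show ?thesis using unit_factor_nonzero[OF i] i by blast
  qed
  show ?thesis
  proof (rule that[of degree_of_divisor P])
    fix z :: "complex ^ ('n option)" assume "z \<noteq> 0"
    then obtain u i where u: "u \<noteq> 0" "z \<in> lift_domain T i" "P z = u *s local_lift i z" using P by blast
    then show "P z \<noteq> 0" "ppt (P z) = T (ppt z)"
      using local_lift_nonzero[OF u(2)] ppt_local_lift[OF u(2)] ppt_smult[OF local_lift_nonzero[OF u(2)] u(1)] u(1)
      by auto
  qed (use p in \<open>auto simp: P_def vec_eq_iff\<close>)
qed

lemma nonvanishing_poly_constant:
  fixes p :: "complex poly"
  assumes "\<And>t. poly p t \<noteq> 0"
  obtains c where "p = [:c:]"
proof -
  have "degree p = 0"
  proof (rule ccontr)
    assume "degree p \<noteq> 0"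
    then have "\<not> constant (poly p)" by (simp add: constant_degree)
    then show False using Fundamental_Theorem_Algebra.fundamental_theorem_of_algebra assms by blast
  qed
  then show ?thesis using degree_0_id[of p] that by metis
qed

text \<open>By homogeneity the function equals its derivative at the origin.\<close>

lemma polyfun_degree_one_linear:
  fixes f :: "complex ^ 'a::finite \<Rightarrow> complex"
  assumes "polyfun 1 f" and hom: "\<And>c x. c \<noteq> 0 \<Longrightarrow> f (c *s x) = c * f x"
  shows "f x = (\<Sum>i\<in>UNIV. f (axis i 1) * x $ i)"
proof -
  have f0: "f 0 = 0" using hom[of 2 0] by simp
  obtain D where D: "(f has_derivative D) (at 0)"
    using holo_on_polyfun[OF assms(1), of UNIV] unfolding holo_on_def by blast
  interpret D: bounded_linear D by (rule has_derivative_bounded_linear[OF D])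
  have fD: "f v = D v" for v
  proof -
    have "((\<lambda>t. f (t *s v)) has_derivative (\<lambda>h. D (h *s v))) (at (0::complex))"
    proof -
      have "((\<lambda>t::complex. t *s v) has_derivative (\<lambda>h. h *s v)) (at 0)"
        by (rule bounded_linear.has_derivative[OF bounded_linear_smult_left has_derivative_ident])
      moreover have "(f has_derivative D) (at (0 *s v))" using D by simp
      ultimately show ?thesis using diff_chain_at by (fastforce simp: o_def)
    qed
    moreover have "(\<lambda>t. f (t *s v)) = (\<lambda>t. t * f v)"
    proof
      fix t show "f (t *s v) = t * f v" using hom[of t v] f0 by (cases "t = 0") auto
    qed
    ultimately have "((\<lambda>t. t * f v) has_derivative (\<lambda>h. D (h *s v))) (at (0::complex))" by simp
    moreover have "((\<lambda>t. t * f v) has_derivative (\<lambda>h. h * f v)) (at (0::complex))"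
      by (auto intro!: derivative_eq_intros)
    ultimately have "(\<lambda>h. D (h *s v)) = (\<lambda>h. h * f v)" by (rule has_derivative_unique)
    from fun_cong[OF this, of 1] show ?thesis by simp
  qed
  have "f x = f (\<Sum>i\<in>UNIV. x $ i *s axis i 1)" by (simp add: basis_expansion)
  also have "\<dots> = (\<Sum>i\<in>UNIV. f (x $ i *s axis i 1))" by (simp only: fD D.sum)
  also have "\<dots> = (\<Sum>i\<in>UNIV. f (axis i 1) * x $ i)"
    by (rule sum.cong[OF refl]) (metis f0 hom mult.commute mult_zero_right vector_smult_lzero)
  finally show ?thesis .
qed

text \<open>Let \<open>P\<close>, \<open>Q\<close> be polynomial lifts of \<open>T\<close> and its inverse, of degrees \<open>n\<close> and \<open>m\<close>. Then \<open>Q (P z)\<close> is a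
  nonzero multiple of \<open>z\<close>. On a line that avoids the origin the factor is a polynomial without zeros,
  hence constant. Comparing the lines \<open>z + t w\<close> and \<open>w + z / t\<close> by homogeneity of degree \<open>n m\<close> gives
  \<open>n m = 1\<close>.\<close>

lemma proj_Aut_linear:
  fixes T :: "'n::finite proj \<Rightarrow> 'n proj"
  assumes T: "T \<in> proj_Aut"
  obtains A where "invertible A" "\<And>z. z \<noteq> 0 \<Longrightarrow> T (ppt z) = ppt (A *v z)"
proof -
  have bij: "bij T" and h: "holo_map T" "holo_map (inv T)" using T by (auto simp: proj_Aut_def)
  obtain n P where P: "\<And>b. polyfun n (\<lambda>z. P z $ b)" "\<And>c z. c \<noteq> 0 \<Longrightarrow> P (c *s z) = c ^ n *s P z"
    "\<And>z. z \<noteq> 0 \<Longrightarrow> P z \<noteq> 0" "\<And>z. z \<noteq> 0 \<Longrightarrow> ppt (P z) = T (ppt z)"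
    using holo_map_polynomial_lift[OF h(1)] by metis
  obtain m Q where Q: "\<And>b. polyfun m (\<lambda>z. Q z $ b)" "\<And>c z. c \<noteq> 0 \<Longrightarrow> Q (c *s z) = c ^ m *s Q z"
    "\<And>z. z \<noteq> 0 \<Longrightarrow> Q z \<noteq> 0" "\<And>z. z \<noteq> 0 \<Longrightarrow> ppt (Q z) = inv T (ppt z)"
    using holo_map_polynomial_lift[OF h(2)] by metis
  have QP: "\<exists>c. c \<noteq> 0 \<and> Q (P z) = c *s z" if z: "z \<noteq> 0" for z
  proof -
    have "ppt (Q (P z)) = ppt z" using Q(4)[OF P(3)[OF z]] P(4)[OF z] bij by (simp add: bij_is_inj)
    then show ?thesis using ppt_eq_iff[OF z Q(3)[OF P(3)[OF z]]] by metis
  qed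
  have hom: "Q (P (c *s z)) = c ^ (n * m) *s Q (P z)" if "c \<noteq> 0" for c z
    using that by (simp add: P(2) Q(2) power_mult)
  have line: "\<exists>c. \<forall>t. Q (P (z + t *s w)) = c *s (z + t *s w)"
    if zw: "z $ a = 1" "w $ a = 0" for z w :: "complex ^ ('n option)" and a
  proof -
    have nz: "z + t *s w \<noteq> 0" for t using zw by (auto simp: vec_eq_iff intro!: exI[of _ a])
    have "polyfun (m * n) (\<lambda>z. Q (P z) $ a)" by (rule polyfun_compose[OF Q(1) P(1)])
    from polyfun_line[OF this, of z w] obtain p where p: "\<And>t. Q (P (z + t *s w)) $ a = poly p t" by blast
    have key: "\<exists>c. c \<noteq> 0 \<and> poly p t = c \<and> Q (P (z + t *s w)) = c *s (z + t *s w)" for t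
    proof -
      obtain c where c: "c \<noteq> 0" "Q (P (z + t *s w)) = c *s (z + t *s w)" using QP[OF nz] by blast
      have "poly p t = c" using p[of t] zw unfolding c(2) by simp
      then show ?thesis using c by blast
    qed
    then have "poly p t \<noteq> 0" for t by blast
    then obtain c where "p = [:c:]" by (rule nonvanishing_poly_constant)
    then show ?thesis using key by (intro exI[of _ c]) auto
  qed
  obtain j :: 'n where True by simp
  define z w :: "complex ^ ('n option)" where "z = axis None 1" and "w = axis (Some j) 1"
  obtain c where c: "\<And>t. Q (P (z + t *s w)) = c *s (z + t *s w)"
    using line[of z None w] by (auto simp: z_def w_def axis_def)
  obtain d where d: "\<And>t. Q (P (w + t *s z)) = d *s (w + t *s z)"
    using line[of w "Some j" z] by (auto simp: z_def w_def axis_def)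
  have cd: "t * c = t ^ (n * m) * d" if "t \<noteq> 0" for t
  proof -
    have "z + t *s w = t *s (w + (1 / t) *s z)" using that by (simp add: vec_eq_iff field_simps)
    then have "c *s (z + t *s w) = t ^ (n * m) *s (d *s (w + (1 / t) *s z))"
      using c[of t] hom[OF that] d[of "1 / t"] by metis
    then have "(c *s (z + t *s w)) $ Some j = (t ^ (n * m) *s (d *s (w + (1 / t) *s z))) $ Some j" by simp
    then show ?thesis by (simp add: z_def w_def axis_def mult.commute)
  qed
  have "c \<noteq> 0"
  proof -
    have "z \<noteq> 0" by (simp add: z_def)
    then have "Q (P z) \<noteq> 0" by (intro Q(3) P(3))
    then show ?thesis using c[of 0] by auto
  qed
  moreover have "c = d" using cd[of 1] by simp
  ultimately have "(2::complex) ^ (n * m) = 2 ^ 1" using cd[of 2] by simp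
  then have "n * m = 1"
  proof -
    assume "(2::complex) ^ (n * m) = 2 ^ 1"
    then have "norm ((2::complex) ^ (n * m)) = norm ((2::complex) ^ 1)" by simp
    then have "(2::real) ^ (n * m) = 2 ^ 1" by (simp add: norm_power)
    then show ?thesis by (rule power_inject_exp[THEN iffD1, rotated]) simp
  qed
  then have n: "n = 1" by simp
  define A :: "complex ^ ('n option) ^ ('n option)" where "A = (\<chi> b i. P (axis i 1) $ b)"
  have PA: "P z = A *v z" for z
  proof -
    have "P z $ b = (\<Sum>i\<in>UNIV. P (axis i 1) $ b * z $ i)" for b
    proof (rule polyfun_degree_one_linear)
      show "polyfun 1 (\<lambda>z. P z $ b)" using P(1)[of b] n by simp
      show "P (c *s x) $ b = c * P x $ b" if "c \<noteq> 0" for c x using P(2)[OF that, of x] n by simp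
    qed
    then show ?thesis by (simp add: vec_eq_iff A_def matrix_vector_mult_def)
  qed
  have "A *v x = 0 \<Longrightarrow> x = 0" for x using P(3)[of x] PA[of x] by auto
  then have "invertible A"
    unfolding invertible_left_inverse matrix_left_invertible_ker by blast
  moreover have "T (ppt z) = ppt (A *v z)" if "z \<noteq> 0" for z using P(4)[OF that] PA by simp
  ultimately show ?thesis using that by blast
qed

section \<open>Linear automorphisms\<close>

definition proj_lin :: "complex ^ ('n::finite option) ^ ('n option) \<Rightarrow> 'n proj \<Rightarrow> 'n proj" where
  "proj_lin A x = ppt (A *v rep_proj x)"

lemma proj_lin_ppt:
  assumes "invertible A" "z \<noteq> 0"
  shows "proj_lin A (ppt z) = ppt (A *v z)"
proof -
  obtain c where c: "c \<noteq> 0" "rep_proj (ppt z) = c *s z"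
    using ppt_eq_iff[OF assms(2) rep_proj_nonzero, of "ppt z"] by auto
  then show ?thesis
    using ppt_smult[OF invertible_nonzero[OF assms] c(1)] by (simp add: proj_lin_def matrix_vector_smult)
qed

lemma chart_expression_proj_lin:
  assumes "invertible A" "invertible B"
  shows "chart_expression (proj_lin A) B (A ** B) UNIV (\<lambda>x. x)"
  unfolding chart_expression_def
  using assms proj_lin_ppt[OF assms(1) chart_nonzero[OF assms(2)]]
  by (auto simp: invertible_mult chart_def matrix_vector_mul_assoc)

lemma holo_map_proj_lin: "invertible A \<Longrightarrow> holo_map (proj_lin A)"
  unfolding holo_map_def using chart_expression_proj_lin by blast

lemma invertible_matrix_inv:
  fixes A :: "complex ^ 'n ^ 'n"
  shows "invertible A \<Longrightarrow> invertible (matrix_inv A)"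
  using matrix_inv_mult unfolding invertible_def by blast

lemma proj_lin_inverse:
  assumes "invertible A" shows "proj_lin (matrix_inv A) (proj_lin A x) = x" "proj_lin A (proj_lin (matrix_inv A) x) = x"
proof -
  obtain z where z: "z \<noteq> 0" "x = ppt z" by (rule proj_cases)
  note i = invertible_matrix_inv[OF assms]
  show "proj_lin (matrix_inv A) (proj_lin A x) = x" "proj_lin A (proj_lin (matrix_inv A) x) = x"
    unfolding z(2) proj_lin_ppt[OF assms z(1)] proj_lin_ppt[OF i z(1)]
      proj_lin_ppt[OF i invertible_nonzero[OF assms z(1)]] proj_lin_ppt[OF assms invertible_nonzero[OF i z(1)]]
    using assms by auto
qed

lemma proj_lin_in_proj_Aut: "invertible A \<Longrightarrow> proj_lin A \<in> proj_Aut"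
proof -
  assume A: "invertible A"
  have "proj_lin (matrix_inv A) \<circ> proj_lin A = id" "proj_lin A \<circ> proj_lin (matrix_inv A) = id"
    using proj_lin_inverse[OF A] by (auto simp: fun_eq_iff)
  then have "bij (proj_lin A)" "inv (proj_lin A) = proj_lin (matrix_inv A)"
    by (auto intro: o_bij simp: inv_unique_comp)
  then show ?thesis
    unfolding proj_Aut_def using holo_map_proj_lin[OF A] holo_map_proj_lin[OF invertible_matrix_inv[OF A]] by simp
qed

text \<open>A matrix for which all vectors are eigenvectors is scalar.\<close>

lemma proj_lin_eqD:
  fixes A B :: "complex ^ ('n::finite option) ^ ('n option)"
  assumes A: "invertible A" and B: "invertible B" and eq: "proj_lin A = proj_lin B"
  obtains c where "c \<noteq> 0" "\<And>z. B *v z = c *s (A *v z)"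
proof -
  define M where "M = matrix_inv A ** B"
  have ex: "\<exists>c. M *v z = c *s z" if z: "z \<noteq> 0" for z
  proof -
    have "ppt (A *v z) = ppt (B *v z)" using eq proj_lin_ppt[OF A z] proj_lin_ppt[OF B z] by metis
    then obtain c where "B *v z = c *s (A *v z)"
      using ppt_eq_iff[OF invertible_nonzero[OF A z] invertible_nonzero[OF B z]] by blast
    then have "M *v z = c *s z"
      using A by (simp add: M_def matrix_vector_mul_assoc[symmetric] matrix_vector_smult)
    then show ?thesis by blast
  qed
  have "\<exists>c. M *v axis i 1 = c *s axis i 1" for i by (rule ex) simp
  then obtain ev where l: "\<And>i. M *v axis i 1 = ev i *s axis i 1" by metis
  have same: "ev i = ev j" if ij: "i \<noteq> j" for i j
  proof -
    have "axis i 1 + axis j 1 \<noteq> (0 :: complex ^ ('n option))"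
      using ij by (auto simp: vec_eq_iff axis_def intro!: exI[of _ i])
    then obtain c where "M *v (axis i 1 + axis j 1) = c *s (axis i 1 + axis j 1)" using ex by blast
    then have "ev i *s axis i 1 + ev j *s axis j 1 = c *s (axis i 1 + axis j (1::complex))"
      by (simp add: matrix_vector_right_distrib l)
    then have "(ev i *s axis i 1 + ev j *s axis j 1) $ a = (c *s (axis i 1 + axis j (1::complex))) $ a" for a by simp
    from this[of i] this[of j] show ?thesis using ij by (simp add: axis_def)
  qed
  define c where "c = ev None"
  have "M *v z = c *s z" for z
  proof -
    have "M *v z = M *v (\<Sum>i\<in>UNIV. z $ i *s axis i 1)" by (simp add: basis_expansion)
    also have "\<dots> = (\<Sum>i\<in>UNIV. z $ i *s (M *v axis i 1))"
      by (simp only: vec.linear_sum[OF matrix_vector_mul_linear_gen] matrix_vector_smult)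
    also have "\<dots> = (\<Sum>i\<in>UNIV. c *s (z $ i *s axis i 1))"
    proof (rule sum.cong[OF refl])
      fix i
      have "ev i = c" using same[of i None] by (cases "i = None") (auto simp: c_def)
      then show "z $ i *s (M *v axis i 1) = c *s (z $ i *s axis i 1)"
        by (simp only: l vector_smult_assoc mult.commute)
    qed
    also have "\<dots> = c *s z" by (simp only: vec.scale_sum_right[symmetric] basis_expansion)
    finally show ?thesis .
  qed
  then have Bz: "B *v z = c *s (A *v z)" for z
    using A matrix_inv_vector(1)[OF A, of "B *v z"]
    by (metis M_def matrix_vector_mul_assoc matrix_vector_smult)
  moreover have "c \<noteq> 0"
    using Bz[of 1] invertible_nonzero[OF B, of 1] by auto
  ultimately show ?thesis using that by blast
qed

lemma ptan_linear_cong: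
  fixes A :: "complex ^ ('n::finite option) ^ ('n option)"
  assumes A: "invertible A" and z: "z \<noteq> 0" "w \<noteq> 0" and eq: "ptan (z, v) = ptan (w, u)"
  shows "ptan (A *v z, A *v v) = ptan (A *v w, A *v u)"
proof -
  obtain c \<mu> where c: "c \<noteq> 0" "w = c *s z" "u = c *s v + \<mu> *s z" using ptan_eq_iff[OF z] eq by blast
  then have "A *v w = c *s (A *v z)" "A *v u = c *s (A *v v) + \<mu> *s (A *v z)"
    by (simp_all only: matrix_vector_smult matrix_vector_right_distrib)
  then show ?thesis
    using ptan_eq_iff[OF invertible_nonzero[OF A z(1)] invertible_nonzero[OF A z(2)]] c(1) by blast
qed

text \<open>In homogeneous coordinates a chart expression satisfies \<open>A B (1, x) = c(x) C (1, F x)\<close>; the claim is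
  the derivative of this identity, the term with \<open>c'\<close> being tangent to the ray.\<close>

lemma chart_expression_tangent:
  fixes T :: "'n::finite proj \<Rightarrow> 'n proj"
  assumes A: "invertible A" and T: "\<And>z. z \<noteq> 0 \<Longrightarrow> T (ppt z) = ppt (A *v z)"
    and ce: "chart_expression T B C W F" and x: "x \<in> W"
  shows "tan_chart C (F x) (frechet_derivative F (at x) v) = ptan (A *v (B *v aff_point x), A *v (B *v aff_vector v))"
proof -
  have B: "invertible B" and C: "invertible C" and W: "open W" and hF: "\<And>i. holo_on W (\<lambda>x. F x $ i)"
    and TF: "\<And>x. x \<in> W \<Longrightarrow> T (chart B x) = chart C (F x)"
    using ce unfolding chart_expression_def by auto
  obtain D where D: "(F has_derivative D) (at x)" "\<And>c v. D (c *s v) = c *s D v"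
    using has_derivative_vec_of_holo_on[OF hF x] by blast
  have FD: "frechet_derivative F (at x) = D" using frechet_derivative_at[OF D(1)] by simp
  define M where "M = matrix_inv C ** A ** B"
  have Mv: "M *v y = matrix_inv C *v (A *v (B *v y))" for y
    by (simp add: M_def matrix_vector_mul_assoc[symmetric])
  have MF: "M *v aff_point y = (M *v aff_point y) $ None *s aff_point (F y)" if y: "y \<in> W" for y
  proof -
    have nz: "B *v aff_point y \<noteq> 0" by (rule chart_nonzero[OF B])
    have "ppt (C *v aff_point (F y)) = ppt (A *v (B *v aff_point y))"
      using TF[OF y] T[OF nz] by (simp add: chart_def)
    then obtain c where "A *v (B *v aff_point y) = c *s (C *v aff_point (F y))"
      using ppt_eq_iff[OF chart_nonzero[OF C] invertible_nonzero[OF A nz]] by blast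
    then have "M *v aff_point y = c *s aff_point (F y)" using C by (simp add: Mv matrix_vector_smult)
    then show ?thesis by simp
  qed
  define b where "b = (\<lambda>a. (M *v aff_point x) $ a)"
  define b' where "b' = (\<lambda>a. (M *v aff_vector v) $ a)"
  have aff: "(M *v aff_point (x + t *s v)) $ a = b a + t * b' a" for t a
  proof -
    have "aff_point (x + t *s v) = aff_point x + t *s aff_vector v"
      by (simp add: vec_eq_iff aff_point_def aff_vector_def split: option.split)
    then show ?thesis by (simp add: b_def b'_def matrix_vector_right_distrib matrix_vector_smult)
  qed
  have key: "b' (Some j) = b' None * F x $ j + b None * D v $ j" for j
  proof -
    have dF: "((\<lambda>t. F (x + t *s v) $ j) has_field_derivative D v $ j) (at 0)"
    proof -
      have "((\<lambda>t. x + t *s v) has_derivative (\<lambda>h. h *s v)) (at (0::complex))"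
        by (auto intro!: derivative_eq_intros bounded_linear.has_derivative[OF bounded_linear_smult_left])
      moreover have "(F has_derivative D) (at (x + 0 *s v))" using D(1) by simp
      ultimately have "(F \<circ> (\<lambda>t. x + t *s v) has_derivative D \<circ> (\<lambda>h. h *s v)) (at 0)" by (rule diff_chain_at)
      from bounded_linear.has_derivative[OF bounded_linear_vec_nth this, of j]
      show ?thesis by (simp add: o_def D(2) has_field_derivative_def mult_commute_abs)
    qed
    have "((\<lambda>t. (b None + t * b' None) * F (x + t *s v) $ j) has_field_derivative
        b' None * F x $ j + b None * D v $ j) (at 0)"
      by (rule derivative_eq_intros dF refl | simp)+
    moreover have "((\<lambda>t. (b None + t * b' None) * F (x + t *s v) $ j) has_field_derivative b' (Some j)) (at 0)"
    proof (rule has_field_derivative_transform_within_open)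
      show "((\<lambda>t. b (Some j) + t * b' (Some j)) has_field_derivative b' (Some j)) (at 0)"
        by (rule derivative_eq_intros refl | simp)+
      show "open {t. x + t *s v \<in> W}" by (rule open_line_preimage[OF W])
      show "0 \<in> {t. x + t *s v \<in> W}" using x by simp
      fix t assume "t \<in> {t. x + t *s v \<in> W}"
      then have "(M *v aff_point (x + t *s v)) $ Some j = ((M *v aff_point (x + t *s v)) $ None *s aff_point (F (x + t *s v))) $ Some j"
        using MF by simp
      then show "b (Some j) + t * b' (Some j) = (b None + t * b' None) * F (x + t *s v) $ j"
        by (simp add: aff distrib_right)
    qed
    ultimately show ?thesis using DERIV_unique by blast
  qed
  have "M *v aff_vector v = b None *s aff_vector (D v) + b' None *s aff_point (F x)"
  proof -
    have "(M *v aff_vector v) $ a = (b None *s aff_vector (D v) + b' None *s aff_point (F x)) $ a" for a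
      by (cases a) (auto simp: key[symmetric] b'_def[symmetric] add.commute)
    then show ?thesis unfolding vec_eq_iff ..
  qed
  moreover have "M *v aff_point x = b None *s aff_point (F x)" using MF[OF x] by (simp add: b_def)
  ultimately have "C *v (M *v aff_point x) = b None *s (C *v aff_point (F x))"
    "C *v (M *v aff_vector v) = b None *s (C *v aff_vector (D v)) + b' None *s (C *v aff_point (F x))"
    by (simp_all only: matrix_vector_smult matrix_vector_right_distrib)
  then have eqs: "A *v (B *v aff_point x) = b None *s (C *v aff_point (F x))"
    "A *v (B *v aff_vector v) = b None *s (C *v aff_vector (D v)) + b' None *s (C *v aff_point (F x))"
    using C by (simp_all add: Mv)
  have nz: "A *v (B *v aff_point x) \<noteq> 0" by (rule invertible_nonzero[OF A chart_nonzero[OF B]])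
  then have "b None \<noteq> 0" using eqs(1) by auto
  then show ?thesis
    unfolding tan_chart_def FD using ptan_eq_iff[OF chart_nonzero[OF C] nz] eqs by blast
qed

lemma proj_differential_linear:
  fixes T :: "'n::finite proj \<Rightarrow> 'n proj"
  assumes A: "invertible A" and T: "\<And>z. z \<noteq> 0 \<Longrightarrow> T (ppt z) = ppt (A *v z)" and hT: "holo_map T" and z: "z \<noteq> 0"
  shows "proj_differential T (ptan (z, v)) = ptan (A *v z, A *v v)"
  unfolding proj_differential_def
proof (rule the_equality)
  obtain B x u where B: "invertible B" "ptan (z, v) = tan_chart B x u" by (rule exists_tan_chart)
  obtain C W F where ce: "x \<in> W" "chart_expression T B C W F" using hT B(1) unfolding holo_map_def by blast
  have "tan_chart C (F x) (frechet_derivative F (at x) u) = ptan (A *v z, A *v v)"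
    using chart_expression_tangent[OF A T ce(2,1)] ptan_linear_cong[OF A z chart_nonzero[OF B(1)]] B(2)
    by (simp add: tan_chart_def)
  then show "\<exists>B C W F x u. chart_expression T B C W F \<and> x \<in> W \<and> ptan (z, v) = tan_chart B x u \<and>
      ptan (A *v z, A *v v) = tan_chart C (F x) (frechet_derivative F (at x) u)"
    using B(2) ce by metis
next
  fix \<sigma> assume "\<exists>B C W F x u. chart_expression T B C W F \<and> x \<in> W \<and> ptan (z, v) = tan_chart B x u \<and>
      \<sigma> = tan_chart C (F x) (frechet_derivative F (at x) u)"
  then obtain B C W F x u where ce: "chart_expression T B C W F" "x \<in> W" "ptan (z, v) = tan_chart B x u"
      "\<sigma> = tan_chart C (F x) (frechet_derivative F (at x) u)" by blast
  have B: "invertible B" using ce(1) unfolding chart_expression_def by blast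
  show "\<sigma> = ptan (A *v z, A *v v)"
    using chart_expression_tangent[OF A T ce(1,2)] ptan_linear_cong[OF A z chart_nonzero[OF B]] ce(3,4)
    by (simp add: tan_chart_def)
qed

section \<open>Symmetric forms in homogeneous coordinates\<close>

lemma ptan_chart:
  assumes A: "invertible A" and h: "chart_height A z \<noteq> 0"
  shows "ptan (z, v) = tan_chart A (chart_coords A z)
    (\<chi> j. ((matrix_inv A *v v) $ Some j - (matrix_inv A *v v) $ None * chart_coords A z $ j) / chart_height A z)"
proof -
  define w where "w = matrix_inv A *v v"
  define u where "u = (\<chi> j. (w $ Some j - w $ None * chart_coords A z $ j) / chart_height A z)"
  have "w = chart_height A z *s aff_vector u + w $ None *s aff_point (chart_coords A z)"
    using h by (simp add: u_def vec_eq_iff aff_vector_def aff_point_def split: option.split)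
  then have "A *v w = chart_height A z *s (A *v aff_vector u) + w $ None *s (A *v aff_point (chart_coords A z))"
    by (metis matrix_vector_right_distrib matrix_vector_smult)
  moreover have "A *v w = v" using A by (simp add: w_def)
  ultimately have v: "v = chart_height A z *s (A *v aff_vector u) + w $ None *s (A *v aff_point (chart_coords A z))" by simp
  have z: "z \<noteq> 0" using h by (auto simp: chart_height_def)
  have "ptan (A *v aff_point (chart_coords A z), A *v aff_vector u) = ptan (z, v)"
    using ptan_eq_iff[OF chart_nonzero[OF A] z] v chart_decomposition[OF A h] h by metis
  then show ?thesis by (simp add: tan_chart_def u_def w_def)
qed

text \<open>The affine coordinates of a point are rational functions of \<open>z\<close>, and those of the tangent vector
  are in addition linear in \<open>v\<close>.\<close>

lemma sym_form_homogeneous_coordinates: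
  fixes U :: "'n::finite proj set"
  assumes form: "proj_sym_form k U \<omega>" and U: "open U"
  shows "z \<noteq> 0 \<Longrightarrow> ppt z \<in> U \<Longrightarrow> polyfun k (\<lambda>v. \<omega> (ptan (z, v)))"
    and "z \<noteq> 0 \<Longrightarrow> ppt z \<in> U \<Longrightarrow> \<omega> (ptan (z, c *s v)) = c ^ k * \<omega> (ptan (z, v))"
    and "holo_on {z. z \<noteq> 0 \<and> ppt z \<in> U} (\<lambda>z. \<omega> (ptan (z, v)))"
proof -
  define u where "u = (\<lambda>A (z :: complex ^ ('n option)) v. (\<chi> j. ((matrix_inv A *v v) $ Some j
    - (matrix_inv A *v v) $ None * chart_coords A z $ j) / chart_height A z) :: complex ^ 'n)"
  have repr: "\<exists>a. (\<forall>I\<in>{I. sum I UNIV = k}. holo_on (chart A -` U) (a I)) \<and>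
     (\<forall>z v. chart_height A z \<noteq> 0 \<longrightarrow> ppt z \<in> U \<longrightarrow>
       \<omega> (ptan (z, v)) = (\<Sum>I | sum I UNIV = k. a I (chart_coords A z) * monomial I (u A z v)))"
    if A: "invertible A" for A
  proof -
    obtain a where a: "\<forall>I\<in>{I. sum I UNIV = k}. holo_on (chart A -` U) (a I)"
      "\<And>x v. x \<in> chart A -` U \<Longrightarrow> local_form A \<omega> x v = (\<Sum>I | sum I UNIV = k. a I x * monomial I v)"
      using form A unfolding proj_sym_form_def sym_form_def by blast
    have "\<omega> (ptan (z, v)) = (\<Sum>I | sum I UNIV = k. a I (chart_coords A z) * monomial I (u A z v))"
      if "chart_height A z \<noteq> 0" "ppt z \<in> U" for z v
      using ptan_chart[OF A that(1)] a(2)[of "chart_coords A z"] chart_chart_coords[OF A that(1)] that(2)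
      by (simp add: local_form_def u_def)
    then show ?thesis using a(1) by blast
  qed
  show "polyfun k (\<lambda>v. \<omega> (ptan (z, v)))" "\<omega> (ptan (z, c *s v)) = c ^ k * \<omega> (ptan (z, v))"
    if z: "z \<noteq> 0" "ppt z \<in> U" for z
  proof -
    obtain A where A: "invertible A" "chart_height A z \<noteq> 0" using exists_chart_height[OF z(1)] by metis
    obtain a where a: "\<And>v. \<omega> (ptan (z, v)) = (\<Sum>I | sum I UNIV = k. a I (chart_coords A z) * monomial I (u A z v))"
      using repr[OF A(1)] A(2) z(2) by blast
    have u1: "polyfun 1 (\<lambda>v. u A z v $ j)" for j
    proof -
      have mv: "polyfun 1 (\<lambda>v. (matrix_inv A *v v) $ b)" for b
        unfolding matrix_vector_mult_def using polyfun_nth[of 0]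
        by (auto intro!: polyfun_sum polyfun_cmult)
      have "(\<lambda>v. u A z v $ j) = (\<lambda>v. (1 / chart_height A z) * (matrix_inv A *v v) $ Some j
          + (- chart_coords A z $ j / chart_height A z) * (matrix_inv A *v v) $ None)"
        by (auto simp: u_def diff_divide_distrib mult.commute)
      then show ?thesis by (simp only:) (intro polyfun_add polyfun_cmult mv)
    qed
    have "polyfun k (\<lambda>v. monomial I (u A z v))" if "sum I UNIV = k" for I
      using polyfun_compose[OF polyfun_monomial u1, of I] that by simp
    then show "polyfun k (\<lambda>v. \<omega> (ptan (z, v)))"
      unfolding a by (auto intro!: polyfun_sum polyfun_cmult)
    have "u A z (c *s v) = c *s u A z v"
      by (simp add: u_def vec_eq_iff matrix_vector_smult algebra_simps)
    then show "\<omega> (ptan (z, c *s v)) = c ^ k * \<omega> (ptan (z, v))"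
      unfolding a by (simp add: monomial_smult sum_distrib_left mult_ac)
  qed
  show "holo_on {z. z \<noteq> 0 \<and> ppt z \<in> U} (\<lambda>z. \<omega> (ptan (z, v)))"
  proof (rule holo_on_local)
    fix z assume "z \<in> {z. z \<noteq> 0 \<and> ppt z \<in> U}"
    then have z: "z \<noteq> 0" "ppt z \<in> U" by auto
    obtain A where A: "invertible A" "chart_height A z \<noteq> 0" using exists_chart_height[OF z(1)] by metis
    from repr[OF A(1)] obtain a where a': "(\<forall>I\<in>{I. sum I UNIV = k}. holo_on (chart A -` U) (a I)) \<and>
     (\<forall>z v. chart_height A z \<noteq> 0 \<longrightarrow> ppt z \<in> U \<longrightarrow>
       \<omega> (ptan (z, v)) = (\<Sum>I | sum I UNIV = k. a I (chart_coords A z) * monomial I (u A z v)))" ..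
    then have a: "\<And>I. sum I UNIV = k \<Longrightarrow> holo_on (chart A -` U) (a I)"
      "\<And>z v. chart_height A z \<noteq> 0 \<Longrightarrow> ppt z \<in> U \<Longrightarrow>
       \<omega> (ptan (z, v)) = (\<Sum>I | sum I UNIV = k. a I (chart_coords A z) * monomial I (u A z v))"
      by simp_all
    let ?W = "{z. chart_height A z \<noteq> 0} \<inter> {z. z \<noteq> 0 \<and> ppt z \<in> U}"
    have "open {z. chart_height A z \<noteq> 0}"
      using holo_on_imp_continuous_on[OF holo_on_chart_height, of UNIV A]
      by (intro open_Collect_neq continuous_intros) auto
    then have op: "open ?W" using open_proj_preimage[OF U] by (rule open_Int)
    have "holo_on ?W (\<lambda>z. \<Sum>I | sum I UNIV = k. a I (chart_coords A z) * monomial I (u A z v))"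
    proof (intro holo_on_sum holo_on_mult)
      fix I :: "'n \<Rightarrow> nat" assume "I \<in> {I. sum I UNIV = k}"
      then show "holo_on ?W (\<lambda>z. a I (chart_coords A z))"
        by (intro holo_on_compose[OF _ a(1)] holo_on_chart_coords) (auto simp: chart_chart_coords[OF A(1)])
      show "holo_on ?W (\<lambda>z. monomial I (u A z v))"
      proof (rule holo_on_compose[OF _ holo_on_polyfun[OF polyfun_monomial], of _ _ UNIV])
        fix j
        have "holo_on ?W (\<lambda>z. ((matrix_inv A *v v) $ Some j + (- (matrix_inv A *v v) $ None) * chart_coords A z $ j) / chart_height A z)"
          by (intro holo_on_divide holo_on_add holo_on_mult holo_on_const holo_on_chart_coords holo_on_chart_height) auto
        then show "holo_on ?W (\<lambda>z. u A z v $ j)" by (simp add: u_def)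
      qed simp
    qed
    then have "holo_on ?W (\<lambda>z. \<omega> (ptan (z, v)))"
      by (rule holo_on_cong[OF op]) (use a(2) in auto)
    then show "\<exists>W. open W \<and> z \<in> W \<and> holo_on W (\<lambda>z. \<omega> (ptan (z, v)))" using op z A(2) by blast
  qed
qed

lemma holo_on_holo_fun:
  fixes U :: "'n::finite proj set"
  assumes g: "holo_fun U g" and U: "open U"
  shows "holo_on {z. z \<noteq> 0 \<and> ppt z \<in> U} (\<lambda>z. g (ppt z))"
proof (rule holo_on_local)
  fix z assume "z \<in> {z. z \<noteq> 0 \<and> ppt z \<in> U}"
  then have z: "z \<noteq> 0" "ppt z \<in> U" by auto
  obtain A where A: "invertible A" "chart_height A z \<noteq> 0" using exists_chart_height[OF z(1)] by metis
  let ?W = "{z. chart_height A z \<noteq> 0} \<inter> {z. z \<noteq> 0 \<and> ppt z \<in> U}"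
  have "open {z. chart_height A z \<noteq> 0}"
    using holo_on_imp_continuous_on[OF holo_on_chart_height, of UNIV A]
    by (intro open_Collect_neq continuous_intros) auto
  then have op: "open ?W" using open_proj_preimage[OF U] by (rule open_Int)
  have "holo_on (chart A -` U) (\<lambda>x. g (chart A x))" using g A(1) unfolding holo_fun_def by blast
  then have "holo_on ?W (\<lambda>z. g (chart A (chart_coords A z)))"
    by (rule holo_on_compose[rotated]) (auto simp: chart_chart_coords[OF A(1)] intro!: holo_on_chart_coords)
  then have "holo_on ?W (\<lambda>z. g (ppt z))"
    by (rule holo_on_cong[OF op]) (auto simp: chart_chart_coords[OF A(1)])
  then show "\<exists>W. open W \<and> z \<in> W \<and> holo_on W (\<lambda>z. g (ppt z))" using op z A(2) by blast
qed

section \<open>The homogeneous polynomial of a web\<close>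

text \<open>Lagrange interpolation on a grid. It separates the variables of a function that is polynomial in
  \<open>v\<close> and holomorphic in \<open>z\<close>.\<close>

lemma polyfun_interpolation:
  "\<exists>(R :: ('a::finite \<Rightarrow> nat) set) pt L. finite R \<and> (\<forall>r. \<exists>n. polyfun n (L r)) \<and>
     (\<forall>f. polyfun k f \<longrightarrow> (\<forall>v :: complex ^ 'a. f v = (\<Sum>r\<in>R. f (pt r) * L r v)))"
proof -
  obtain l where l: "\<And>(p :: complex poly) t. degree p \<le> k \<Longrightarrow> poly p t = (\<Sum>m\<le>k. poly p (of_nat (Suc m)) * poly (l m) t)"
    using lagrange_interpolation by metis
  define R where "R = PiE (UNIV :: 'a set) (\<lambda>_. {..k})"
  define pt where "pt = (\<lambda>r :: 'a \<Rightarrow> nat. (\<chi> i. of_nat (Suc (r i))) :: complex ^ 'a)"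
  define L where "L = (\<lambda>(r :: 'a \<Rightarrow> nat) (v :: complex ^ 'a). \<Prod>i\<in>UNIV. poly (l (r i)) (v $ i))"
  have "finite R" unfolding R_def by (intro finite_PiE) auto
  moreover have "\<exists>n. polyfun n (L r)" for r
  proof -
    have "\<forall>i. \<exists>n. polyfun n (\<lambda>v :: complex ^ 'a. poly (l (r i)) (v $ i))" using polyfun_poly_nth by blast
    from choice[OF this] obtain n where "\<And>i. polyfun (n i) (\<lambda>v :: complex ^ 'a. poly (l (r i)) (v $ i))" by blast
    then have "polyfun (sum n UNIV) (L r)" unfolding L_def by (intro polyfun_prod)
    then show ?thesis by blast
  qed
  moreover have "f v = (\<Sum>r\<in>R. f (pt r) * L r v)" if f: "polyfun k f" for f and v :: "complex ^ 'a"
  proof -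
    have mono: "monomial I v = (\<Sum>r\<in>R. monomial I (pt r) * L r v)" if I: "sum I UNIV \<le> k" for I
    proof -
      have "monomial I v = (\<Prod>i\<in>UNIV. \<Sum>m\<le>k. of_nat (Suc m) ^ I i * poly (l m) (v $ i))"
        unfolding monomial_def
      proof (rule prod.cong[OF refl])
        fix i
        have "degree (monom (1::complex) (I i)) \<le> k"
          using le_trans[OF multi_index_le_sum I] degree_monom_le le_trans by blast
        from l[OF this, of "v $ i"] show "v $ i ^ I i = (\<Sum>m\<le>k. of_nat (Suc m) ^ I i * poly (l m) (v $ i))"
          by (simp add: poly_monom del: of_nat_Suc)
      qed
      also have "\<dots> = (\<Sum>r\<in>R. \<Prod>i\<in>UNIV. of_nat (Suc (r i)) ^ I i * poly (l (r i)) (v $ i))"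
        unfolding R_def by (rule prod_sum_PiE) auto
      finally show ?thesis by (simp add: monomial_def pt_def L_def prod.distrib)
    qed
    obtain c where c: "\<And>x. f x = (\<Sum>I | sum I UNIV \<le> k. c I * monomial I x)" using polyfun_repr[OF f] by blast
    have "f v = (\<Sum>I | sum I UNIV \<le> k. \<Sum>r\<in>R. c I * monomial I (pt r) * L r v)"
      unfolding c by (rule sum.cong[OF refl]) (simp add: mono sum_distrib_left mult.assoc)
    also have "\<dots> = (\<Sum>r\<in>R. f (pt r) * L r v)"
      by (subst sum.swap) (simp add: c sum_distrib_right)
    finally show ?thesis .
  qed
  ultimately show ?thesis by blast
qed

text \<open>The entries of a matrix as the coordinates of a vector, so that polynomial functions of a matrix
  are covered by \<open>polyfun\<close>.\<close>

definition vmat :: "complex ^ ('m::finite \<times> 'm) \<Rightarrow> complex ^ 'm ^ 'm" where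
  "vmat x = (\<chi> i j. x $ (i, j))"

lemma polyfun_vmat_vector: "polyfun 1 (\<lambda>x. (vmat x *v z) $ i)"
proof -
  have "polyfun 1 (\<lambda>x. \<Sum>j\<in>UNIV. z $ j * x $ (i, j))"
    using polyfun_nth[of 0] by (auto intro!: polyfun_sum polyfun_cmult)
  then show ?thesis by (simp add: vmat_def matrix_vector_mult_def mult.commute)
qed

lemma vmat_smult_vector: "vmat (c *s x) *v z = c *s (vmat x *v z)"
  by (simp add: vmat_def matrix_vector_mult_def vec_eq_iff sum_distrib_left mult.assoc)

lemma exists_vmat: "\<exists>x. vmat x = A"
  by (rule exI[of _ "\<chi> p. A $ fst p $ snd p"]) (simp add: vmat_def vec_eq_iff)

lemma degree_eq_sum_order: "p \<noteq> 0 \<Longrightarrow> (\<Sum>z | poly p z = 0. order z p) = degree (p :: complex poly)"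
proof -
  assume p: "p \<noteq> 0"
  have "degree p = degree (smult (lead_coeff p) (\<Prod>z | poly p z = 0. [:- z, 1:] ^ order z p))"
    by (simp only: complex_poly_decompose)
  also have "\<dots> = (\<Sum>z | poly p z = 0. order z p)"
    using p by (simp add: degree_prod_sum_eq degree_power_eq)
  finally show ?thesis by simp
qed

lemma zorder_poly:
  assumes "p \<noteq> 0" shows "zorder (poly p) z = int (order z p)"
proof -
  obtain q where q: "p = [:- z, 1:] ^ order z p * q" "\<not> [:- z, 1:] dvd q" using order_decomp[OF assms] by blast
  show ?thesis
  proof (rule zorder_eqI[of UNIV z "poly q"])
    show "poly q z \<noteq> 0" using q(2) by (simp add: poly_eq_0_iff_dvd)
    fix w :: complex
    have "poly p w = (w - z) ^ order z p * poly q w"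
      by (subst q(1)) (simp add: poly_power)
    then show "poly p w = poly q w * (w - z) powi int (order z p)" by simp
  qed (auto intro!: holomorphic_intros)
qed

lemma zorder_unit_multiple:
  assumes S: "open S" "z \<in> S" and w: "w holomorphic_on S" "w z \<noteq> 0" and h: "h holomorphic_on S"
    and p: "p \<noteq> 0" "\<And>s. s \<in> S \<Longrightarrow> poly p s = w s * h s"
  shows "zorder h z = int (order z p)"
proof -
  have aw: "w analytic_on {z}" and ah: "h analytic_on {z}" using S w(1) h analytic_at by blast+
  have nz: "eventually (\<lambda>s. poly p s \<noteq> 0) (at z)"
    using islimpt_finite[OF poly_roots_finite[OF p(1)], of z] by (simp add: islimpt_iff_eventually)
  have inS: "eventually (\<lambda>s. s \<in> S) (at z)" using eventually_at_in_open'[OF S] .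
  have "int (order z p) = zorder (poly p) z" by (rule zorder_poly[OF p(1), symmetric])
  also have "\<dots> = zorder (\<lambda>s. w s * h s) z"
    by (rule zorder_cong) (use inS p(2) in \<open>auto elim: eventually_mono\<close>)
  also have "\<dots> = zorder w z + zorder h z"
    by (rule zorder_times_analytic[OF aw ah]) (use inS nz p(2) in \<open>auto elim: eventually_elim2\<close>)
  also have "zorder w z = 0" by (rule zorder_eq_0I[OF aw w(2)])
  finally show ?thesis by simp
qed

text \<open>The divisor is given by the functions \<open>\<omega> i (ptan (z, q))\<close>, where \<open>p, q\<close> span a line on which the
  degree is attained. Let \<open>n\<close> be its degree. The glued form has degree \<open>n\<close> in \<open>z\<close> and \<open>k\<close> in \<open>v\<close>, so
  \<open>n + k\<close> in total, and \<open>n = d + k\<close> is found by counting zeros on the line: if \<open>\<Phi>\<close> and \<open>\<Psi>\<close> are the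
  restrictions of the form in the coordinates at \<open>p\<close> and at \<open>q\<close>, then \<open>\<Psi>\<close> is, up to sign, \<open>s\<^sup>n\<^sup>-\<^sup>k \<Phi>(1/s)\<close>.
  The tangency points in the coordinate \<open>t\<close> contribute the degree of \<open>\<Phi>\<close> and the point at infinity
  the order of \<open>\<Psi>\<close> at zero; these add up to \<open>n - k\<close>.
  
  The vector \<open>q\<close> is retained in the conclusion because \<open>F z q\<close> is a single nonzero polynomial whose
  nonvanishing locus is dense.\<close>

lemma web_polynomial_form:
  fixes U :: "'i \<Rightarrow> 'n::finite proj set" and \<omega> :: "'i \<Rightarrow> 'n ptangent \<Rightarrow> complex"
  assumes web: "is_web k U \<omega>" and deg: "web_degree U \<omega> d"
  obtains F u q N where
    "\<And>z v. z \<noteq> 0 \<Longrightarrow> polyfun (d + 2 * k) (\<lambda>x. F (vmat x *v z) (vmat x *v v))"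
    "\<And>i z v. z \<noteq> 0 \<Longrightarrow> ppt z \<in> U i \<Longrightarrow> F z v = u i z * \<omega> i (ptan (z, v))"
    "\<And>i z. z \<noteq> 0 \<Longrightarrow> ppt z \<in> U i \<Longrightarrow> u i z \<noteq> 0"
    "\<And>i. holo_on {z. z \<noteq> 0 \<and> ppt z \<in> U i} (u i)"
    "\<And>i c z. z \<noteq> 0 \<Longrightarrow> ppt z \<in> U i \<Longrightarrow> c \<noteq> 0 \<Longrightarrow> u i (c *s z) = c ^ (d + 2 * k) * u i z"
    "polyfun N (\<lambda>z. F z q)" "\<exists>z. z \<noteq> 0 \<and> F z q \<noteq> 0"
proof -
  have openU: "open (U i)" and coverU: "\<exists>i. x \<in> U i" and formU: "proj_sym_form k (U i) (\<omega> i)"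
    and um: "unit_multiple (U i \<inter> U j) (\<omega> i) (\<omega> j)" for i j x
    using web unfolding is_web_def by auto
  define V where "V = (\<lambda>i. {z :: complex ^ ('n option). z \<noteq> 0 \<and> ppt z \<in> U i})"
  have "\<forall>i j. \<exists>g. holo_fun (U i \<inter> U j) g \<and> (\<forall>x\<in>U i \<inter> U j. g x \<noteq> 0) \<and>
        (\<forall>\<tau>. base_point \<tau> \<in> U i \<inter> U j \<longrightarrow> \<omega> i \<tau> = g (base_point \<tau>) * \<omega> j \<tau>)"
    using um unfolding unit_multiple_def by blast
  then obtain gg where gg: "\<And>i j. holo_fun (U i \<inter> U j) (gg i j)" "\<And>i j x. x \<in> U i \<inter> U j \<Longrightarrow> gg i j x \<noteq> 0"
    "\<And>i j \<tau>. base_point \<tau> \<in> U i \<inter> U j \<Longrightarrow> \<omega> i \<tau> = gg i j (base_point \<tau>) * \<omega> j \<tau>"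
    by metis
  define g where "g = (\<lambda>i j z. gg i j (ppt z))"
  have trans: "\<omega> i (ptan (z, v)) = g i j z * \<omega> j (ptan (z, v))" if "z \<in> V i" "z \<in> V j" for i j z v
    using gg(3)[of "ptan (z, v)" i j] that by (simp add: V_def g_def base_point_ptan)
  have openV: "open (V i)" for i unfolding V_def by (rule open_proj_preimage[OF openU])
  have holo\<omega>: "holo_on (V i) (\<lambda>z. \<omega> i (ptan (z, v)))" for i v
    unfolding V_def by (rule sym_form_homogeneous_coordinates(3)[OF formU openU])
  have poly\<omega>: "polyfun k (\<lambda>v. \<omega> i (ptan (z, v)))" if "z \<in> V i" for i z
    using sym_form_homogeneous_coordinates(1)[OF formU openU] that by (simp add: V_def)
  have hom\<omega>: "\<omega> i (ptan (z, c *s v)) = c ^ k * \<omega> i (ptan (z, v))" if "z \<in> V i" for i z v c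
    using sym_form_homogeneous_coordinates(2)[OF formU openU] that by (simp add: V_def)
  have coneV: "c *s z \<in> V i" if "z \<in> V i" "c \<noteq> 0" for c z i
    using that ppt_smult[of z c] by (simp add: V_def)
  have scale\<omega>: "\<omega> i (ptan (c *s z, v)) = (1 / c) ^ k * \<omega> i (ptan (z, v))" if z: "z \<in> V i" and c: "c \<noteq> 0" for i z v c
  proof -
    have z0: "z \<noteq> 0" "c *s z \<noteq> 0" using z c by (auto simp: V_def)
    have "v = c *s ((1 / c) *s v) + 0 *s z" using c by (simp add: vector_smult_assoc)
    then have "ptan (z, (1 / c) *s v) = ptan (c *s z, v)"
      using ptan_eq_iff[OF z0, of "(1 / c) *s v" v] c by blast
    then show ?thesis using hom\<omega>[OF z, of "1 / c" v] by simp
  qed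
  have shift\<omega>: "ptan (z, v + \<mu> *s z) = ptan (z, v)" if "z \<noteq> 0" for z v :: "complex ^ ('n option)" and \<mu>
  proof -
    have "v + \<mu> *s z = 1 *s v + \<mu> *s z" "z = 1 *s z" by auto
    then show ?thesis using ptan_eq_iff[OF that that, of v "v + \<mu> *s z"] by (metis zero_neq_one)
  qed
  have "line_pairs \<noteq> ({} :: (complex ^ ('n option + 'n option)) set)"
  proof -
    obtain j :: 'n where True by simp
    define w :: "complex ^ ('n option + 'n option)" where
      "w = (\<chi> s. case s of Inl i \<Rightarrow> axis None 1 $ i | Inr i \<Rightarrow> axis (Some j) 1 $ i)"
    have "a = 0 \<and> b = 0" if "a *s (\<chi> i. w $ Inl i) + b *s (\<chi> i. w $ Inr i) = 0" for a b
    proof -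
      have eqs: "(a *s (\<chi> i. w $ Inl i) + b *s (\<chi> i. w $ Inr i)) $ i = 0" for i using that by simp
      from eqs[of None] eqs[of "Some j"] show ?thesis by (simp add: w_def axis_def)
    qed
    then have "w \<in> line_pairs" unfolding line_pairs_def by blast
    then show ?thesis by blast
  qed
  then obtain w where w: "w \<in> line_pairs" "tangency_degree U \<omega> (\<chi> i. w $ Inl i) (\<chi> i. w $ Inr i) d"
    using deg unfolding web_degree_def generically_def
    by (metis (no_types, lifting) closure_empty equals0I subset_empty Diff_iff)
  define p q where "p = (\<chi> i. w $ Inl i)" and "q = (\<chi> i. w $ Inr i)"
  have indep: "a = 0 \<and> b = 0" if "a *s p + b *s q = 0" for a b
    using w(1) that unfolding line_pairs_def p_def q_def by blast
  have td: "tangency_degree U \<omega> p q d" using w(2) by (simp add: p_def q_def)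
  have pq: "p + t *s q \<noteq> 0" "q + t *s p \<noteq> 0" for t
    using indep[of 1 t] indep[of t 1] by (auto simp: add.commute)
  have fin: "finite (tangency_points U \<omega> p q)" using td unfolding tangency_degree_def by blast
  obtain t0 where t0: "t0 \<notin> tangency_points U \<omega> p q"
    using ex_new_if_finite[OF infinite_UNIV_char_0 fin] by blast
  define e where "e = p + t0 *s q"
  have e0: "e \<noteq> 0" using pq by (simp add: e_def)
  obtain i0 where i0: "ppt e \<in> U i0" using coverU by blast
  have enz: "\<omega> i0 (ptan (e, q)) \<noteq> 0"
    using t0 i0 unfolding tangency_points_def line_restriction_def e_def by blast
  interpret cone_divisor V "\<lambda>i z. \<omega> i (ptan (z, q))" g "\<lambda>c. (1 / c) ^ k" e
  proof
    show "2 \<le> CARD('n option)" by (simp add: card_UNIV_option Suc_le_eq)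
    show "open (V i)" for i by (rule openV)
    show "z \<noteq> 0" if "z \<in> V i" for z i using that by (simp add: V_def)
    show "\<exists>i. z \<in> V i" if "z \<noteq> 0" for z using coverU[of "ppt z"] that by (auto simp: V_def)
    show "c *s z \<in> V i" if "z \<in> V i" "c \<noteq> 0" for c z i by (rule coneV[OF that])
    show "holo_on (V i) (\<lambda>z. \<omega> i (ptan (z, q)))" for i by (rule holo\<omega>)
    show "\<omega> i (ptan (z, q)) = g i j z * \<omega> j (ptan (z, q))" if "z \<in> V i" "z \<in> V j" for z i j by (rule trans[OF that])
    show "g i j z \<noteq> 0" if "z \<in> V i" "z \<in> V j" for z i j using gg(2) that by (simp add: g_def V_def)
    show "holo_on (V i \<inter> V j) (g i j)" for i j
    proof -
      have "V i \<inter> V j = {z. z \<noteq> 0 \<and> ppt z \<in> U i \<inter> U j}" by (auto simp: V_def)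
      then show ?thesis using holo_on_holo_fun[OF gg(1)[of i j]] openU by (simp add: g_def open_Int)
    qed
    show "\<omega> i (ptan (c *s z, q)) = (1 / c) ^ k * \<omega> i (ptan (z, q))" if "z \<in> V i" "c \<noteq> 0" for c z i
      by (rule scale\<omega>[OF that])
    show "\<exists>i. e \<in> V i \<and> \<omega> i (ptan (e, q)) \<noteq> 0" using i0 e0 enz by (auto simp: V_def)
  qed simp
  define n where "n = degree_of_divisor"
  define S where "S = (\<lambda>v. glue (\<lambda>i z. \<omega> i (ptan (z, v))))"
  have S: "S v z = unit_factor i z * \<omega> i (ptan (z, v))" if "z \<in> V i" for v z i
    unfolding S_def by (rule glue_eq[OF trans that])
  have holoS: "holo_on (- {0}) (S v)" for v unfolding S_def by (rule holo_on_glue[OF trans holo\<omega>])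
  have homS: "S v (c *s z) = c ^ n * S v z" if "c \<noteq> 0" "z \<noteq> 0" for v c z
    unfolding S_def n_def by (rule glue_smult[OF trans scale\<omega> that])
  have "\<forall>v. \<exists>p. polyfun n p \<and> (\<forall>z. z \<noteq> 0 \<longrightarrow> S v z = p z) \<and> (\<forall>c z. c \<noteq> 0 \<longrightarrow> p (c *s z) = c ^ n * p z)"
    by (intro allI holo_on_homogeneous_polynomial[OF card_ge holoS homS])
  from choice[OF this] obtain P where P: "\<And>v. polyfun n (P v)" "\<And>v z. z \<noteq> 0 \<Longrightarrow> S v z = P v z" by blast
  obtain R pt and L :: "('n option \<Rightarrow> nat) \<Rightarrow> complex ^ ('n option) \<Rightarrow> complex" where L: "finite R" "\<And>r. \<exists>n. polyfun n (L r)"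
    "\<And>f v. polyfun k f \<Longrightarrow> f v = (\<Sum>r\<in>R. f (pt r) * L r v)"
    using polyfun_interpolation[where 'a = "'n option" and k = k] by blast
  define F where "F = (\<lambda>z v. \<Sum>r\<in>R. P (pt r) z * L r v)"
  have FS: "F z v = S v z" if z: "z \<noteq> 0" for z v
  proof -
    obtain i where i: "z \<in> V i" using cover[OF z] by blast
    have "polyfun k (\<lambda>v. S v z)" unfolding S[OF i] by (intro polyfun_cmult poly\<omega>[OF i])
    from L(3)[OF this, of v] show ?thesis by (simp add: F_def P(2)[OF z])
  qed
  have Feq: "F z v = unit_factor i z * \<omega> i (ptan (z, v))" if "z \<in> V i" for i z v
    using FS[OF V_nonzero[OF that]] S[OF that] by simp
  have Fhom: "F (c *s z) (c *s v) = c ^ (n + k) * F z v" if c: "c \<noteq> 0" and z: "z \<noteq> 0" for c z v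
  proof -
    obtain i where i: "z \<in> V i" using cover[OF z] by blast
    have "F (c *s z) (c *s v) = S (c *s v) (c *s z)" by (rule FS) (use c z in auto)
    also have "\<dots> = c ^ n * S (c *s v) z" by (rule homS[OF c z])
    also have "\<dots> = c ^ n * (c ^ k * S v z)" by (simp add: S[OF i] hom\<omega>[OF i])
    finally show ?thesis using FS[OF z] by (simp add: power_add)
  qed
  have Fpoly: "\<exists>N. polyfun N (\<lambda>x. F (vmat x *v z) (vmat x *v v))" for z v
  proof -
    have "\<exists>N. polyfun N (\<lambda>x. P (pt r) (vmat x *v z) * L r (vmat x *v v))" for r
    proof -
      obtain m where "polyfun m (L r)" using L(2) by blast
      then have "polyfun (m * 1) (\<lambda>x. L r (vmat x *v v))" by (rule polyfun_compose[OF _ polyfun_vmat_vector])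
      moreover have "polyfun (n * 1) (\<lambda>x. P (pt r) (vmat x *v z))" by (rule polyfun_compose[OF P(1) polyfun_vmat_vector])
      ultimately show ?thesis using polyfun_mult by blast
    qed
    then show ?thesis unfolding F_def by (intro polyfun_ex_sum L(1))
  qed
  have Fdeg: "polyfun (n + k) (\<lambda>x. F (vmat x *v z) (vmat x *v v))" if z: "z \<noteq> 0" for z v
  proof -
    obtain N where N: "polyfun N (\<lambda>x. F (vmat x *v z) (vmat x *v v))" using Fpoly by blast
    show ?thesis
    proof (rule polyfun_homogeneous_degree[OF N])
      fix c :: complex and x :: "complex ^ ('n option \<times> 'n option)" assume c: "c \<noteq> 0"
      define h where "h = (\<lambda>x. F (vmat x *v z) (vmat x *v v))"
      have "polyfun 1 (\<lambda>x :: complex ^ ('n option \<times> 'n option). (c *s x) $ i)" for i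
        using polyfun_cmult[OF polyfun_nth[of 0 i], of c] by simp
      from polyfun_compose[OF N this] have "polyfun N (\<lambda>x. h (c *s x))" by (simp add: h_def)
      then have hp: "polyfun N (\<lambda>x. h (c *s x) + (- (c ^ (n + k))) * h x)"
        using N by (intro polyfun_add polyfun_cmult) (simp_all add: h_def)
      let ?O = "{x :: complex ^ ('n option \<times> 'n option). vmat x *v z \<noteq> 0}"
      have "open ?O"
      proof -
        have "?O = (\<Union>i. {x. (vmat x *v z) $ i \<noteq> 0})" by (auto simp: vec_eq_iff)
        moreover have "open {x. (vmat x *v z) $ i \<noteq> 0}" for i
          by (intro open_Collect_neq holo_on_imp_continuous_on[OF holo_on_polyfun[OF polyfun_vmat_vector]] continuous_intros)
        ultimately show ?thesis by auto
      qed
      moreover have "?O \<noteq> {}"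
      proof -
        obtain x where "vmat x = (mat 1 :: complex ^ ('n option) ^ ('n option))" using exists_vmat by blast
        then have "x \<in> ?O" using z by simp
        then show ?thesis by blast
      qed
      moreover have "h (c *s x) + (- (c ^ (n + k))) * h x = 0" if "x \<in> ?O" for x
        using Fhom[OF c, of "vmat x *v z" "vmat x *v v"] that by (simp add: h_def vmat_smult_vector)
      ultimately have "h (c *s x) + (- (c ^ (n + k))) * h x = 0" by (rule polyfun_zero_on_open[OF hp])
      then show "F (vmat (c *s x) *v z) (vmat (c *s x) *v v) = c ^ (n + k) * F (vmat x *v z) (vmat x *v v)"
        by (simp add: h_def)
    qed
  qed
  have Fz: "\<exists>N. polyfun N (\<lambda>z. F z v)" for v
    unfolding F_def by (intro polyfun_ex_sum L(1) polyfun_ex_mult) (use P(1) polyfun_const in blast)+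
  have "n = d + k"
  proof -
    obtain N1 where N1: "polyfun N1 (\<lambda>z. F z q)" using Fz by blast
    obtain N2 where N2: "polyfun N2 (\<lambda>z. F z p)" using Fz by blast
    obtain \<Phi> where \<Phi>: "\<And>t. F (p + t *s q) q = poly \<Phi> t" using polyfun_line[OF N1, of p q] by blast
    obtain \<Psi> where \<Psi>: "\<And>t. F (q + t *s p) p = poly \<Psi> t" using polyfun_line[OF N2, of q p] by blast
    have zorder_line: "zorder (line_restriction (\<omega> i) a b) t = int (order t \<Theta>)"
      if ab: "\<And>t. a + t *s b \<noteq> 0" "\<And>t. F (a + t *s b) b = poly \<Theta> t" "\<Theta> \<noteq> 0" and i: "ppt (a + t *s b) \<in> U i"
      for a b t \<Theta> i
    proof (rule zorder_unit_multiple)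
      let ?S = "{s. a + s *s b \<in> V i}"
      show "open ?S" by (rule open_line_preimage[OF openV])
      show "t \<in> ?S" using i ab(1) by (simp add: V_def)
      then show "unit_factor i (a + t *s b) \<noteq> 0" using unit_factor_nonzero by blast
      show "(\<lambda>s. unit_factor i (a + s *s b)) holomorphic_on ?S"
        by (rule holo_on_compose_line_holomorphic[OF holo_on_unit_factor]) simp
      show "line_restriction (\<omega> i) a b holomorphic_on ?S"
        unfolding line_restriction_def[abs_def]
        by (rule holo_on_compose_line_holomorphic[OF holo\<omega>]) simp
      show "\<Theta> \<noteq> 0" by (rule ab(3))
      show "poly \<Theta> s = unit_factor i (a + s *s b) * line_restriction (\<omega> i) a b s" if "s \<in> ?S" for s
        using Feq[of "a + s *s b" i b] that by (simp add: ab(2) line_restriction_def)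
    qed
    have tp: "tangency_points U \<omega> p q = {t. poly \<Phi> t = 0}"
    proof -
      have "line_restriction (\<omega> i) p q t = 0 \<longleftrightarrow> poly \<Phi> t = 0" if "ppt (p + t *s q) \<in> U i" for t i
        using Feq[of "p + t *s q" i q] unit_factor_nonzero[of "p + t *s q" i] that pq(1)[of t]
        by (simp add: \<Phi> line_restriction_def V_def)
      then show ?thesis using coverU unfolding tangency_points_def by blast
    qed
    have \<Phi>0: "\<Phi> \<noteq> 0"
    proof
      assume "\<Phi> = 0"
      then have "t0 \<in> tangency_points U \<omega> p q" unfolding tp by simp
      then show False using t0 by blast
    qed
    have some: "ppt x \<in> U (SOME i. ppt x \<in> U i)" for x :: "complex ^ ('n option)"
      using coverU[of "ppt x"] by (rule someI_ex)
    have o1: "tangency_order U \<omega> p q t = int (order t \<Phi>)" for t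
      unfolding tangency_order_def by (rule zorder_line[OF pq(1) \<Phi> \<Phi>0 some])
    have rel: "s ^ (k + degree \<Phi>) * poly \<Psi> s = (- 1) ^ k * s ^ n * poly (reflect_poly \<Phi>) s" if s: "s \<noteq> 0" for s
    proof -
      define y where "y = p + (1 / s) *s q"
      have y0: "y \<noteq> 0" using pq(1) by (simp add: y_def)
      obtain i where i: "y \<in> V i" using cover[OF y0] by blast
      have "q + s *s p = s *s y" using s by (simp add: y_def vec_eq_iff algebra_simps)
      then have "poly \<Psi> s = S p (s *s y)" using \<Psi>[of s] FS[OF pq(2)[of s], of p] by simp
      also have "\<dots> = s ^ n * S p y" by (rule homS[OF s y0])
      also have "p = (- 1 / s) *s q + 1 *s y" by (simp add: y_def vec_eq_iff)
      also have "S ((- 1 / s) *s q + 1 *s y) y = S ((- 1 / s) *s q) y" unfolding S[OF i] shift\<omega>[OF y0] ..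
      also have "\<dots> = (- 1 / s) ^ k * S q y" unfolding S[OF i] hom\<omega>[OF i] by simp
      also have "S q y = poly \<Phi> (inverse s)"
        using FS[OF y0, of q] \<Phi>[of "1 / s"] by (simp add: y_def inverse_eq_divide)
      finally have "poly \<Psi> s = s ^ n * ((- 1 / s) ^ k * poly \<Phi> (inverse s))" .
      moreover have "s ^ k * (- 1 / s) ^ k = (- 1) ^ k" using s by (simp flip: power_mult_distrib)
      ultimately have "s ^ k * poly \<Psi> s = (- 1) ^ k * (s ^ n * poly \<Phi> (inverse s))" by (simp add: algebra_simps)
      then have "s ^ degree \<Phi> * (s ^ k * poly \<Psi> s) = s ^ degree \<Phi> * ((- 1) ^ k * (s ^ n * poly \<Phi> (inverse s)))" by simp
      then show ?thesis using poly_reflect_poly_nz[OF s, of \<Phi>] by (simp add: power_add mult_ac)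
    qed
    \<comment> \<open>The relation between \<open>\<Phi>\<close> and \<open>\<Psi>\<close>, multiplied by powers of \<open>s\<close> to become an identity of polynomials.\<close>
    define X where "X = monom 1 (k + degree \<Phi>) * \<Psi>"
    define Y where "Y = smult ((- 1) ^ k) (monom 1 n * reflect_poly \<Phi>)"
    have "X = Y"
    proof -
      have "poly (X - Y) s = 0" if "s \<noteq> 0" for s
        using rel[OF that] by (simp add: X_def Y_def poly_monom)
      then have "- {0} \<subseteq> {s. poly (X - Y) s = 0}" by auto
      moreover have "infinite (- {0::complex})" by (simp add: infinite_UNIV_char_0)
      ultimately have "X - Y = 0" using poly_roots_finite finite_subset by blast
      then show ?thesis by simp
    qed
    have monom0: "order 0 (monom (1::complex) m) = m" for m
      using order_power_n_n[of "0::complex" m] by (simp add: monom_altdef)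
    have Y0: "Y \<noteq> 0" using \<Phi>0 by (simp add: Y_def)
    then have \<Psi>0: "\<Psi> \<noteq> 0" using \<open>X = Y\<close> by (auto simp: X_def)
    have "order 0 X = (k + degree \<Phi>) + order 0 \<Psi>"
      unfolding X_def using \<Psi>0 by (subst order_mult) (auto simp: monom0)
    moreover have "order 0 Y = n"
    proof -
      have "order 0 (reflect_poly \<Phi>) = 0" by (rule order_0I) (use \<Phi>0 in simp)
      then show ?thesis
        unfolding Y_def using \<Phi>0 by (simp add: order_smult order_mult monom0)
    qed
    ultimately have ord: "n = k + degree \<Phi> + order 0 \<Psi>" using \<open>X = Y\<close> by simp
    have "int d = (\<Sum>t | poly \<Phi> t = 0. int (order t \<Phi>)) + tangency_order U \<omega> q p 0"
      using td unfolding tangency_degree_def tp o1 by blast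
    also have "(\<Sum>t | poly \<Phi> t = 0. int (order t \<Phi>)) = int (degree \<Phi>)"
      using degree_eq_sum_order[OF \<Phi>0] by (simp flip: of_nat_sum)
    also have "tangency_order U \<omega> q p 0 = int (order 0 \<Psi>)"
      unfolding tangency_order_def by (rule zorder_line[OF pq(2) \<Psi> \<Psi>0 some])
    finally show ?thesis using ord by simp
  qed
  then have D: "n + k = d + 2 * k" by simp
  obtain N where N: "polyfun N (\<lambda>z. F z q)" using Fz by blast
  show ?thesis
  proof (rule that[of F unit_factor N q])
    show "polyfun (d + 2 * k) (\<lambda>x. F (vmat x *v z) (vmat x *v v))" if "z \<noteq> 0" for z v
      using Fdeg[OF that] D by simp
    show "F z v = unit_factor i z * \<omega> i (ptan (z, v))" if "z \<noteq> 0" "ppt z \<in> U i" for i z v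
      using Feq that by (simp add: V_def)
    show "unit_factor i z \<noteq> 0" if "z \<noteq> 0" "ppt z \<in> U i" for i z
      using unit_factor_nonzero that by (simp add: V_def)
    show "holo_on {z. z \<noteq> 0 \<and> ppt z \<in> U i} (unit_factor i)" for i
      using holo_on_unit_factor[of i] by (simp add: V_def)
    show "unit_factor i (c *s z) = c ^ (d + 2 * k) * unit_factor i z" if "z \<noteq> 0" "ppt z \<in> U i" "c \<noteq> 0" for i c z
    proof -
      have "unit_factor i (c *s z) * (1 / c) ^ k = c ^ n * unit_factor i z"
        using unit_factor_smult[of z i c] that by (simp add: V_def n_def)
      then have "unit_factor i (c *s z) * ((1 / c) ^ k * c ^ k) = c ^ n * c ^ k * unit_factor i z" by simp
      moreover have "(1 / c) ^ k * c ^ k = 1" using that by (simp flip: power_mult_distrib)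
      ultimately show ?thesis using D by (simp flip: power_add)
    qed
    show "polyfun N (\<lambda>z. F z q)" by (rule N)
    have "e \<in> V i0" using e0 i0 by (simp add: V_def)
    then have "F e q \<noteq> 0" using Feq unit_factor_nonzero enz by simp
    then show "\<exists>z. z \<noteq> 0 \<and> F z q \<noteq> 0" using e0 by blast
  qed
qed

section \<open>Matrices that preserve a form\<close>

lemma polyfun_0_constant:
  assumes "polyfun 0 f" shows "f x = f y"
proof -
  obtain p where p: "degree p \<le> 0" "\<And>t. f (x + t *s (y - x)) = poly p t" using polyfun_line[OF assms] by blast
  then obtain c where "p = [:c:]" using degree_eq_zeroE by blast
  then show ?thesis using p(2)[of 0] p(2)[of 1] by simp
qed

text \<open>The exponential series, through the two properties of \<open>t \<mapsto> exp (t X)\<close> that are needed.\<close>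

lemma matrix_exponential:
  fixes X :: "complex ^ 'm::finite ^ 'm"
  obtains E where "E 0 = mat 1"
    "\<And>t i j. ((\<lambda>t. E t $ i $ j) has_field_derivative (X ** E t) $ i $ j) (at t)"
proof -
  define pw where "pw = (\<lambda>n z. ((\<lambda>v. X *v v) ^^ n) z)"
  have lin: "bounded_linear (\<lambda>v. X *v v)"
  proof (rule linear_conv_bounded_linear[THEN iffD1], rule linearI)
    show "X *v (x + y) = X *v x + X *v y" for x y by (rule matrix_vector_right_distrib)
    have "r *\<^sub>R y = complex_of_real r *s y" for r and y :: "complex ^ 'm"
      unfolding vec_eq_iff vector_scaleR_component vector_smult_component by (simp add: scaleR_conv_of_real)
    then show "X *v (r *\<^sub>R x) = r *\<^sub>R (X *v x)" for r x by (simp only: matrix_vector_smult)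
  qed
  obtain K where K: "K > 0" "\<And>v. norm (X *v v) \<le> norm v * K" using bounded_linear.pos_bounded[OF lin] by blast
  have pwK: "norm (pw n z) \<le> K ^ n * norm z" for n z
  proof (induction n)
    case (Suc n)
    have "norm (pw (Suc n) z) \<le> norm (pw n z) * K" using K(2) by (simp add: pw_def)
    also have "\<dots> \<le> K ^ n * norm z * K" using Suc K(1) by (intro mult_right_mono) auto
    finally show ?case by (simp add: mult_ac)
  qed (simp add: pw_def)
  define a where "a = (\<lambda>i j n. pw n (axis j 1) $ i / fact n)"
  have summ: "summable (\<lambda>n. a i j n * t ^ n)" for i j t
  proof (rule summable_comparison_test')
    show "summable (\<lambda>n. inverse (fact n) * (K * norm t) ^ n)" by (rule summable_exp)
    fix n :: nat
    have "norm (pw n (axis j 1) $ i) \<le> K ^ n"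
      using order_trans[OF Finite_Cartesian_Product.norm_nth_le pwK[of n "axis j 1"]] by (simp add: norm_axis_1)
    then have "norm (pw n (axis j 1) $ i) / fact n * norm t ^ n \<le> K ^ n / fact n * norm t ^ n"
      by (intro mult_right_mono divide_right_mono) auto
    then show "norm (a i j n * t ^ n) \<le> inverse (fact n) * (K * norm t) ^ n"
    proof -
      have "norm (a i j n * t ^ n) = norm (pw n (axis j 1) $ i) / fact n * norm t ^ n"
        by (simp add: a_def norm_mult norm_divide norm_power)
      moreover have "inverse (fact n) * (K * norm t) ^ n = K ^ n / fact n * norm t ^ n"
        by (simp add: power_mult_distrib divide_inverse)
      ultimately show ?thesis using \<open>norm (pw n (axis j 1) $ i) / fact n * norm t ^ n \<le> K ^ n / fact n * norm t ^ n\<close> by simp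
    qed
  qed
  define E where "E = (\<lambda>t. \<chi> i j. \<Sum>n. a i j n * t ^ n)"
  have E: "E t $ i $ j = (\<Sum>n. a i j n * t ^ n)" for t i j by (simp add: E_def)
  show ?thesis
  proof (rule that[of E])
    have "E 0 $ i $ j = a i j 0" for i j by (simp only: E powser_zero)
    then have "E 0 $ i $ j = mat 1 $ i $ j" for i j
      by (simp add: a_def pw_def axis_def mat_def)
    then show "E 0 = mat 1" by (simp add: vec_eq_iff)
    fix t i j
    have da: "diffs (a i j) n = (\<Sum>l\<in>UNIV. X $ i $ l * a l j n)" for n
    proof -
      have "diffs (a i j) n = pw (Suc n) (axis j 1) $ i / fact n"
        by (simp add: diffs_def a_def fact_Suc del: of_nat_Suc)
      also have "\<dots> = (\<Sum>l\<in>UNIV. X $ i $ l * pw n (axis j 1) $ l) / fact n"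
        by (simp add: pw_def matrix_vector_mult_def)
      finally show ?thesis by (simp add: a_def sum_divide_distrib)
    qed
    have "((\<lambda>t. \<Sum>n. a i j n * t ^ n) has_field_derivative (\<Sum>n. diffs (a i j) n * t ^ n)) (at t)"
      by (rule termdiffs_strong_converges_everywhere[OF summ])
    moreover have "(\<Sum>n. diffs (a i j) n * t ^ n) = (X ** E t) $ i $ j"
    proof -
      have "(\<Sum>n. diffs (a i j) n * t ^ n) = (\<Sum>n. \<Sum>l\<in>UNIV. X $ i $ l * (a l j n * t ^ n))"
        by (simp add: da sum_distrib_right mult.assoc)
      also have "\<dots> = (\<Sum>l\<in>UNIV. \<Sum>n. X $ i $ l * (a l j n * t ^ n))"
        by (rule suminf_sum) (intro summable_mult summ)
      also have "\<dots> = (\<Sum>l\<in>UNIV. X $ i $ l * E t $ l $ j)"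
        by (simp add: E suminf_mult[OF summ])
      finally show ?thesis by (simp add: matrix_matrix_mult_def)
    qed
    ultimately show "((\<lambda>t. E t $ i $ j) has_field_derivative (X ** E t) $ i $ j) (at t)" by (simp add: E)
  qed
qed

text \<open>Each further functional that does not vanish on the common kernel of the previous ones lowers its
  dimension.\<close>

lemma exists_separating_subfamily:
  fixes \<Lambda> :: "'j \<Rightarrow> complex ^ 'q::finite \<Rightarrow> complex"
  assumes add: "\<And>j x y. \<Lambda> j (x + y) = \<Lambda> j x + \<Lambda> j y" and smult: "\<And>j c x. \<Lambda> j (c *s x) = c * \<Lambda> j x"
    and ker: "\<And>x. (\<And>j. \<Lambda> j x = 0) \<Longrightarrow> x = 0"
  obtains J :: "'q \<Rightarrow> 'j" where "\<And>x. (\<And>i. \<Lambda> (J i) x = 0) \<Longrightarrow> x = 0"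
proof -
  define K where "K = (\<lambda>js. {x. \<forall>j\<in>set js. \<Lambda> j x = 0})"
  have zero: "\<Lambda> j 0 = 0" for j using smult[of j 0 0] by simp
  have sub: "vec.subspace (K js)" for js
    by (rule vec.subspaceI) (auto simp: K_def add smult zero)
  have "\<exists>js. length js = n \<and> vec.dim (K js) \<le> CARD('q) - n" for n
  proof (induction n)
    case 0
    have "vec.dim (K []) \<le> CARD('q)"
      by (rule dim_subset_UNIV_cart_gen)
    then show ?case by auto
  next
    case (Suc n)
    then obtain js where js: "length js = n" "vec.dim (K js) \<le> CARD('q) - n" by blast
    show ?case
    proof (cases "K js \<subseteq> {0}")
      case True
      then have "vec.dim (K (undefined # js)) = 0" by (subst vec.dim_eq_0) (auto simp: K_def)
      then show ?thesis using js(1) by (metis length_Cons zero_le)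
    next
      case False
      then obtain x where x: "x \<in> K js" "x \<noteq> 0" by blast
      then obtain j where j: "\<Lambda> j x \<noteq> 0" using ker by blast
      have "K (j # js) \<subset> K js" using x j by (auto simp: K_def)
      then have "vec.span (K (j # js)) \<subset> vec.span (K js)"
        using sub by (simp add: vec.span_eq_iff[THEN iffD2])
      then have "vec.dim (K (j # js)) < vec.dim (K js)" by (rule vec.dim_psubset)
      then show ?thesis using js by (intro exI[of _ "j # js"]) auto
    qed
  qed
  then obtain js where js: "length js = CARD('q)" "vec.dim (K js) \<le> 0" by (metis diff_self_eq_0)
  then have K0: "K js \<subseteq> {0}" using vec.dim_eq_0 by blast
  obtain h :: "'q \<Rightarrow> nat" where h: "bij_betw h UNIV {0..<CARD('q)}" using ex_bij_betw_finite_nat[of "UNIV :: 'q set"] by auto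
  show ?thesis
  proof (rule that[of "\<lambda>i. js ! h i"])
    fix x assume x: "\<And>i. \<Lambda> (js ! h i) x = 0"
    have "\<Lambda> j x = 0" if j: "j \<in> set js" for j
    proof -
      obtain m where m: "m < length js" "j = js ! m" using j by (metis in_set_conv_nth)
      have "m \<in> h ` UNIV" using h js(1) m(1) by (simp add: bij_betw_def)
      then obtain i where "h i = m" by blast
      then show ?thesis using x[of i] m by simp
    qed
    then show "x = 0" using K0 by (auto simp: K_def)
  qed
qed

lemma open_image_of_nondegenerate:
  fixes \<Phi> :: "complex ^ 'q::finite \<Rightarrow> complex ^ 'q"
  assumes hol: "\<And>i. holo_on UNIV (\<lambda>x. \<Phi> x $ i)"
    and D: "\<And>i. ((\<lambda>x. \<Phi> x $ i) has_derivative D i) (at x0)"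
    and inj: "\<And>x. (\<And>i. D i x = 0) \<Longrightarrow> x = 0"
    and T: "open T" "x0 \<in> T"
  shows "\<Phi> x0 \<in> interior (\<Phi> ` T)"
proof -
  define D' where "D' = (\<lambda>v. \<Sum>i\<in>UNIV. D i v *s axis i (1::complex))"
  have D'i: "D' v $ i = D i v" for v i
    by (simp add: D'_def axis_def if_distrib[of "\<lambda>y. _ * y"] cong: if_cong)
  have "((\<lambda>x. \<Sum>i\<in>UNIV. \<Phi> x $ i *s axis i 1) has_derivative D') (at x0)"
    unfolding D'_def by (intro has_derivative_sum bounded_linear.has_derivative[OF bounded_linear_smult_left] D)
  then have der: "(\<Phi> has_derivative D') (at x0)" by (simp add: basis_expansion)
  have lin: "linear D'" using has_derivative_linear[OF der] .
  have "inj D'"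
    unfolding linear_injective_0[OF lin] using inj D'i by (metis zero_index)
  then obtain g where g: "linear g" "\<And>x. D' (g x) = x"
    using linear_injective_isomorphism[OF lin] by blast
  have "continuous_on UNIV (\<lambda>x. \<chi> i. \<Phi> x $ i)"
    by (intro continuous_on_vec_lambda holo_on_imp_continuous_on[OF hol])
  then have cont: "continuous_on UNIV \<Phi>" by simp
  show ?thesis
    by (rule sussmann_open_mapping[OF open_UNIV cont UNIV_I der, of g])
       (use g T in \<open>auto simp: linear_conv_bounded_linear o_def id_def interior_open\<close>)
qed

lemma vmat_has_derivative_direction:
  fixes h :: "complex ^ ('m::finite \<times> 'm) \<Rightarrow> complex"
  assumes h: "(h has_derivative Dh) (at x)" and lin: "\<And>c v. Dh (c *s v) = c * Dh v"
  shows "deriv (\<lambda>s. h (x + s *s y)) 0 = Dh y"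
proof -
  have "((\<lambda>t. x + t *s y) has_derivative (\<lambda>h. h *s y)) (at (0::complex))"
    by (auto intro!: derivative_eq_intros bounded_linear.has_derivative[OF bounded_linear_smult_left])
  moreover have "(h has_derivative Dh) (at (x + 0 *s y))" using h by simp
  ultimately have "(h \<circ> (\<lambda>t. x + t *s y) has_derivative Dh \<circ> (\<lambda>h. h *s y)) (at 0)" by (rule diff_chain_at)
  then have "((\<lambda>s. h (x + s *s y)) has_field_derivative Dh y) (at 0)"
    by (simp add: o_def lin has_field_derivative_def mult_commute_abs)
  then show ?thesis by (rule DERIV_imp_deriv)
qed

lemma vmat_add_smult_vector: "vmat (x + s *s y) *v z = vmat x *v z + s *s (vmat y *v z)"
  by (simp add: vmat_def matrix_vector_mult_def vec_eq_iff sum_distrib_left distrib_right sum.distrib mult.assoc)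

text \<open>If \<open>X\<close> is an infinitesimal symmetry of \<open>F\<close>, then \<open>F\<close> is constant along the flow \<open>exp (t X)\<close>, so all
  matrices of this flow that are invertible near \<open>t = 0\<close> are symmetries. They are infinitely many
  because the derivative of the flow at zero is \<open>X \<noteq> 0\<close>.\<close>

lemma invariant_under_exponential:
  fixes F :: "complex ^ 'm::finite \<Rightarrow> complex ^ 'm \<Rightarrow> complex"
  assumes F: "\<And>z v. z \<noteq> 0 \<Longrightarrow> polyfun D (\<lambda>x. F (vmat x *v z) (vmat x *v v))"
    and X: "\<And>z v. z \<noteq> 0 \<Longrightarrow> deriv (\<lambda>s. F (z + s *s (X *v z)) (v + s *s (X *v v))) 0 = 0"
    and X0: "X \<noteq> 0"
  shows "infinite {A. invertible A \<and> (\<forall>z v. z \<noteq> 0 \<longrightarrow> F (A *v z) (A *v v) = F z v)}"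
proof -
  obtain E where E0: "E 0 = mat 1"
    and E: "\<And>t i j. ((\<lambda>t. E t $ i $ j) has_field_derivative (X ** E t) $ i $ j) (at t)"
    using matrix_exponential by blast
  have contE: "continuous_on S (\<lambda>t. E t $ i $ j)" for S i j
    using E DERIV_isCont continuous_at_imp_continuous_on by blast
  have "continuous_on UNIV (\<lambda>t. det (E t))"
    unfolding det_def by (intro continuous_intros contE)
  moreover have "det (E 0) \<noteq> 0" by (simp add: E0)
  ultimately have "eventually (\<lambda>t. det (E t) \<noteq> 0) (nhds 0)"
    using continuous_on_open_vimage[OF open_UNIV, of "\<lambda>t. det (E t)"]
    by (intro eventually_nhds_in_open[of "(\<lambda>t. det (E t)) -` (- {0})" 0, simplified]) (auto simp: open_Compl)
  then obtain r where r: "r > 0" "\<And>t. dist t 0 < r \<Longrightarrow> det (E t) \<noteq> 0" unfolding eventually_nhds_metric by blast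
  have inv: "invertible (E t)" if "t \<in> ball 0 r" for t
    using r(2)[of t] that by (simp add: invertible_det_nz dist_commute)
  define x where "x = (\<lambda>t. (\<chi> p. E t $ fst p $ snd p) :: complex ^ ('m \<times> 'm))"
  have vx: "vmat (x t) = E t" for t by (simp add: vmat_def x_def vec_eq_iff)
  define y where "y = (\<lambda>t. (\<chi> p. (X ** E t) $ fst p $ snd p) :: complex ^ ('m \<times> 'm))"
  have vy: "vmat (y t) = X ** E t" for t by (simp add: vmat_def y_def vec_eq_iff)
  have x': "(x has_derivative (\<lambda>c. c *s y t)) (at t)" for t
  proof -
    have "((\<lambda>t. \<Sum>p\<in>UNIV. (E t $ fst p $ snd p) *s axis p (1::complex)) has_derivative
        (\<lambda>c. \<Sum>p\<in>UNIV. (c * (X ** E t) $ fst p $ snd p) *s axis p (1::complex))) (at t)"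
      using E[unfolded has_field_derivative_def]
      by (intro has_derivative_sum bounded_linear.has_derivative[OF bounded_linear_smult_left])
         (simp add: mult_commute_abs)
    moreover have "(\<lambda>t. \<Sum>p\<in>UNIV. (E t $ fst p $ snd p) *s axis p (1::complex)) = x"
      by (rule ext) (simp add: vec_eq_iff x_def axis_def if_distrib[of "\<lambda>y. _ * y"] cong: if_cong)
    moreover have "(\<lambda>c. \<Sum>p\<in>UNIV. (c * (X ** E t) $ fst p $ snd p) *s axis p (1::complex)) = (\<lambda>c. c *s y t)"
      by (rule ext) (simp add: vec_eq_iff y_def axis_def if_distrib[of "\<lambda>y. _ * y"] cong: if_cong)
    ultimately show ?thesis by simp
  qed
  have "F (E t *v z) (E t *v v) = F z v" if t: "t \<in> ball 0 r" and z: "z \<noteq> 0" for t z v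
  proof -
    define h where "h = (\<lambda>x. F (vmat x *v z) (vmat x *v v))"
    have "((\<lambda>t. h (x t)) has_field_derivative 0) (at t)" if t: "t \<in> ball 0 r" for t
    proof -
      obtain Dh where Dh: "(h has_derivative Dh) (at (x t))" "\<And>c v. Dh (c *s v) = c * Dh v"
        using holo_on_polyfun[OF F[OF z, of v], of UNIV] unfolding holo_on_def h_def by blast
      have nz: "E t *v z \<noteq> 0" by (rule invertible_nonzero[OF inv[OF t] z])
      have "Dh (y t) = deriv (\<lambda>s. h (x t + s *s y t)) 0" by (rule vmat_has_derivative_direction[OF Dh, symmetric])
      also have "\<dots> = 0"
        using X[OF nz, of "E t *v v"]
        by (simp add: h_def vmat_add_smult_vector vx vy matrix_vector_mul_assoc[symmetric])
      finally have "Dh (y t) = 0" .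
      moreover have "(h \<circ> x has_derivative Dh \<circ> (\<lambda>c. c *s y t)) (at t)" by (rule diff_chain_at[OF x' Dh(1)])
      ultimately show ?thesis unfolding has_field_derivative_def lambda_zero[symmetric] by (simp add: o_def Dh(2))
    qed
    note zero = this
    have "\<exists>c. \<forall>t\<in>ball 0 r. h (x t) = c"
    proof (rule has_field_derivative_zero_constant)
      show "((\<lambda>t. h (x t)) has_field_derivative 0) (at t within ball 0 r)" if "t \<in> ball 0 r" for t
        by (rule has_field_derivative_at_within[OF zero[OF that]])
    qed simp
    then obtain c where c: "\<And>t. t \<in> ball 0 r \<Longrightarrow> h (x t) = c" by blast
    have "h (x t) = h (x 0)" using c[OF t] c[of 0] r(1) by simp
    then show ?thesis by (simp add: h_def vx E0)
  qed
  then have sub: "E ` ball 0 r \<subseteq> {A. invertible A \<and> (\<forall>z v. z \<noteq> 0 \<longrightarrow> F (A *v z) (A *v v) = F z v)}"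
    using inv by auto
  have "infinite (E ` ball 0 r)"
  proof
    assume fin: "finite (E ` ball 0 r)"
    obtain i j where ij: "X $ i $ j \<noteq> 0" using X0 by (metis vec_eq_iff zero_index)
    have "(\<lambda>t. E t $ i $ j) ` ball 0 r = (\<lambda>M. M $ i $ j) ` (E ` ball 0 r)" by (simp add: image_image)
    then have "finite ((\<lambda>t. E t $ i $ j) ` ball 0 r)" using fin by simp
    then have "(\<lambda>t. E t $ i $ j) constant_on ball 0 r"
      by (intro continuous_finite_range_constant connected_ball contE)
    then obtain c where c: "\<And>t. t \<in> ball 0 r \<Longrightarrow> E t $ i $ j = c" unfolding constant_on_def by blast
    have "((\<lambda>t. c) has_field_derivative (X ** E 0) $ i $ j) (at 0)"
      by (rule has_field_derivative_transform_within_open[OF E open_ball[of 0 r]]) (use r c in auto)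
    then have "(X ** E 0) $ i $ j = 0" using DERIV_const DERIV_unique by blast
    then show False using ij by (simp add: E0)
  qed
  then show ?thesis using sub finite_subset by blast
qed

text \<open>The functions \<open>F (A z) (A v)\<close> of the matrix \<open>A\<close> separate tangent vectors at the identity, since
  otherwise \<open>invariant_under_exponential\<close> contradicts finiteness. So as many of them as there are
  matrix entries form a map \<open>\<Phi>\<close> that is open at the identity. Left multiplication by a symmetry
  preserves \<open>\<Phi>\<close>, and therefore \<open>\<Phi>\<close> is open at every symmetry, with the same value.\<close>

lemma symmetry_matrices_card_le:
  fixes F :: "complex ^ 'm::finite \<Rightarrow> complex ^ 'm \<Rightarrow> complex"
  assumes F: "\<And>z v. z \<noteq> 0 \<Longrightarrow> polyfun D (\<lambda>x. F (vmat x *v z) (vmat x *v v))" and D: "D > 0"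
    and fin: "finite {A. invertible A \<and> (\<forall>z v. z \<noteq> 0 \<longrightarrow> F (A *v z) (A *v v) = F z v)}"
  shows "card {A. invertible A \<and> (\<forall>z v. z \<noteq> 0 \<longrightarrow> F (A *v z) (A *v v) = F z v)} \<le> D ^ (CARD('m)\<^sup>2)"
proof -
  let ?G = "{A. invertible A \<and> (\<forall>z v. z \<noteq> 0 \<longrightarrow> F (A *v z) (A *v v) = F z v)}"
  define P where "P = {p :: (complex ^ 'm) \<times> (complex ^ 'm). fst p \<noteq> 0}"
  define h where "h = (\<lambda>p x. F (vmat x *v fst p) (vmat x *v snd p))"
  have hp: "polyfun D (h p)" if "p \<in> P" for p using F that by (simp add: h_def P_def)
  obtain x1 :: "complex ^ ('m \<times> 'm)" where x1: "vmat x1 = mat 1" using exists_vmat by blast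
  have "\<forall>p. \<exists>L. p \<in> P \<longrightarrow> (h p has_derivative L) (at x1) \<and> (\<forall>c v. L (c *s v) = c * L v)"
    using holo_on_polyfun[OF hp, of _ UNIV] unfolding holo_on_def by blast
  then obtain L where L: "\<And>p. p \<in> P \<Longrightarrow> (h p has_derivative L p) (at x1)" "\<And>p c v. p \<in> P \<Longrightarrow> L p (c *s v) = c * L p v"
    by metis
  have Padd: "L p (x + y) = L p x + L p y" if "p \<in> P" for p x y
    using has_derivative_linear[OF L(1)[OF that]] by (rule linear_add)
  define \<Lambda> where "\<Lambda> = (\<lambda>p x. if p \<in> P then L p x else 0)"
  have ker: "x = 0" if x: "\<And>p. \<Lambda> p x = 0" for x
  proof (rule ccontr)
    assume "x \<noteq> 0"
    then have "vmat x \<noteq> 0" by (auto simp: vmat_def vec_eq_iff)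
    moreover have "deriv (\<lambda>s. F (z + s *s (vmat x *v z)) (v + s *s (vmat x *v v))) 0 = 0" if z: "z \<noteq> 0" for z v
    proof -
      have p: "(z, v) \<in> P" using z by (simp add: P_def)
      have "deriv (\<lambda>s. h (z, v) (x1 + s *s x)) 0 = L (z, v) x"
        by (rule vmat_has_derivative_direction[OF L(1)[OF p] L(2)[OF p]])
      then show ?thesis using x[of "(z, v)"] p by (simp add: \<Lambda>_def h_def vmat_add_smult_vector x1)
    qed
    ultimately have "infinite ?G" by (intro invariant_under_exponential[where D = D and F = F and X = "vmat x"] F)
    then show False using fin by blast
  qed
  obtain J :: "'m \<times> 'm \<Rightarrow> (complex ^ 'm) \<times> (complex ^ 'm)" where J: "\<And>x. (\<And>i. \<Lambda> (J i) x = 0) \<Longrightarrow> x = 0"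
  proof (rule exists_separating_subfamily[of \<Lambda>])
    show "\<Lambda> p (x + y) = \<Lambda> p x + \<Lambda> p y" for p x y using Padd by (simp add: \<Lambda>_def)
    show "\<Lambda> p (c *s x) = c * \<Lambda> p x" for p c x using L(2) by (simp add: \<Lambda>_def)
    show "x = 0" if "\<And>p. \<Lambda> p x = 0" for x by (rule ker[OF that])
  qed blast
  obtain p0 where p0: "p0 \<in> P"
  proof -
    have "(1, 0) \<in> P" by (simp add: P_def)
    then show ?thesis using that by blast
  qed
  \<comment> \<open>Indices outside \<open>P\<close> carry the zero functional and may be replaced by an arbitrary element of \<open>P\<close>.\<close>
  define K where "K = (\<lambda>i. if J i \<in> P then J i else p0)"
  have KP: "K i \<in> P" for i using p0 by (simp add: K_def)
  have K: "x = 0" if "\<And>i. L (K i) x = 0" for x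
  proof (rule J)
    fix i show "\<Lambda> (J i) x = 0" using that[of i] by (auto simp: \<Lambda>_def K_def)
  qed
  define \<Phi> where "\<Phi> = (\<lambda>x. \<chi> i. h (K i) x)"
  have open1: "\<Phi> x1 \<in> interior (\<Phi> ` T)" if "open T" "x1 \<in> T" for T
  proof (rule open_image_of_nondegenerate[OF _ _ _ that, where D = "\<lambda>i. L (K i)"])
    show "holo_on UNIV (\<lambda>x. \<Phi> x $ i)" for i using holo_on_polyfun[OF hp[OF KP]] by (simp add: \<Phi>_def)
    show "((\<lambda>x. \<Phi> x $ i) has_derivative L (K i)) (at x1)" for i using L(1)[OF KP] by (simp add: \<Phi>_def)
    show "x = 0" if "\<And>i. L (K i) x = 0" for x by (rule K[OF that])
  qed
  define S where "S = {s. vmat s \<in> ?G}"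
  have injv: "inj (vmat :: complex ^ ('m \<times> 'm) \<Rightarrow> _)" by (auto simp: inj_def vmat_def vec_eq_iff)
  have imS: "vmat ` S = ?G"
  proof
    show "?G \<subseteq> vmat ` S"
    proof
      fix A assume A: "A \<in> ?G"
      obtain s where "vmat s = A" using exists_vmat by blast
      then show "A \<in> vmat ` S" using A by (auto simp: S_def)
    qed
  qed (auto simp: S_def)
  have finS: "finite S" using fin imS injv by (metis finite_imageD inj_on_subset subset_UNIV)
  have "card S \<le> D ^ CARD('m \<times> 'm)"
  proof (rule isolated_fibre_card_le[of D \<Phi> S "\<Phi> x1", OF D _ finS])
    show "polyfun D (\<lambda>x. \<Phi> x $ i)" for i using hp[OF KP] by (simp add: \<Phi>_def)
    fix s T assume s: "s \<in> S" and T: "open T" "s \<in> T"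
    define m where "m = (\<lambda>x. (\<chi> p. (vmat s ** vmat x) $ fst p $ snd p) :: complex ^ ('m \<times> 'm))"
    have vm: "vmat (m x) = vmat s ** vmat x" for x by (simp add: vmat_def m_def vec_eq_iff)
    have m1: "m x1 = s" using injD[OF injv, of "m x1" s] by (simp add: vm x1)
    have contm: "continuous_on UNIV m"
      unfolding m_def matrix_matrix_mult_def vmat_def by (auto intro!: continuous_intros)
    \<comment> \<open>Invariance of \<open>F\<close> is known at nonzero points only.\<close>
    define T' where "T' = m -` T \<inter> (\<Inter>i. {x. vmat x *v fst (K i) \<noteq> 0})"
    have "open {x. vmat x *v z \<noteq> 0}" for z :: "complex ^ 'm"
    proof -
      have "{x. vmat x *v z \<noteq> 0} = (\<Union>i. {x. (vmat x *v z) $ i \<noteq> 0})" by (auto simp: vec_eq_iff)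
      moreover have "open {x. (vmat x *v z) $ i \<noteq> 0}" for i
        by (intro open_Collect_neq holo_on_imp_continuous_on[OF holo_on_polyfun[OF polyfun_vmat_vector]] continuous_intros)
      ultimately show ?thesis by auto
    qed
    then have "open T'" unfolding T'_def by (intro open_Int open_vimage[OF T(1) contm] open_INT) auto
    moreover have "x1 \<in> T'" using m1 T(2) KP by (auto simp: T'_def x1 P_def)
    ultimately have "\<Phi> x1 \<in> interior (\<Phi> ` T')" by (rule open1)
    moreover have "\<Phi> ` T' \<subseteq> \<Phi> ` T"
    proof
      fix w assume "w \<in> \<Phi> ` T'"
      then obtain x where x: "x \<in> T'" "w = \<Phi> x" by blast
      have "h (K i) (m x) = h (K i) x" for i
      proof -
        have "vmat x *v fst (K i) \<noteq> 0" using x(1) unfolding T'_def by blast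
        then show ?thesis using s by (simp add: h_def vm S_def matrix_vector_mul_assoc[symmetric])
      qed
      then have "w = \<Phi> (m x)" using x(2) by (simp add: \<Phi>_def)
      then show "w \<in> \<Phi> ` T" using x(1) by (auto simp: T'_def)
    qed
    ultimately show "\<Phi> x1 \<in> interior (\<Phi> ` T)" using interior_mono by blast
  qed
  moreover have "card ?G = card S" using card_image[OF inj_on_subset[OF injv subset_UNIV], of S] imS by simp
  ultimately show ?thesis by (simp add: power2_eq_square)
qed

section \<open>Automorphisms of a web\<close>

lemma open_linear_preimage:
  fixes A :: "complex ^ 'n::finite ^ 'm::finite"
  assumes "open S" shows "open {z. A *v z \<in> S}"
proof -
  have "continuous_on UNIV (\<lambda>z. \<chi> i. (A *v z) $ i)"
    by (intro continuous_on_vec_lambda holo_on_imp_continuous_on holo_on_matrix_vector_mult)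
  then have "continuous_on UNIV (\<lambda>z. A *v z)" by simp
  from open_vimage[OF assms this] show ?thesis by (simp add: vimage_def)
qed

text \<open>The local forms of the web and of its pullback are unit multiples of \<open>F z v\<close> and \<open>F (A z) (A v)\<close>. The
  quotient of the unit factors is homogeneous of degree zero, so it is a function on projective
  space.\<close>

lemma symmetry_in_web_Aut:
  fixes U :: "'i \<Rightarrow> 'n::finite proj set" and F :: "complex ^ ('n option) \<Rightarrow> complex ^ ('n option) \<Rightarrow> complex"
    and u :: "'i \<Rightarrow> complex ^ ('n option) \<Rightarrow> complex" and \<omega> :: "'i \<Rightarrow> 'n ptangent \<Rightarrow> complex" and D :: nat
  assumes openU: "\<And>i. open (U i)"
    and F: "\<And>i z v. z \<noteq> 0 \<Longrightarrow> ppt z \<in> U i \<Longrightarrow> F z v = u i z * \<omega> i (ptan (z, v))"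
    and u: "\<And>i z. z \<noteq> 0 \<Longrightarrow> ppt z \<in> U i \<Longrightarrow> u i z \<noteq> 0" "\<And>i. holo_on {z. z \<noteq> 0 \<and> ppt z \<in> U i} (u i)"
      "\<And>i c z. z \<noteq> 0 \<Longrightarrow> ppt z \<in> U i \<Longrightarrow> c \<noteq> 0 \<Longrightarrow> u i (c *s z) = c ^ D * u i z"
    and A: "invertible A" and inv: "\<And>z v. z \<noteq> 0 \<Longrightarrow> F (A *v z) (A *v v) = F z v"
  shows "proj_lin A \<in> web_Aut U \<omega>"
proof -
  have openT: "open (proj_lin A -` U i \<inter> U j)" for i j
  proof -
    have "{z. z \<noteq> 0 \<and> ppt z \<in> proj_lin A -` U i} = {z. A *v z \<in> {w. w \<noteq> 0 \<and> ppt w \<in> U i}}"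
    proof (rule Collect_cong)
      fix z show "z \<noteq> 0 \<and> ppt z \<in> proj_lin A -` U i \<longleftrightarrow> A *v z \<in> {w. w \<noteq> 0 \<and> ppt w \<in> U i}"
        using proj_lin_ppt[OF A, of z] invertible_nonzero[OF A, of z] by (cases "z = 0") auto
    qed
    then have "open (proj_lin A -` U i)"
      unfolding open_proj_def using open_linear_preimage[OF open_proj_preimage[OF openU[of i]], of A] by simp
    then show ?thesis using openU by blast
  qed
  have "unit_multiple (proj_lin A -` U i \<inter> U j) (\<lambda>\<tau>. \<omega> i (proj_differential (proj_lin A) \<tau>)) (\<omega> j)" for i j
  proof -
    define g where "g = (\<lambda>x. u j (rep_proj x) / u i (A *v rep_proj x))"
    have g: "g (ppt z) = u j z / u i (A *v z)"
      if z: "z \<noteq> 0" "ppt z \<in> U j" "ppt (A *v z) \<in> U i" for z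
    proof -
      obtain c where c: "c \<noteq> 0" "rep_proj (ppt z) = c *s z"
        using ppt_eq_iff[OF z(1) rep_proj_nonzero, of "ppt z"] by auto
      have "g (ppt z) = u j (c *s z) / u i (c *s (A *v z))" by (simp add: g_def c(2) matrix_vector_smult)
      also have "\<dots> = u j z / u i (A *v z)"
        unfolding u(3)[OF z(1,2) c(1)] u(3)[OF invertible_nonzero[OF A z(1)] z(3) c(1)] using c(1) by simp
      finally show ?thesis .
    qed
    have "holo_fun (proj_lin A -` U i \<inter> U j) g"
      unfolding holo_fun_def
    proof (intro allI impI)
      fix B :: "complex ^ ('n option) ^ ('n option)" assume B: "invertible B"
      let ?W = "chart B -` (proj_lin A -` U i \<inter> U j)"
      have W: "ppt (B *v aff_point x) \<in> U j" "ppt (A *v (B *v aff_point x)) \<in> U i" if "x \<in> ?W" for x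
        using that proj_lin_ppt[OF A chart_nonzero[OF B, of x]] by (auto simp: chart_def)
      have aff: "holo_on ?W (\<lambda>x. (M *v aff_point x) $ b)" for M :: "complex ^ ('n option) ^ ('n option)" and b
      proof -
        have "holo_on ?W (\<lambda>x. aff_point x $ c)" for c by (cases c) auto
        then show ?thesis unfolding matrix_vector_mult_def by (auto intro!: holo_on_sum holo_on_mult)
      qed
      have "holo_on ?W (\<lambda>x. u j (B *v aff_point x) / u i (A *v (B *v aff_point x)))"
      proof (rule holo_on_divide)
        show "holo_on ?W (\<lambda>x. u j (B *v aff_point x))"
          by (rule holo_on_compose[OF aff u(2)]) (use W chart_nonzero[OF B] in auto)
        have "holo_on ?W (\<lambda>x. u i ((A ** B) *v aff_point x))"
          by (rule holo_on_compose[OF aff u(2)])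
             (use W invertible_nonzero[OF A chart_nonzero[OF B]] in \<open>auto simp: matrix_vector_mul_assoc[symmetric]\<close>)
        then show "holo_on ?W (\<lambda>x. u i (A *v (B *v aff_point x)))" by (simp add: matrix_vector_mul_assoc)
        show "u i (A *v (B *v aff_point x)) \<noteq> 0" if "x \<in> ?W" for x
          using u(1)[OF invertible_nonzero[OF A chart_nonzero[OF B]]] W(2)[OF that] by blast
      qed
      moreover have "u j (B *v aff_point x) / u i (A *v (B *v aff_point x)) = g (chart B x)" if "x \<in> ?W" for x
        using g[OF chart_nonzero[OF B] W[OF that]] by (simp add: chart_def)
      ultimately show "holo_on ?W (\<lambda>x. g (chart B x))"
        by (rule holo_on_cong[OF open_chart_preimage[OF openT B]])
    qed
    moreover have "g x \<noteq> 0" if x: "x \<in> proj_lin A -` U i \<inter> U j" for x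
    proof -
      obtain z where z: "z \<noteq> 0" "x = ppt z" by (rule proj_cases)
      have zU: "ppt z \<in> U j" "ppt (A *v z) \<in> U i" using x proj_lin_ppt[OF A z(1)] by (auto simp: z(2))
      show ?thesis unfolding z(2) g[OF z(1) zU] using u(1)[OF z(1) zU(1)] u(1)[OF invertible_nonzero[OF A z(1)] zU(2)] by simp
    qed
    moreover have "\<omega> i (proj_differential (proj_lin A) \<tau>) = g (base_point \<tau>) * \<omega> j \<tau>"
      if t: "base_point \<tau> \<in> proj_lin A -` U i \<inter> U j" for \<tau>
    proof -
      obtain z v where z: "z \<noteq> 0" "\<tau> = ptan (z, v)" by (rule ptan_cases)
      have zU: "ppt z \<in> U j" "ppt (A *v z) \<in> U i"
        using t proj_lin_ppt[OF A z(1)] by (auto simp: z base_point_ptan)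
      note Az = invertible_nonzero[OF A z(1)]
      have "u i (A *v z) * \<omega> i (ptan (A *v z, A *v v)) = u j z * \<omega> j (ptan (z, v))"
        using inv[OF z(1), of v] F[OF z(1) zU(1), of v] F[OF Az zU(2), of "A *v v"] by simp
      then have "\<omega> i (ptan (A *v z, A *v v)) = u j z / u i (A *v z) * \<omega> j (ptan (z, v))"
        using u(1)[OF Az zU(2)] by (simp add: field_simps)
      moreover have "proj_differential (proj_lin A) \<tau> = ptan (A *v z, A *v v)"
        unfolding z(2) by (rule proj_differential_linear[OF A proj_lin_ppt[OF A] holo_map_proj_lin[OF A] z(1)])
      ultimately show ?thesis using g[OF z(1) zU] by (simp add: z base_point_ptan)
    qed
    ultimately show ?thesis unfolding unit_multiple_def by blast
  qed
  then show ?thesis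
    unfolding web_Aut_def same_web_def using proj_lin_in_proj_Aut[OF A] by blast
qed

text \<open>On each piece of the covering \<open>F (A z) (A v)\<close> is a unit multiple of \<open>F z v\<close>. Where \<open>F z q \<noteq> 0\<close> the unit is
  determined by \<open>F\<close>, and this locus is dense, so the local units agree on overlaps. They form a
  homogeneous function of degree zero, which is constant.\<close>

lemma web_Aut_symmetry:
  fixes U :: "'i \<Rightarrow> 'n::finite proj set" and F :: "complex ^ ('n option) \<Rightarrow> complex ^ ('n option) \<Rightarrow> complex"
    and u :: "'i \<Rightarrow> complex ^ ('n option) \<Rightarrow> complex" and \<omega> :: "'i \<Rightarrow> 'n ptangent \<Rightarrow> complex" and D :: nat
  assumes openU: "\<And>i. open (U i)" and coverU: "\<And>x. \<exists>i. x \<in> U i"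
    and F: "\<And>i z v. z \<noteq> 0 \<Longrightarrow> ppt z \<in> U i \<Longrightarrow> F z v = u i z * \<omega> i (ptan (z, v))"
    and u: "\<And>i z. z \<noteq> 0 \<Longrightarrow> ppt z \<in> U i \<Longrightarrow> u i z \<noteq> 0" "\<And>i. holo_on {z. z \<noteq> 0 \<and> ppt z \<in> U i} (u i)"
      "\<And>i c z. z \<noteq> 0 \<Longrightarrow> ppt z \<in> U i \<Longrightarrow> c \<noteq> 0 \<Longrightarrow> u i (c *s z) = c ^ D * u i z"
    and Fq: "polyfun N (\<lambda>z. F z q)" "\<exists>z. z \<noteq> 0 \<and> F z q \<noteq> 0"
    and T: "T \<in> web_Aut U \<omega>"
  obtains A c where "invertible A" "T = proj_lin A" "c \<noteq> 0"
    "\<And>z v. z \<noteq> 0 \<Longrightarrow> F (A *v z) (A *v v) = c * F z v"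
proof -
  have TA: "T \<in> proj_Aut" and same: "\<And>i j. unit_multiple (T -` U i \<inter> U j) (\<lambda>\<tau>. \<omega> i (proj_differential T \<tau>)) (\<omega> j)"
    using T unfolding web_Aut_def same_web_def by auto
  obtain A where A: "invertible A" "\<And>z. z \<noteq> 0 \<Longrightarrow> T (ppt z) = ppt (A *v z)" using proj_Aut_linear[OF TA] by metis
  have Tlin: "T = proj_lin A"
  proof
    fix x show "T x = proj_lin A x"
      by (rule proj_cases[of x]) (use A proj_lin_ppt[OF A(1)] in auto)
  qed
  have hT: "holo_map T" using TA unfolding proj_Aut_def by blast
  have "\<forall>i j. \<exists>g. holo_fun (T -` U i \<inter> U j) g \<and> (\<forall>x\<in>T -` U i \<inter> U j. g x \<noteq> 0) \<and>
        (\<forall>\<tau>. base_point \<tau> \<in> T -` U i \<inter> U j \<longrightarrow> \<omega> i (proj_differential T \<tau>) = g (base_point \<tau>) * \<omega> j \<tau>)"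
    using same unfolding unit_multiple_def by blast
  then obtain g where g: "\<And>i j. holo_fun (T -` U i \<inter> U j) (g i j)" "\<And>i j x. x \<in> T -` U i \<inter> U j \<Longrightarrow> g i j x \<noteq> 0"
    "\<And>i j \<tau>. base_point \<tau> \<in> T -` U i \<inter> U j \<Longrightarrow> \<omega> i (proj_differential T \<tau>) = g i j (base_point \<tau>) * \<omega> j \<tau>"
    by metis
  define W where "W = (\<lambda>(i, j). {z. z \<noteq> 0 \<and> ppt (A *v z) \<in> U i \<and> ppt z \<in> U j})"
  define H where "H = (\<lambda>(i, j) z. u i (A *v z) * g i j (ppt z) / u j z)"
  note Anz = invertible_nonzero[OF A(1)]
  have openAi: "open {z. z \<noteq> 0 \<and> ppt (A *v z) \<in> U i}" for i
  proof -
    have "{z. z \<noteq> 0 \<and> ppt (A *v z) \<in> U i} = {z. A *v z \<in> {w. w \<noteq> 0 \<and> ppt w \<in> U i}}"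
    proof (rule Collect_cong)
      fix z show "z \<noteq> 0 \<and> ppt (A *v z) \<in> U i \<longleftrightarrow> A *v z \<in> {w. w \<noteq> 0 \<and> ppt w \<in> U i}"
        using Anz[of z] by (cases "z = 0") auto
    qed
    then show ?thesis using open_linear_preimage[OF open_proj_preimage[OF openU[of i]], of A] by simp
  qed
  have openT: "open (T -` U i)" for i
  proof -
    have "{z. z \<noteq> 0 \<and> ppt z \<in> T -` U i} = {z. z \<noteq> 0 \<and> ppt (A *v z) \<in> U i}" using A(2) by auto
    then show ?thesis unfolding open_proj_def using openAi[of i] by simp
  qed
  have W: "W (i, j) = {z. z \<noteq> 0 \<and> ppt z \<in> T -` U i \<inter> U j}" for i j
    using A(2) by (auto simp: W_def)
  have openW: "open (W a)" for a
    using open_proj_preimage[OF open_Int[OF openT openU]] W by (cases a) simp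
  have coverW: "\<exists>a. z \<in> W a" if "z \<noteq> 0" for z
    using coverU[of "ppt z"] coverU[of "ppt (A *v z)"] that by (auto simp: W_def)
  have FH: "F (A *v z) (A *v v) = H a z * F z v" if z: "z \<in> W a" for a z v
  proof -
    obtain i j where a: "a = (i, j)" by (cases a)
    have z0: "z \<noteq> 0" and zi: "ppt (A *v z) \<in> U i" and zj: "ppt z \<in> U j" using z by (auto simp: a W_def)
    have "ppt z \<in> T -` U i \<inter> U j" using zi zj A(2)[OF z0] by simp
    then have "\<omega> i (ptan (A *v z, A *v v)) = g i j (ppt z) * \<omega> j (ptan (z, v))"
      using g(3)[of "ptan (z, v)" i j] proj_differential_linear[OF A hT z0] by (simp add: base_point_ptan[OF z0])
    then show ?thesis
      using F[OF Anz[OF z0] zi, of "A *v v"] F[OF z0 zj, of v] u(1)[OF z0 zj] by (simp add: a H_def)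
  qed
  have holoH: "holo_on (W a) (H a)" for a
  proof -
    obtain i j where a: "a = (i, j)" by (cases a)
    have "holo_on (W a) (\<lambda>z. u i (A *v z))"
      by (rule holo_on_compose[OF holo_on_matrix_vector_mult u(2)]) (use Anz in \<open>auto simp: a W_def\<close>)
    moreover have "holo_on (W a) (\<lambda>z. g i j (ppt z))"
      unfolding a W by (rule holo_on_holo_fun[OF g(1) open_Int[OF openT openU]])
    moreover have "holo_on (W a) (u j)" by (rule holo_on_subset[OF u(2)]) (auto simp: a W_def)
    ultimately show ?thesis
      unfolding a H_def prod.case by (intro holo_on_divide holo_on_mult) (use u(1) in \<open>auto simp: W_def\<close>)
  qed
  have H0: "H a z \<noteq> 0" if "z \<in> W a" for a z
  proof -
    obtain i j where a: "a = (i, j)" by (cases a)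
    have "ppt z \<in> T -` U i \<inter> U j" using that unfolding a W by blast
    moreover have "z \<noteq> 0" "ppt (A *v z) \<in> U i" "ppt z \<in> U j" using that by (auto simp: a W_def)
    ultimately show ?thesis using g(2) u(1)[OF Anz] u(1) by (simp add: a H_def)
  qed
  have dense: "\<exists>w\<in>S. F w q \<noteq> 0" if "open S" "S \<noteq> {}" for S
    using polyfun_zero_on_open[OF Fq(1) that] Fq(2) by blast
  have Heq: "H a z = H b z" if zab: "z \<in> W a" "z \<in> W b" for a b z
  proof (rule ccontr)
    assume ne: "H a z \<noteq> H b z"
    have "open (W a \<inter> W b)" using openW by blast
    moreover have "continuous_on (W a \<inter> W b) (\<lambda>z. H a z - H b z)"
      using holo_on_imp_continuous_on[OF holo_on_subset[OF holoH]] by (intro continuous_intros) auto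
    ultimately have "open ((W a \<inter> W b) \<inter> (\<lambda>z. H a z - H b z) -` (- {0}))"
      by (intro continuous_open_preimage) (auto simp: open_Compl)
    moreover have "z \<in> (W a \<inter> W b) \<inter> (\<lambda>z. H a z - H b z) -` (- {0})" using zab ne by simp
    ultimately obtain w where w: "w \<in> W a" "w \<in> W b" "H a w \<noteq> H b w" "F w q \<noteq> 0" using dense by fastforce
    have "H a w * F w q = H b w * F w q" using FH[OF w(1), of q] FH[OF w(2), of q] by metis
    then show False using w(3,4) by simp
  qed
  define h where "h = (\<lambda>z. H (SOME a. z \<in> W a) z)"
  have hH: "h z = H a z" if "z \<in> W a" for z a
    unfolding h_def by (rule Heq[OF someI that]) (rule that)
  have "holo_on (- {0}) h"
  proof (rule holo_on_local)
    fix z :: "complex ^ ('n option)" assume "z \<in> - {0}"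
    then have "z \<noteq> 0" by simp
    then obtain a where a: "z \<in> W a" using coverW by blast
    have "holo_on (W a) h" by (rule holo_on_cong[OF openW holoH]) (simp add: hH)
    then show "\<exists>W. open W \<and> z \<in> W \<and> holo_on W h" using a openW by blast
  qed
  moreover have "h (c *s z) = c ^ 0 * h z" if c: "c \<noteq> 0" and z: "z \<noteq> 0" for c z
  proof -
    obtain a where a: "z \<in> W a" using coverW[OF z] by blast
    obtain i j where ij: "a = (i, j)" by (cases a)
    have zi: "ppt (A *v z) \<in> U i" and zj: "ppt z \<in> U j" using a by (auto simp: ij W_def)
    have p: "ppt (c *s z) = ppt z" "ppt (c *s (A *v z)) = ppt (A *v z)"
      using ppt_smult[OF z c] ppt_smult[OF Anz[OF z] c] by auto
    have ca: "c *s z \<in> W a" using z c zi zj p by (simp add: ij W_def matrix_vector_smult)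
    have "H a (c *s z) = u i (c *s (A *v z)) * g i j (ppt z) / u j (c *s z)"
      by (simp add: ij H_def p matrix_vector_smult)
    also have "\<dots> = H a z"
      unfolding u(3)[OF Anz[OF z] zi c] u(3)[OF z zj c] using c by (simp add: ij H_def)
    finally show ?thesis using hH[OF a] hH[OF ca] by simp
  qed
  moreover have "CARD('n option) \<ge> 2" by (simp add: card_UNIV_option Suc_le_eq)
  ultimately obtain p where p: "polyfun 0 p" "\<And>z. z \<noteq> 0 \<Longrightarrow> h z = p z"
    using holo_on_homogeneous_polynomial[of h 0] by blast
  have hc: "h z = p 0" if "z \<noteq> 0" for z using p(2)[OF that] polyfun_0_constant[OF p(1)] by metis
  show ?thesis
  proof (rule that[OF A(1) Tlin, of "p 0"])
    fix z v :: "complex ^ ('n option)" assume z: "z \<noteq> 0"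
    obtain a where a: "z \<in> W a" using coverW[OF z] by blast
    show "F (A *v z) (A *v v) = p 0 * F z v" using FH[OF a] hH[OF a] hc[OF z] by simp
  next
    have one: "(1 :: complex ^ ('n option)) \<noteq> 0" by simp
    obtain a where a: "(1 :: complex ^ ('n option)) \<in> W a" using coverW[OF one] by blast
    show "p 0 \<noteq> 0" using H0[OF a] hH[OF a] hc[OF one] by simp
  qed
qed

text \<open>Elementary matrices already give infinitely many.\<close>

lemma infinite_proj_lin: "infinite {proj_lin A | A :: complex ^ ('n::finite option) ^ ('n option). invertible A}"
proof
  assume fin: "finite {proj_lin A | A :: complex ^ ('n option) ^ ('n option). invertible A}"
  obtain j :: 'n where True by simp
  define M where "M = (\<lambda>t :: complex. (\<chi> a b. (if a = b then 1 else 0) + (if a = None \<and> b = Some j then t else 0))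
      :: complex ^ ('n option) ^ ('n option))"
  have M: "(M t *v x) $ a = x $ a + (if a = None then t * x $ Some j else 0)" for t x a
    by (cases a)
       (simp_all add: M_def matrix_vector_mult_def distrib_right sum.distrib if_distrib[of "\<lambda>y. y * _"] cong: if_cong)
  have "M t ** M (- t) = mat 1" for t
    unfolding matrix_eq matrix_vector_mul_assoc[symmetric] by (simp add: vec_eq_iff M)
  then have inv: "invertible (M t)" for t unfolding invertible_right_inverse by blast
  have "inj (\<lambda>t. proj_lin (M t))"
  proof (rule injI)
    fix s t assume "proj_lin (M s) = proj_lin (M t)"
    then obtain c where c: "\<And>z. M t *v z = c *s (M s *v z)" using proj_lin_eqD[OF inv inv] by metis
    have eq: "(M t *v z) $ a = c * (M s *v z) $ a" for z a unfolding c by simp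
    show "s = t" using eq[of "axis (Some j) 1" "Some j"] eq[of "axis (Some j) 1" None] by (simp add: M axis_def)
  qed
  then have "infinite (range (\<lambda>t. proj_lin (M t)))" using finite_imageD infinite_UNIV_char_0 by blast
  moreover have "range (\<lambda>t. proj_lin (M t)) \<subseteq> {proj_lin A | A. invertible A}" using inv by blast
  ultimately show False using fin finite_subset by blast
qed

text \<open>With \<open>G\<close> the group of invertible matrices that preserve \<open>F\<close>, the products of the \<open>D\<close>-th roots of unity
  with one chosen matrix of \<open>G\<close> for each automorphism are distinct elements of \<open>G\<close>. The case \<open>D = 0\<close> does
  not occur: then \<open>F\<close> would be preserved by all matrices.\<close>

theorem proposition3p1:
  fixes U :: "'i \<Rightarrow> 'n::finite proj set"
    and \<omega> :: "'i \<Rightarrow> 'n ptangent \<Rightarrow> complex"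
    and k d :: nat
  assumes "CARD('n) \<ge> 2"
    and "is_web k U \<omega>"
    and "web_degree U \<omega> d"
    and "finite (web_Aut U \<omega>)"
  shows "card (web_Aut U \<omega>) \<le> (d + 2 * k) ^ ((CARD('n) + 1)\<^sup>2 - 1)"
proof -
  define D where "D = d + 2 * k"
  obtain F u q N where
    Fpoly: "\<And>z v. z \<noteq> 0 \<Longrightarrow> polyfun D (\<lambda>x. F (vmat x *v z) (vmat x *v v))"
    and F: "\<And>i z v. z \<noteq> 0 \<Longrightarrow> ppt z \<in> U i \<Longrightarrow> F z v = u i z * \<omega> i (ptan (z, v))"
    and u: "\<And>i z. z \<noteq> 0 \<Longrightarrow> ppt z \<in> U i \<Longrightarrow> u i z \<noteq> 0"
      "\<And>i. holo_on {z. z \<noteq> 0 \<and> ppt z \<in> U i} (u i)"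
      "\<And>i c z. z \<noteq> 0 \<Longrightarrow> ppt z \<in> U i \<Longrightarrow> c \<noteq> 0 \<Longrightarrow> u i (c *s z) = c ^ D * u i z"
    and Fq: "polyfun N (\<lambda>z. F z q)" "\<exists>z. z \<noteq> 0 \<and> F z q \<noteq> 0"
    unfolding D_def by (rule web_polynomial_form[OF assms(2,3)]) blast
  have openU: "open (U i)" and coverU: "\<exists>i. x \<in> U i" for i x
    using assms(2) unfolding is_web_def by auto
  let ?G = "{A. invertible A \<and> (\<forall>z v. z \<noteq> 0 \<longrightarrow> F (A *v z) (A *v v) = F z v)}"
  have GAut: "proj_lin A \<in> web_Aut U \<omega>" if "A \<in> ?G" for A
    by (rule symmetry_in_web_Aut[OF openU F u]) (use that in auto)
  have Fhom: "F (c *s z) (c *s v) = c ^ D * F z v" if z: "z \<noteq> 0" and c: "c \<noteq> 0" for c z v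
  proof -
    obtain i where i: "ppt z \<in> U i" using coverU by blast
    have ci: "ppt (c *s z) \<in> U i" "c *s z \<noteq> 0" using ppt_smult[OF z c] i z c by auto
    have "ptan (c *s z, c *s v) = ptan (z, v)"
    proof -
      have "c *s v = c *s v + 0 *s z" by simp
      then show ?thesis using ptan_eq_iff[OF z ci(2), of v "c *s v"] c by metis
    qed
    then show ?thesis using F[OF ci(2,1)] F[OF z i] u(3)[OF z i c] by simp
  qed
  have D: "D > 0"
  proof (rule ccontr)
    assume "\<not> D > 0"
    then have D0: "D = 0" by simp
    have "A \<in> ?G" if A: "invertible A" for A
    proof -
      have "F (A *v z) (A *v v) = F z v" if z: "z \<noteq> 0" for z v
      proof -
        obtain x y where "vmat x = A" "vmat y = (mat 1 :: complex ^ ('n option) ^ ('n option))"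
          using exists_vmat by metis
        then show ?thesis using polyfun_0_constant[OF Fpoly[OF z, of v, unfolded D0], of x y] by simp
      qed
      then show ?thesis using A by blast
    qed
    then have "{proj_lin A | A. invertible A} \<subseteq> web_Aut U \<omega>" using GAut by blast
    then show False using infinite_proj_lin assms(4) finite_subset by blast
  qed
  define \<mu> where "\<mu> = {z :: complex. z ^ D = 1}"
  have card\<mu>: "card \<mu> = D" "finite \<mu>"
  proof -
    show "card \<mu> = D" unfolding \<mu>_def by (rule card_roots_unity_eq[OF D])
    then show "finite \<mu>" using D card_ge_0_finite by metis
  qed
  define sc where "sc = (\<lambda>(c :: complex) (A :: complex ^ ('n option) ^ ('n option)). (\<chi> i j. c * A $ i $ j))"
  have scv: "sc c A *v z = c *s (A *v z)" for c A z
    by (simp add: sc_def matrix_vector_mult_def vec_eq_iff sum_distrib_left mult.assoc)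
  have sc_inv: "invertible (sc c A)" if "c \<noteq> 0" "invertible A" for c A
  proof -
    have "sc c A *v z = 0 \<Longrightarrow> z = 0" for z using invertible_nonzero[OF that(2), of z] that(1) by (auto simp: scv)
    then show ?thesis unfolding invertible_left_inverse matrix_left_invertible_ker by blast
  qed
  have sc_lin: "proj_lin (sc c A) = proj_lin A" if c: "c \<noteq> 0" and A: "invertible A" for c A
  proof
    fix x :: "'n proj"
    obtain z where z: "z \<noteq> 0" "x = ppt z" by (rule proj_cases)
    show "proj_lin (sc c A) x = proj_lin A x"
      unfolding z(2) proj_lin_ppt[OF sc_inv[OF that] z(1)] proj_lin_ppt[OF A z(1)] scv
      by (rule ppt_smult[OF invertible_nonzero[OF A z(1)] c])
  qed
  have scF: "F (sc c A *v z) (sc c A *v v) = c ^ D * F (A *v z) (A *v v)" if "c \<noteq> 0" "invertible A" "z \<noteq> 0" for c A z v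
    unfolding scv by (rule Fhom[OF invertible_nonzero[OF that(2,3)] that(1)])
  have exM: "\<exists>A. A \<in> ?G \<and> proj_lin A = T" if T: "T \<in> web_Aut U \<omega>" for T
  proof -
    obtain A c where A: "invertible A" "T = proj_lin A" "c \<noteq> 0"
      "\<And>z v. z \<noteq> 0 \<Longrightarrow> F (A *v z) (A *v v) = c * F z v"
      by (rule web_Aut_symmetry[OF openU coverU F u Fq T]) (assumption | blast)+
    have "card {z :: complex. z ^ D = 1 / c} = D" by (rule card_nth_roots) (use A(3) D in auto)
    then obtain b where b: "b ^ D = 1 / c" using D by (metis (mono_tags, lifting) card.empty empty_Collect_eq less_irrefl)
    then have b0: "b \<noteq> 0" using A(3) D by (auto simp: power_0_left)
    have "sc b A \<in> ?G" using sc_inv[OF b0 A(1)] scF[OF b0 A(1)] A(3,4) b by simp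
    then show ?thesis using sc_lin[OF b0 A(1)] A(2) by blast
  qed
  define M where "M = (\<lambda>T. SOME A. A \<in> ?G \<and> proj_lin A = T)"
  have M: "M T \<in> ?G" "proj_lin (M T) = T" if "T \<in> web_Aut U \<omega>" for T
    using someI_ex[OF exM[OF that]] unfolding M_def by blast+
  have \<mu>0: "c \<noteq> 0" if "c \<in> \<mu>" for c using that D by (auto simp: \<mu>_def power_0_left)
  have inj: "inj_on (\<lambda>(c, T). sc c (M T)) (\<mu> \<times> web_Aut U \<omega>)"
  proof (rule inj_onI, clarify)
    fix c T c' T' assume c: "c \<in> \<mu>" "c' \<in> \<mu>" and T: "T \<in> web_Aut U \<omega>" "T' \<in> web_Aut U \<omega>"
      and eq: "sc c (M T) = sc c' (M T')"
    have iT: "invertible (M T)" "invertible (M T')" using M(1) T by auto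
    have "T = T'" using sc_lin[OF \<mu>0[OF c(1)] iT(1)] sc_lin[OF \<mu>0[OF c(2)] iT(2)] eq M(2) T by metis
    moreover have "c = c'"
    proof -
      have "M T *v 1 \<noteq> 0" by (rule invertible_nonzero[OF iT(1)]) simp
      then obtain i where i: "(M T *v 1) $ i \<noteq> 0" by (metis vec_eq_iff zero_index)
      have "sc c (M T) *v 1 = sc c' (M T) *v 1" using eq \<open>T = T'\<close> by simp
      then have "c * (M T *v 1) $ i = c' * (M T *v 1) $ i" unfolding scv by (metis vector_smult_component)
      then show ?thesis using i by simp
    qed
    ultimately show "c = c' \<and> T = T'" by simp
  qed
  have finG: "finite ?G"
  proof (rule finite_subset)
    show "?G \<subseteq> (\<lambda>(c, T). sc c (M T)) ` (\<mu> \<times> web_Aut U \<omega>)"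
    proof
      fix A assume A: "A \<in> ?G"
      define T where "T = proj_lin A"
      have T: "T \<in> web_Aut U \<omega>" unfolding T_def by (rule GAut[OF A])
      have iM: "invertible (M T)" and iA: "invertible A" using M(1)[OF T] A by auto
      obtain c where c: "c \<noteq> 0" "\<And>z. A *v z = c *s (M T *v z)"
        using proj_lin_eqD[OF iM iA] M(2)[OF T] T_def by metis
      have Asc: "A = sc c (M T)" unfolding matrix_eq scv using c(2) by blast
      obtain z where z: "z \<noteq> 0" "F z q \<noteq> 0" using Fq(2) by blast
      have "F (A *v z) (A *v q) = c ^ D * F (M T *v z) (M T *v q)" unfolding Asc by (rule scF[OF c(1) iM z(1)])
      moreover have "F (A *v z) (A *v q) = F z q" "F (M T *v z) (M T *v q) = F z q" using A M(1)[OF T] z(1) by auto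
      ultimately have "c ^ D = 1" using z(2) by simp
      then show "A \<in> (\<lambda>(c, T). sc c (M T)) ` (\<mu> \<times> web_Aut U \<omega>)" using Asc T by (auto simp: \<mu>_def)
    qed
    show "finite ((\<lambda>(c, T). sc c (M T)) ` (\<mu> \<times> web_Aut U \<omega>))" using card\<mu>(2) assms(4) by blast
  qed
  have "(\<lambda>(c, T). sc c (M T)) ` (\<mu> \<times> web_Aut U \<omega>) \<subseteq> ?G"
  proof clarify
    fix c T assume c: "c \<in> \<mu>" and T: "T \<in> web_Aut U \<omega>"
    have MT: "invertible (M T)" "\<And>z v. z \<noteq> 0 \<Longrightarrow> F (M T *v z) (M T *v v) = F z v" using M(1)[OF T] by auto
    show "invertible (sc c (M T)) \<and> (\<forall>z v. z \<noteq> 0 \<longrightarrow> F (sc c (M T) *v z) (sc c (M T) *v v) = F z v)"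
      using sc_inv[OF \<mu>0[OF c] MT(1)] scF[OF \<mu>0[OF c] MT(1)] MT(2) c by (simp add: \<mu>_def)
  qed
  then have "card (\<mu> \<times> web_Aut U \<omega>) \<le> card ?G" by (rule card_inj_on_le[OF inj _ finG])
  also have "card ?G \<le> D ^ (CARD('n option)\<^sup>2)" by (rule symmetry_matrices_card_le[OF Fpoly D finG])
  finally have "D * card (web_Aut U \<omega>) \<le> D ^ ((CARD('n) + 1)\<^sup>2)"
    by (simp add: card_cartesian_product card\<mu>(1) card_UNIV_option)
  also have "\<dots> = D * D ^ ((CARD('n) + 1)\<^sup>2 - 1)"
    by (subst power_Suc[symmetric]) simp
  finally have "card (web_Aut U \<omega>) \<le> D ^ ((CARD('n) + 1)\<^sup>2 - 1)"
    using D by (simp only: mult_le_cancel1)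
  then show ?thesis unfolding D_def .
qed

end
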